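(* Consider explicit Runge--Kutta schemes of order $p\in\mathbb{N}$ with stability function $$R(z)=\sum_{j=0}^p\frac{z^j}{j!}+\sum_{j=p+1}^s c_j\frac{z^j}{j!},\quad z\in\mathbb{C},\qquad c_{p+1}\neq1,$$ where $c_{p+1},\dots,c_s\in\mathbb{R}$ and $c_j=0$ for $j\ge s+1$. Consider the condition (C) on $c_{p+1}$: $$(-1)^{(p+1)/2}(1-c_{p+1})<0\ \text{ if } p \text{ is odd};\qquad 1+(-1)^{p/2}(c_{p+1}-1)\binom{p}{p/2}<0\ \text{ if } p\text{ is even}.$$ Let $\mathcal{L}_{AS}$ be the set of asymptotically stable, semi-dissipative matrices (of any dimension), and for $m\in\mathbb{N}_0$ let $\mathcal{L}_{AS}^m=\{\mathbf{L}\in\mathcal{L}_{AS}: m_{HC}(\mathbf{L})\le m\}$, where $m_{HC}$ is the hypocoercivity index. Then: (a) All explicit Runge--Kutta schemes of order $p\in\mathbb{N}$ are strongly stable with respect to $\mathcal{L}_{AS}^m$ if $m\in\mathbb{N}_0$ satisfies $2m+1\le p$. (b) An explicit Runge--Kutta scheme of order $p\in\mathbb{N}$ is not strongly stable with respect to $\mathcal{L}_{AS}$ if the coefficient $c_{p+1}$ satisfies (C). (c) If (C) holds and the matrix $\mathbf{L}\in\mathcal{L}_{AS}$ satisfies $2m_{HC}(\mathbf{L})+1>p$, then the considered Runge--Kutta scheme is not strongly stable with respect to the singleton $\{\mathbf{L}\}$. This means that the scheme is strongly stable with respect to $\mathcal{L}_{AS}^m$ but not strongly stable with respect to $\mathcal{L}_{AS}\setminus\mathcal{L}_{AS}^m$,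 for any $m\in\mathbb{N}$ with $2m+1\le p$.
   Context: Runge--Kutta scheme: for the linear system $\frac{du}{dt}=\mathbf{L}u$, $u(0)=u^0\in\mathbb{C}^n$, $\mathbf{L}\in\mathbb{C}^{n\times n}$, and time step $\tau>0$, an explicit Runge--Kutta method with $s$ stages is $$u^k=u^{k-1}+\tau\sum_{i=1}^s b_iK_i^k,\qquad K_i^k=\mathbf{L}\Big(u^{k-1}+\tau\sum_{j=1}^{i-1}a_{ij}K_j^k\Big),\quad i=1,\dots,s.$$ It can be written as $u^k=R(\tau\mathbf{L})u^{k-1}$ with a polynomial $R$, the stability function. "Order $p$" refers to the order for linear systems, and $R$ then has the form displayed in the claim (with $s\ge p$). Matrix notions: $\mathbf{L}\in\mathbb{C}^{n\times n}$ is asymptotically stable if all its eigenvalues have negative real part; it is semi-dissipative if its Hermitian part $\mathbf{L}_H=(\mathbf{L}+\mathbf{L}^* )/2$ is negative semi-definite. The skew-Hermitian part is $\mathbf{L}_S=(\mathbf{L}-\mathbf{L}^* )/2$. Hypocoercivity index: for a semi-dissipative $\mathbf{L}$, $m_{HC}(\mathbf{L})$ is the smallest $m\in\mathbb{N}_0$ (if it exists) such that $\sum_{j=0}^m\mathbf{L}_S^j\,\mathbf{L}_H\,(\mathbf{L}_S^* )^j<0$ (negative definite). Every $\mathbf{L}\in\mathcal{L}_{AS}$ has a finite hypocoercivity index. Strong stability with respect to a set $\mathcal{L}_0\subseteq\mathcal{L}_{AS}$: for every $\mathbf{L}\in\mathcal{L}_0$, $\mathbf{L}\in\mathbb{C}^{n\times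 n}$, the numerical solution satisfies $\|u^1\|\le\|u^0\|$ in the Euclidean norm for all $u^0\in\mathbb{C}^n$ and all sufficiently small time steps; i.e. there is $\tau_0=\tau_0(\mathbf{L})>0$ with $\|R(\tau\mathbf{L})u^0\|\le\|u^0\|$ for all $0<\tau\le\tau_0$ and all $u^0\in\mathbb{C}^n$. $\mathbb{N}=\{1,2,\dots\}$, $\mathbb{N}_0=\mathbb{N}\cup\{0\}$. *)

theory Defs
  imports
    "Jordan_Normal_Form.Matrix"
    "Jordan_Normal_Form.Char_Poly"
    "Jordan_Normal_Form.Schur_Decomposition"
    "HOL-Library.Extended_Nat"
begin

(* Matrices and vectors carry their dimension as a value, so that a set of type
   "complex mat set" may contain square matrices of all sizes. *)

definition vec_norm2 :: "complex vec \<Rightarrow> real" where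
  "vec_norm2 v = sqrt (\<Sum>i<dim_vec v. (cmod (v $ i))\<^sup>2)"

definition hermitian :: "complex mat \<Rightarrow> bool" where
  "hermitian A \<longleftrightarrow> mat_adjoint A = A"

(* (A *\<^sub>v v) \<bullet>c v is v^* A v, which is real for Hermitian A. *)

definition neg_semidefinite :: "complex mat \<Rightarrow> bool" where
  "neg_semidefinite A \<longleftrightarrow> hermitian A \<and>
     (\<forall>v \<in> carrier_vec (dim_row A). Re ((A *\<^sub>v v) \<bullet>c v) \<le> 0)"

definition neg_definite :: "complex mat \<Rightarrow> bool" where
  "neg_definite A \<longleftrightarrow> hermitian A \<and>
     (\<forall>v \<in> carrier_vec (dim_row A). v \<noteq> 0\<^sub>v (dim_row A) \<longrightarrow> Re ((A *\<^sub>v v) \<bullet>c v) < 0)"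

definition herm_part :: "complex mat \<Rightarrow> complex mat" where
  "herm_part L = (1 / 2) \<cdot>\<^sub>m (L + mat_adjoint L)"

definition skew_part :: "complex mat \<Rightarrow> complex mat" where
  "skew_part L = (1 / 2) \<cdot>\<^sub>m (L - mat_adjoint L)"

definition asymptotically_stable :: "complex mat \<Rightarrow> bool" where
  "asymptotically_stable L \<longleftrightarrow> (\<forall>z. eigenvalue L z \<longrightarrow> Re z < 0)"

definition semi_dissipative :: "complex mat \<Rightarrow> bool" where
  "semi_dissipative L \<longleftrightarrow> neg_semidefinite (herm_part L)"

definition hc_sum :: "complex mat \<Rightarrow> nat \<Rightarrow> complex mat" where
  "hc_sum L m = mat (dim_row L) (dim_row L) (\<lambda>rc. \<Sum>j\<le>m.
     (skew_part L ^\<^sub>m j * herm_part L * mat_adjoint (skew_part L) ^\<^sub>m j) $$ rc)"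

(* The infimum in enat is the least element if there is one, and \<infinity> otherwise. *)

definition hc_index :: "complex mat \<Rightarrow> enat" where
  "hc_index L = (INF m \<in> {m. neg_definite (hc_sum L m)}. enat m)"

definition L_AS :: "complex mat set" where
  "L_AS = {L. \<exists>n\<ge>1. L \<in> carrier_mat n n \<and> asymptotically_stable L \<and> semi_dissipative L}"

definition L_AS_hc :: "nat \<Rightarrow> complex mat set" where
  "L_AS_hc m = {L \<in> L_AS. hc_index L \<le> enat m}"

(* An explicit Runge-Kutta method is given by the number s of stages, the coefficients
   a i j (read only for 1 \<le> j < i \<le> s) and the weights b i (read only for 1 \<le> i \<le> s). *)

fun rk_stage :: "(nat \<Rightarrow> nat \<Rightarrow> real) \<Rightarrow> complex mat \<Rightarrow> real \<Rightarrow> complex vec \<Rightarrow> nat \<Rightarrow> complex vec" where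
  "rk_stage a L \<tau> u i =
     L *\<^sub>v (u + complex_of_real \<tau> \<cdot>\<^sub>v
             vec (dim_vec u) (\<lambda>r. \<Sum>j\<in>{1..<i}. complex_of_real (a i j) * rk_stage a L \<tau> u j $ r))"

declare rk_stage.simps [simp del]

definition rk_step ::
  "nat \<Rightarrow> (nat \<Rightarrow> nat \<Rightarrow> real) \<Rightarrow> (nat \<Rightarrow> real) \<Rightarrow> complex mat \<Rightarrow> real \<Rightarrow> complex vec \<Rightarrow> complex vec" where
  "rk_step s a b L \<tau> u =
     u + complex_of_real \<tau> \<cdot>\<^sub>v
       vec (dim_vec u) (\<lambda>r. \<Sum>i=1..s. complex_of_real (b i) * rk_stage a L \<tau> u i $ r)"

definition poly_mat :: "complex poly \<Rightarrow> complex mat \<Rightarrow> complex mat" where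
  "poly_mat R A = mat (dim_row A) (dim_row A) (\<lambda>rc. \<Sum>j\<le>degree R. coeff R j * (A ^\<^sub>m j) $$ rc)"

definition stability_function ::
  "nat \<Rightarrow> (nat \<Rightarrow> nat \<Rightarrow> real) \<Rightarrow> (nat \<Rightarrow> real) \<Rightarrow> complex poly \<Rightarrow> bool" where
  "stability_function s a b R \<longleftrightarrow>
     (\<forall>n\<ge>1. \<forall>L \<in> carrier_mat n n. \<forall>u \<in> carrier_vec n. \<forall>\<tau>>0.
        rk_step s a b L \<tau> u = poly_mat R (complex_of_real \<tau> \<cdot>\<^sub>m L) *\<^sub>v u)"

definition strongly_stable ::
  "nat \<Rightarrow> (nat \<Rightarrow> nat \<Rightarrow> real) \<Rightarrow> (nat \<Rightarrow> real) \<Rightarrow> complex mat set \<Rightarrow> bool" where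
  "strongly_stable s a b L0 \<longleftrightarrow>
     (\<forall>L \<in> L0. \<exists>\<tau>0>0. \<forall>\<tau>. 0 < \<tau> \<and> \<tau> \<le> \<tau>0 \<longrightarrow>
        (\<forall>u \<in> carrier_vec (dim_row L). vec_norm2 (rk_step s a b L \<tau> u) \<le> vec_norm2 u))"

definition condition_C :: "nat \<Rightarrow> real \<Rightarrow> bool" where
  "condition_C p x \<longleftrightarrow>
     (if odd p then (- 1) ^ ((p + 1) div 2) * (1 - x) < 0
      else 1 + (- 1) ^ (p div 2) * (x - 1) * real (p choose (p div 2)) < 0)"


(* Every explicit Runge-Kutta method has a stability function; stage_poly a i is
   \<tau> K_i as a polynomial in z = \<tau> L. *)

fun stage_poly :: "(nat \<Rightarrow> nat \<Rightarrow> real) \<Rightarrow> nat \<Rightarrow> complex poly" where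
  "stage_poly a i =
     pCons 0 (1 + (\<Sum>j\<in>{1..<i}. smult (complex_of_real (a i j)) (stage_poly a j)))"

declare stage_poly.simps [simp del]

lemma mult_vec_index:
  fixes A :: "complex mat"
  assumes "A \<in> carrier_mat n n" "v \<in> carrier_vec n" "r < n"
  shows "(A *\<^sub>v v) $ r = (\<Sum>k<n. A $$ (r, k) * v $ k)"
proof -
  have r: "r < dim_row A" and d: "dim_vec v = n" using assms by auto
  have "(A *\<^sub>v v) $ r = (\<Sum>k<n. row A r $ k * v $ k)"
    unfolding index_mult_mat_vec[OF r] scalar_prod_def d atLeast0LessThan ..
  also have "\<dots> = (\<Sum>k<n. A $$ (r, k) * v $ k)"
  proof (rule sum.cong[OF refl])
    fix k assume "k \<in> {..<n}"
    then have "row A r $ k = A $$ (r, k)" using r assms(1) index_row(1)[of r A k] by auto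
    then show "row A r $ k * v $ k = A $$ (r, k) * v $ k" by (rule arg_cong)
  qed
  finally show ?thesis .
qed

lemma poly_mat_vec_index:
  assumes A: "A \<in> carrier_mat n n" and u: "u \<in> carrier_vec n" and r: "r < n"
    and N: "degree R \<le> N"
  shows "(poly_mat R A *\<^sub>v u) $ r = (\<Sum>j\<le>N. coeff R j * (A ^\<^sub>m j *\<^sub>v u) $ r)"
proof -
  have P: "A ^\<^sub>m j \<in> carrier_mat n n" for j using A by simp
  have "(poly_mat R A *\<^sub>v u) $ r =
      (\<Sum>k<n. (\<Sum>j\<le>degree R. coeff R j * (A ^\<^sub>m j) $$ (r, k)) * u $ k)"
    using A u r by (simp add: poly_mat_def scalar_prod_def atLeast0LessThan)
  also have "\<dots> = (\<Sum>j\<le>degree R. \<Sum>k<n. coeff R j * (A ^\<^sub>m j) $$ (r, k) * u $ k)"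
    unfolding sum_distrib_right by (rule sum.swap)
  also have "\<dots> = (\<Sum>j\<le>degree R. coeff R j * (A ^\<^sub>m j *\<^sub>v u) $ r)"
  proof (rule sum.cong[OF refl])
    fix j
    have "(A ^\<^sub>m j *\<^sub>v u) $ r = (\<Sum>k<n. (A ^\<^sub>m j) $$ (r, k) * u $ k)"
      by (rule mult_vec_index[OF P u r])
    then show "(\<Sum>k<n. coeff R j * (A ^\<^sub>m j) $$ (r, k) * u $ k) = coeff R j * (A ^\<^sub>m j *\<^sub>v u) $ r"
      by (simp add: sum_distrib_left mult.assoc)
  qed
  also have "\<dots> = (\<Sum>j\<le>N. coeff R j * (A ^\<^sub>m j *\<^sub>v u) $ r)"
    by (rule sum.mono_neutral_left) (use N in \<open>auto simp: coeff_eq_0\<close>)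
  finally show ?thesis .
qed

lemma poly_mat_vec_carrier:
  assumes "A \<in> carrier_mat n n"
  shows "poly_mat R A *\<^sub>v u \<in> carrier_vec n" and "dim_vec (poly_mat R A *\<^sub>v u) = n"
proof -
  show "dim_vec (poly_mat R A *\<^sub>v u) = n"
    using carrier_matD(1)[OF assms] by (simp only: dim_mult_mat_vec poly_mat_def dim_row_mat)
  then show "poly_mat R A *\<^sub>v u \<in> carrier_vec n" by (rule carrier_vecI)
qed

lemma poly_mat_vec_add:
  assumes "A \<in> carrier_mat n n" "u \<in> carrier_vec n" "r < n"
  shows "(poly_mat (P + Q) A *\<^sub>v u) $ r = (poly_mat P A *\<^sub>v u) $ r + (poly_mat Q A *\<^sub>v u) $ r"
proof -
  let ?N = "max (degree P) (degree Q)"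
  have "degree (P + Q) \<le> ?N" by (rule degree_add_le_max)
  moreover have "degree P \<le> ?N" "degree Q \<le> ?N" by simp_all
  ultimately show ?thesis
    by (simp only: poly_mat_vec_index[OF assms] coeff_add distrib_right sum.distrib)
qed

lemma poly_mat_vec_smult:
  assumes "A \<in> carrier_mat n n" "u \<in> carrier_vec n" "r < n"
  shows "(poly_mat (smult k P) A *\<^sub>v u) $ r = k * (poly_mat P A *\<^sub>v u) $ r"
  unfolding poly_mat_vec_index[OF assms degree_smult_le]
  by (simp only: poly_mat_vec_index[OF assms order_refl] coeff_smult sum_distrib_left mult.assoc)

lemma poly_mat_vec_sum:
  assumes "A \<in> carrier_mat n n" "u \<in> carrier_vec n" "r < n" "finite S"
  shows "(poly_mat (\<Sum>j\<in>S. f j) A *\<^sub>v u) $ r = (\<Sum>j\<in>S. (poly_mat (f j) A *\<^sub>v u) $ r)"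
  using assms(4)
proof (induction S rule: finite_induct)
  case empty
  show ?case using poly_mat_vec_index[OF assms(1-3), of 0 0]
    by (simp del: index_mult_mat_vec)
next
  case (insert x S)
  then show ?case
    by (simp only: sum.insert[OF insert.hyps] poly_mat_vec_add[OF assms(1-3)])
qed

lemma poly_mat_vec_one:
  assumes "A \<in> carrier_mat n n" "u \<in> carrier_vec n" "r < n"
  shows "(poly_mat 1 A *\<^sub>v u) $ r = u $ r"
proof -
  have "A ^\<^sub>m 0 *\<^sub>v u = u" using assms(1,2) by simp
  then show ?thesis
    using poly_mat_vec_index[OF assms, of 1 0] by (simp del: index_mult_mat_vec)
qed

lemma poly_mat_vec_shift:
  assumes A: "A \<in> carrier_mat n n" and u: "u \<in> carrier_vec n" and r: "r < n"
  shows "(poly_mat (pCons 0 P) A *\<^sub>v u) $ r = (A *\<^sub>v (poly_mat P A *\<^sub>v u)) $ r"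
proof -
  let ?d = "degree P"
  have P: "A ^\<^sub>m j \<in> carrier_mat n n" for j using A by simp
  have S: "A ^\<^sub>m Suc j *\<^sub>v u = A *\<^sub>v (A ^\<^sub>m j *\<^sub>v u)" for j
  proof -
    have "A ^\<^sub>m Suc j = A * A ^\<^sub>m j"
    proof (induction j)
      case 0
      show ?case using A by simp
    next
      case (Suc j)
      have "A ^\<^sub>m Suc (Suc j) = (A * A ^\<^sub>m j) * A" by (simp only: pow_mat.simps(2)[of A "Suc j"] Suc.IH)
      also have "\<dots> = A * A ^\<^sub>m Suc j" using assoc_mult_mat[OF A P A] by (simp only: pow_mat.simps)
      finally show ?case .
    qed
    then show ?thesis by (simp only: assoc_mult_mat_vec[OF A P u])
  qed
  have "degree (pCons 0 P) \<le> Suc ?d" by (simp add: degree_pCons_le)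
  from poly_mat_vec_index[OF assms this]
  have "(poly_mat (pCons 0 P) A *\<^sub>v u) $ r =
      (\<Sum>j\<le>Suc ?d. coeff (pCons 0 P) j * (A ^\<^sub>m j *\<^sub>v u) $ r)" .
  also have "\<dots> = (\<Sum>j\<le>?d. coeff P j * (A ^\<^sub>m Suc j *\<^sub>v u) $ r)"
    by (simp only: sum.atMost_Suc_shift coeff_pCons_0 coeff_pCons_Suc mult_zero_left add_0)
  also have "\<dots> = (\<Sum>j\<le>?d. coeff P j * (\<Sum>k<n. A $$ (r, k) * (A ^\<^sub>m j *\<^sub>v u) $ k))"
  proof (rule sum.cong[OF refl])
    fix j
    have D: "A ^\<^sub>m j *\<^sub>v u \<in> carrier_vec n" using P[of j] u by simp
    show "coeff P j * (A ^\<^sub>m Suc j *\<^sub>v u) $ r =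
        coeff P j * (\<Sum>k<n. A $$ (r, k) * (A ^\<^sub>m j *\<^sub>v u) $ k)"
      unfolding S mult_vec_index[OF A D r] ..
  qed
  also have "\<dots> = (\<Sum>k<n. A $$ (r, k) * (\<Sum>j\<le>?d. coeff P j * (A ^\<^sub>m j *\<^sub>v u) $ k))"
    unfolding sum_distrib_left by (subst sum.swap) (simp add: mult.left_commute)
  also have "\<dots> = (\<Sum>k<n. A $$ (r, k) * (poly_mat P A *\<^sub>v u) $ k)"
    by (rule sum.cong[OF refl]) (simp add: poly_mat_vec_index[OF A u _ order_refl] del: index_mult_mat_vec)
  also have "\<dots> = (A *\<^sub>v (poly_mat P A *\<^sub>v u)) $ r"
    by (rule mult_vec_index[OF A poly_mat_vec_carrier(1)[OF A] r, symmetric])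
  finally show ?thesis .
qed

lemma rk_stage_poly:
  assumes L: "L \<in> carrier_mat n n" and u: "u \<in> carrier_vec n" and r: "r < n"
  shows "complex_of_real \<tau> * rk_stage a L \<tau> u i $ r =
     (poly_mat (stage_poly a i) (complex_of_real \<tau> \<cdot>\<^sub>m L) *\<^sub>v u) $ r"
  using r
proof (induction i arbitrary: r rule: less_induct)
  case (less i)
  let ?A = "complex_of_real \<tau> \<cdot>\<^sub>m L"
  have A: "?A \<in> carrier_mat n n" using L by simp
  define Q where "Q = 1 + (\<Sum>j\<in>{1..<i}. smult (complex_of_real (a i j)) (stage_poly a j))"
  define w where "w = u + complex_of_real \<tau> \<cdot>\<^sub>v
      vec (dim_vec u) (\<lambda>r. \<Sum>j\<in>{1..<i}. complex_of_real (a i j) * rk_stage a L \<tau> u j $ r)"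
  have w: "w \<in> carrier_vec n" using u by (simp add: w_def)
  have "w = poly_mat Q ?A *\<^sub>v u"
  proof (rule eq_vecI)
    show "dim_vec w = dim_vec (poly_mat Q ?A *\<^sub>v u)"
      using w poly_mat_vec_carrier(2)[OF A, of Q u] by (metis carrier_vecD)
    fix q assume "q < dim_vec (poly_mat Q ?A *\<^sub>v u)"
    then have q: "q < n" unfolding poly_mat_vec_carrier(2)[OF A] .
    have "w $ q = u $ q +
        (\<Sum>j\<in>{1..<i}. complex_of_real (a i j) * (complex_of_real \<tau> * rk_stage a L \<tau> u j $ q))"
      using u q by (simp add: w_def sum_distrib_left algebra_simps)
    also have "\<dots> = u $ q + (\<Sum>j\<in>{1..<i}. complex_of_real (a i j) *
          (poly_mat (stage_poly a j) ?A *\<^sub>v u) $ q)"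
    proof -
      have "complex_of_real (a i j) * (complex_of_real \<tau> * rk_stage a L \<tau> u j $ q) =
          complex_of_real (a i j) * (poly_mat (stage_poly a j) ?A *\<^sub>v u) $ q" if "j \<in> {1..<i}" for j
        using less.IH[of j, OF _ q] that by (simp only: atLeastLessThan_iff)
      then show ?thesis by (simp only: cong: sum.cong)
    qed
    also have "\<dots> = (poly_mat Q ?A *\<^sub>v u) $ q"
      unfolding Q_def poly_mat_vec_add[OF A u q] poly_mat_vec_one[OF A u q]
        poly_mat_vec_sum[OF A u q finite_atLeastLessThan] poly_mat_vec_smult[OF A u q] ..
    finally show "w $ q = (poly_mat Q ?A *\<^sub>v u) $ q" .
  qed
  moreover have "complex_of_real \<tau> * rk_stage a L \<tau> u i $ r = (?A *\<^sub>v w) $ r"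
  proof -
    have "rk_stage a L \<tau> u i = L *\<^sub>v w"
      by (subst rk_stage.simps) (simp only: w_def)
    then show ?thesis
      using mult_vec_index[OF L w less.prems] mult_vec_index[OF A w less.prems] L less.prems
      by (simp add: sum_distrib_left mult.assoc del: index_mult_mat_vec)
  qed
  moreover have "stage_poly a i = pCons 0 Q"
    by (subst stage_poly.simps) (simp add: Q_def)
  ultimately show ?case
    by (simp only: poly_mat_vec_shift[OF A u less.prems])
qed

lemma stability_function_exists:
  "stability_function s a b (1 + (\<Sum>i=1..s. smult (complex_of_real (b i)) (stage_poly a i)))"
  unfolding stability_function_def
proof (intro allI ballI impI)
  fix n :: nat and L :: "complex mat" and u :: "complex vec" and \<tau> :: real
  assume L: "L \<in> carrier_mat n n" and u: "u \<in> carrier_vec n"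
  let ?A = "complex_of_real \<tau> \<cdot>\<^sub>m L"
  let ?R = "1 + (\<Sum>i=1..s. smult (complex_of_real (b i)) (stage_poly a i))"
  have A: "?A \<in> carrier_mat n n" using L by simp
  show "rk_step s a b L \<tau> u = poly_mat ?R ?A *\<^sub>v u"
  proof (rule eq_vecI)
    show "dim_vec (rk_step s a b L \<tau> u) = dim_vec (poly_mat ?R ?A *\<^sub>v u)"
      unfolding poly_mat_vec_carrier(2)[OF A] using u by (simp add: rk_step_def)
    fix q assume "q < dim_vec (poly_mat ?R ?A *\<^sub>v u)"
    then have q: "q < n" unfolding poly_mat_vec_carrier(2)[OF A] .
    have "rk_step s a b L \<tau> u $ q = u $ q +
        (\<Sum>i=1..s. complex_of_real (b i) * (complex_of_real \<tau> * rk_stage a L \<tau> u i $ q))"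
      using u q by (simp add: rk_step_def sum_distrib_left algebra_simps)
    also have "\<dots> = (poly_mat ?R ?A *\<^sub>v u) $ q"
      unfolding rk_stage_poly[OF L u q] poly_mat_vec_add[OF A u q] poly_mat_vec_one[OF A u q]
        poly_mat_vec_sum[OF A u q finite_atLeastAtMost] poly_mat_vec_smult[OF A u q] ..
    finally show "rk_step s a b L \<tau> u $ q = (poly_mat ?R ?A *\<^sub>v u) $ q" .
  qed
qed

end

theory Submission
  imports Defs "HOL-Computational_Algebra.Fundamental_Theorem_Algebra"
begin

text \<open>
  For the orbit of a vector \<open>u\<close>, everything depends on the two real kernels
  \<open>G j k = Re \<langle>L^j u, L^k u\<rangle>\<close> and \<open>K j k = - Re \<langle>L_H L^j u, L^k u\<rangle>\<close>, related by
  \<open>G (j+1) k + G j (k+1) = - 2 K j k\<close>.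

  Stability: up to \<open>O(\<tau>^(p+1))\<close>, the energy loss in one step is twice the integral over \<open>[0, \<tau>]\<close> of the dissipation
  along \<open>exp (s L) u\<close>, a Hilbert-matrix form in the vectors \<open>\<tau>^j L^j u / j!\<close>. It is bounded below by a
  multiple of \<open>\<tau>^(2m+1) |u|^2\<close>, which dominates the error if \<open>2m+1 \<le> p\<close>.

  Instability: let \<open>q\<close> be \<open>p/2\<close> rounded up. If the index is at least \<open>q\<close>, some orbit has \<open>L_H L^j u = 0\<close> for \<open>j < q\<close>,
  so \<open>G\<close> alternates in sign along antidiagonals. For odd \<open>p\<close> the leading energy change has order
  \<open>\<tau>^(2q)\<close> and the sign of \<open>(-1)^q (c_(p+1) - 1)\<close>. For even \<open>p\<close> one takes moreover \<open>L_H L^q u \<noteq> 0\<close> and starts from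
  \<open>Q(\<tau>L) u\<close>, where \<open>Q\<close> is the denominator of the diagonal Pade approximant
  of \<open>exp\<close>: since \<open>exp(z) Q(z) = Q(-z) + O(z^(2q+1))\<close>, all terms below \<open>\<tau>^(2q+1)\<close> cancel,
  and this \<open>\<tau>\<close>-dependent choice produces the binomial coefficient in the condition on \<open>c_(p+1)\<close>.
\<close>

section \<open>Pade coefficients of the exponential\<close>

text \<open>The obstacle to stability is uniformity: \<tau>0 must serve all u, while the order in
  \<tau> at which energy is first lost jumps with u, so no leading term can be singled out. The
  Hilbert form avoids this, because its lower bound holds with one constant for all positive
  semidefinite kernels.

  In even order p = 2q, start at a fixed u with \<open>L_H L^j u = 0\<close> for j < q and
  \<open>L_H L^q u \<noteq> 0\<close>, and write B for (2q choose q). The leading energy change is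
  then a growth only if B + (-1)^q (c_(p+1) - 1) < 0, which is stricter than (C). The loss B is that
  of the exact flow, whose dissipative component is the monomial s^q / q! on [0, \<tau>]. Adding
  multiples of \<tau>^k L^k u to the start replaces it by a polynomial with the same leading term,
  and the least square integral belongs to the Legendre polynomial of [0, \<tau>]. The start
  Q(\<tau>L) u produces exactly this one and lowers B to 1 / B, which gives (C).

  The index is defined by powers of the adjoint of L_S, but the schemes see powers of L. On a vector
  the two agree up to sign until L_H first fails to vanish, so both describe the same
  kernels.\<close>

lemma alternating_binomial_sum:
  "n \<le> N \<Longrightarrow> (\<Sum>k\<le>n. (- 1) ^ k * real (n choose k) * real ((N - k) choose q)) =
     (if n \<le> q then real ((N - n) choose (q - n)) else 0)"
proof (induction n arbitrary: N q)
  case 0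
  then show ?case by simp
next
  case (Suc n)
  \<comment> \<open>The sum is the backward difference of order \<open>Suc n\<close> of
    \<open>N choose q\<close> in \<open>N\<close>. Pascal's rule for \<open>Suc n choose k\<close>
    splits off one difference; Pascal's rule for \<open>(N - k) choose q\<close> then turns this
    difference into a decrease of \<open>q\<close> by one.\<close>
  have "(\<Sum>k\<le>Suc n. (- 1) ^ k * real (Suc n choose k) * real ((N - k) choose q)) =
     real (N choose q) + (\<Sum>k\<le>n. - ((- 1) ^ k * real (Suc n choose Suc k) * real ((N - Suc k) choose q)))"
    by (simp add: sum.atMost_Suc_shift del: sum.atMost_Suc binomial_Suc_Suc)
  also have "\<dots> = (real (N choose q) + (\<Sum>k\<le>n. - ((- 1) ^ k * real (n choose Suc k) * real ((N - Suc k) choose q))))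
      - (\<Sum>k\<le>n. (- 1) ^ k * real (n choose k) * real ((N - 1 - k) choose q))"
    by (simp add: sum_subtractf algebra_simps sum.distrib sum_negf)
  also have "real (N choose q) + (\<Sum>k\<le>n. - ((- 1) ^ k * real (n choose Suc k) * real ((N - Suc k) choose q)))
     = (\<Sum>k\<le>Suc n. (- 1) ^ k * real (n choose k) * real ((N - k) choose q))"
    by (simp add: sum.atMost_Suc_shift del: sum.atMost_Suc)
  also have "\<dots> = (\<Sum>k\<le>n. (- 1) ^ k * real (n choose k) * real ((N - k) choose q))" by simp
  finally have *: "(\<Sum>k\<le>Suc n. (- 1) ^ k * real (Suc n choose k) * real ((N - k) choose q)) =
     (\<Sum>k\<le>n. (- 1) ^ k * real (n choose k) * (real ((N - k) choose q) - real ((N - 1 - k) choose q)))"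
    by (simp add: sum_subtractf[symmetric] algebra_simps)
  show ?case
  proof (cases q)
    case 0
    then show ?thesis unfolding * by simp
  next
    case (Suc q')
    have "(N - k) choose q = ((N - 1 - k) choose q) + ((N - 1 - k) choose q')" if "k \<le> n" for k
    proof -
      have "N - k = Suc (N - 1 - k)" using that Suc.prems by auto
      then show ?thesis using Suc by (metis add.commute binomial_Suc_Suc)
    qed
    then have "(\<Sum>k\<le>Suc n. (- 1) ^ k * real (Suc n choose k) * real ((N - k) choose q)) =
      (\<Sum>k\<le>n. (- 1) ^ k * real (n choose k) * real ((N - 1 - k) choose q'))"
      unfolding * by (intro sum.cong) auto
    also have "\<dots> = (if n \<le> q' then real ((N - 1 - n) choose (q' - n)) else 0)"
      by (rule Suc.IH) (use Suc.prems in auto)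
    finally show ?thesis using Suc by simp
  qed
qed

text \<open>A difference of order n + 1 applied to a polynomial of degree q \<le> n gives 0. Here
  its last term, k = n + 1, is missing; it would contain the generalized binomial coefficient of -1
  over q, which is (-1)^q, and the sum is minus that term. The induction on \<open>n\<close> avoids
  negative upper arguments.\<close>

lemma alternating_binomial_sum_boundary:
  "q \<le> n \<Longrightarrow> (\<Sum>k\<le>n. (- 1) ^ k * real (Suc n choose k) * real ((n - k) choose q)) = (- 1) ^ (n + q)"
proof (induction n rule: dec_induct)
  case base
  have "(\<Sum>k\<le>q. (- 1) ^ k * real (Suc q choose k) * real ((q - k) choose q))
    = (\<Sum>k\<in>{0}. (- 1) ^ k * real (Suc q choose k) * real ((q - k) choose q))"
    by (rule sum.mono_neutral_right) (auto intro!: binomial_eq_0)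
  then show ?case by (simp flip: mult_2)
next
  case (step n)
  have "(\<Sum>k\<le>Suc n. (- 1) ^ k * real (Suc (Suc n) choose k) * real ((Suc n - k) choose q)) =
     real (Suc n choose q) + (\<Sum>k\<le>n. - ((- 1) ^ k * real (Suc (Suc n) choose Suc k) * real ((n - k) choose q)))"
    by (simp add: sum.atMost_Suc_shift del: sum.atMost_Suc binomial_Suc_Suc)
  also have "\<dots> = (real (Suc n choose q) + (\<Sum>k\<le>n. - ((- 1) ^ k * real (Suc n choose Suc k) * real ((n - k) choose q))))
     - (\<Sum>k\<le>n. (- 1) ^ k * real (Suc n choose k) * real ((n - k) choose q))"
    by (subst binomial_Suc_Suc) (simp add: sum_subtractf algebra_simps sum.distrib sum_negf del: binomial_Suc_Suc)
  also have "real (Suc n choose q) + (\<Sum>k\<le>n. - ((- 1) ^ k * real (Suc n choose Suc k) * real ((n - k) choose q)))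
     = (\<Sum>k\<le>Suc n. (- 1) ^ k * real (Suc n choose k) * real ((Suc n - k) choose q))"
    by (simp add: sum.atMost_Suc_shift del: sum.atMost_Suc binomial_Suc_Suc)
  also have "\<dots> = 0" using alternating_binomial_sum[of "Suc n" "Suc n" q] step by simp
  finally show ?case using step by simp
qed

text \<open>For k \<le> q this is (-1)^k q! (2q-k)! / ((2q)! k! (q-k)!), the coefficient of z^k in
  the denominator of the diagonal Pade approximant of exp. The binomial coefficient makes it vanish
  for k > q without a case distinction, except when q = 0, where \<open>0 choose 0\<close> is
  1.\<close>

definition pade_coeff :: "nat \<Rightarrow> nat \<Rightarrow> real" where
  "pade_coeff q k = (- 1) ^ k * fact q ^ 2 / (fact (2 * q) * fact k) * real ((2 * q - k) choose q)"

lemma pade_coeff_0 [simp]: "pade_coeff q 0 = 1"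
proof -
  have "real ((2 * q) choose q) = fact (2 * q) / (fact q * fact q)"
    using binomial_fact[of q "2 * q", where 'a = real] by (simp add: mult_2)
  then show ?thesis by (simp add: pade_coeff_def power2_eq_square)
qed

lemma pade_coeff_eq_0: "q < k \<Longrightarrow> 1 \<le> q \<Longrightarrow> pade_coeff q k = 0"
  by (auto simp: pade_coeff_def intro!: binomial_eq_0)

lemma pade_coeff_convolution:
  "(\<Sum>k\<le>n. pade_coeff q k * (1 / fact (n - k))) =
     fact q ^ 2 / (fact (2 * q) * fact n) * (\<Sum>k\<le>n. (- 1) ^ k * real (n choose k) * real ((2 * q - k) choose q))"
proof -
  have "pade_coeff q k * (1 / fact (n - k)) =
     fact q ^ 2 / (fact (2 * q) * fact n) * ((- 1) ^ k * real (n choose k) * real ((2 * q - k) choose q))"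
    if "k \<le> n" for k
    using that by (simp add: pade_coeff_def binomial_fact field_simps)
  then show ?thesis by (simp add: sum_distrib_left)
qed

text \<open>The Taylor coefficients of exp(z) Q(z) up to degree 2q. For n \<le> q the alternating
  sum matches by symmetry of the binomial coefficient; for q < n \<le> 2q both sides vanish.\<close>

lemma pade_numerator:
  assumes "n \<le> 2 * q" "1 \<le> q"
  shows "(\<Sum>k\<le>n. pade_coeff q k * (1 / fact (n - k))) = (- 1) ^ n * pade_coeff q n"
proof -
  have "(2 * q - n) choose (q - n) = (2 * q - n) choose q" if "n \<le> q"
  proof -
    have "(2 * q - n) choose q = (2 * q - n) choose (2 * q - n - q)"
      by (rule binomial_symmetric) (use that in auto)
    also have "2 * q - n - q = q - n" by auto
    finally show ?thesis ..
  qed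
  then have "(\<Sum>k\<le>n. (- 1) ^ k * real (n choose k) * real ((2 * q - k) choose q)) = real ((2 * q - n) choose q)"
    using assms by (subst alternating_binomial_sum) (auto intro!: binomial_eq_0)
  then show ?thesis
    unfolding pade_coeff_convolution by (simp add: pade_coeff_def flip: mult.assoc power_add mult_2)
qed

lemma pade_error:
  assumes "1 \<le> q"
  shows "(\<Sum>k\<le>2 * q + 1. pade_coeff q k * (1 / fact (2 * q + 1 - k))) =
    (- 1) ^ q / (fact (2 * q + 1) * real ((2 * q) choose q))"
proof -
  have b: "real ((2 * q) choose q) = fact (2 * q) / (fact q * fact q)"
    using binomial_fact[of q "2 * q", where 'a = real] by (simp add: mult_2)
  have "(\<Sum>k\<le>Suc (2 * q). (- 1) ^ k * real (Suc (2 * q) choose k) * real ((2 * q - k) choose q)) = (- 1) ^ q"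
  proof -
    \<comment> \<open>In the term k = 2q + 1 truncated subtraction gives \<open>0 choose q\<close> =
      0, so the sum really stops at 2q and is the boundary sum above, not a vanishing full
      difference.\<close>
    have "(0::nat) choose q = 0" using assms by (auto intro!: binomial_eq_0)
    moreover have "(- 1 :: real) ^ (2 * q + q) = (- 1) ^ q" unfolding power_add by simp
    ultimately show ?thesis
      using alternating_binomial_sum_boundary[of q "2 * q"] by (simp del: binomial_Suc_Suc)
  qed
  then show ?thesis
    unfolding pade_coeff_convolution b by (simp add: power2_eq_square field_simps)
qed

section \<open>Hilbert-matrix forms\<close>

definition psd_upto :: "nat \<Rightarrow> (nat \<Rightarrow> nat \<Rightarrow> real) \<Rightarrow> bool" where
  "psd_upto N b \<longleftrightarrow> (\<forall>c. 0 \<le> (\<Sum>j\<le>N. \<Sum>k\<le>N. c j * c k * b j k))"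

text \<open>If b is the Gram kernel of vectors e_i, this is the integral over [0, 1] of the squared
  norm of the vector polynomial with terms c_i x^i e_i.\<close>

definition hilbert_form :: "nat \<Rightarrow> (nat \<Rightarrow> nat \<Rightarrow> real) \<Rightarrow> (nat \<Rightarrow> real) \<Rightarrow> real" where
  "hilbert_form N b c = (\<Sum>j\<le>N. \<Sum>k\<le>N. c j * c k * b j k / real (j + k + 1))"

text \<open>The dilated integrand on [0, 1] sweeps the original one on [0, 1/2] at half speed, so
  its integral is twice a part of the original integral. The antiderivative \<open>f\<close>,
  nondecreasing because \<open>b\<close> is positive semidefinite, takes the place of the
  integral.\<close>

lemma hilbert_form_dilate:
  assumes "psd_upto N b"
  shows "0 \<le> hilbert_form N b c"
    and "hilbert_form N b (\<lambda>i. c i / 2 ^ i) \<le> 2 * hilbert_form N b c"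
proof -
  define f where "f x = (\<Sum>j\<le>N. \<Sum>k\<le>N. c j * c k * b j k / real (j + k + 1) * x ^ (j + k + 1))" for x
  have deriv: "(f has_real_derivative (\<Sum>j\<le>N. \<Sum>k\<le>N. (c j * x ^ j) * (c k * x ^ k) * b j k)) (at x)" for x
  proof -
    have "((\<lambda>x. c j * c k * b j k / real (j + k + 1) * x ^ (j + k + 1)) has_real_derivative
        (c j * x ^ j) * (c k * x ^ k) * b j k) (at x)" for j k
    proof -
      define r where "r = real (j + k + 1)"
      have r: "r \<noteq> 0" unfolding r_def by linarith
      have "((\<lambda>x. x ^ (j + k + 1)) has_real_derivative r * x ^ (j + k)) (at x)"
        using DERIV_pow[of "j + k + 1" x] by (simp add: r_def)
      from DERIV_cmult[OF this, of "c j * c k * b j k / r"]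
      have "((\<lambda>x. c j * c k * b j k / r * x ^ (j + k + 1)) has_real_derivative
        c j * c k * b j k / r * (r * x ^ (j + k))) (at x)" .
      also have "c j * c k * b j k / r * (r * x ^ (j + k)) = (c j * x ^ j) * (c k * x ^ k) * b j k"
        using r by (simp add: power_add)
      finally show ?thesis unfolding r_def .
    qed
    then show ?thesis unfolding f_def by (intro DERIV_sum)
  qed
  have "0 \<le> (\<Sum>j\<le>N. \<Sum>k\<le>N. (c j * x ^ j) * (c k * x ^ k) * b j k)" for x
    using assms[unfolded psd_upto_def, rule_format, of "\<lambda>j. c j * x ^ j"] .
  then have mono: "f x \<le> f y" if "x \<le> y" for x y
    by (intro DERIV_nonneg_imp_nondecreasing[OF that] exI conjI) (rule deriv)
  have f1: "f 1 = hilbert_form N b c" by (simp add: f_def hilbert_form_def)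
  have f0: "f 0 = 0" by (simp add: f_def)
  have f2: "f (1/2) = hilbert_form N b (\<lambda>i. c i / 2 ^ i) / 2"
    by (simp add: f_def hilbert_form_def sum_divide_distrib power_add power_divide field_simps)
  show "0 \<le> hilbert_form N b c" using mono[of 0 1] f0 f1 by simp
  show "hilbert_form N b (\<lambda>i. c i / 2 ^ i) \<le> 2 * hilbert_form N b c"
    using mono[of "1/2" 1] f1 f2 by simp
qed

text \<open>Parallelogram identity, with the nonnegative form at \<open>c + t * d\<close>
  dropped.\<close>

lemma hilbert_form_diff_le:
  assumes "psd_upto N b"
  shows "hilbert_form N b (\<lambda>i. c i - t * d i) \<le> 2 * hilbert_form N b c + 2 * t\<^sup>2 * hilbert_form N b d"
proof -
  have "hilbert_form N b (\<lambda>i. c i - t * d i) + hilbert_form N b (\<lambda>i. c i + t * d i)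
      = 2 * hilbert_form N b c + 2 * t\<^sup>2 * hilbert_form N b d"
    unfolding hilbert_form_def sum_distrib_left sum.distrib[symmetric]
    by (intro sum.cong refl) (simp add: power2_eq_square add_divide_distrib[symmetric] algebra_simps)
  then show ?thesis using hilbert_form_dilate(1)[OF assms, of "\<lambda>i. c i + t * d i"] by linarith
qed

text \<open>The factor for \<open>j\<close> is the operator \<open>1 - 2\<^sup>j D\<close>, where \<open>D\<close> is the substitution \<open>x \<mapsto> x/2\<close> in \<open>\<Sum>i. c i * x ^ i\<close>;
  it removes the monomial of degree \<open>j\<close>.\<close>

lemma hilbert_form_eliminate:
  assumes "finite J"
  shows "\<exists>C>0. \<forall>b c. psd_upto N b \<longrightarrow>
    hilbert_form N b (\<lambda>i. c i * (\<Prod>j\<in>J. 1 - 2 ^ j / 2 ^ i)) \<le> C * hilbert_form N b c"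
  using assms
proof (induction J rule: finite_induct)
  case empty
  show ?case by (intro exI[of _ 1]) auto
next
  case (insert j J)
  then obtain C where C: "C > 0" and le: "\<And>b c. psd_upto N b \<Longrightarrow>
    hilbert_form N b (\<lambda>i. c i * (\<Prod>j\<in>J. 1 - 2 ^ j / 2 ^ i)) \<le> C * hilbert_form N b c" by blast
  \<comment> \<open>The constant is \<open>hilbert_form_diff_le\<close> with t = 2^j, which gives 2
    + 2 t^2, where the dilation doubles the second summand.\<close>
  show ?case
  proof (intro exI[of _ "(2 + 4 * (2 ^ j)\<^sup>2) * C"] conjI allI impI)
    show "0 < (2 + 4 * (2 ^ j)\<^sup>2) * C" using C by (intro mult_pos_pos add_pos_nonneg) auto
    fix b :: "nat \<Rightarrow> nat \<Rightarrow> real" and c :: "nat \<Rightarrow> real"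
    assume b: "psd_upto N b"
    define d where "d = (\<lambda>i. c i * (\<Prod>j\<in>J. 1 - 2 ^ j / 2 ^ i))"
    have "(\<lambda>i. c i * (\<Prod>j\<in>insert j J. 1 - 2 ^ j / 2 ^ i)) = (\<lambda>i. d i - 2 ^ j * (d i / 2 ^ i))"
      using insert.hyps by (simp add: d_def algebra_simps)
    then have "hilbert_form N b (\<lambda>i. c i * (\<Prod>j\<in>insert j J. 1 - 2 ^ j / 2 ^ i))
      \<le> 2 * hilbert_form N b d + 2 * (2 ^ j)\<^sup>2 * hilbert_form N b (\<lambda>i. d i / 2 ^ i)"
      using hilbert_form_diff_le[OF b, of d "2 ^ j" "\<lambda>i. d i / 2 ^ i"] by simp
    also have "\<dots> \<le> 2 * hilbert_form N b d + 2 * (2 ^ j)\<^sup>2 * (2 * hilbert_form N b d)"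
      by (intro add_left_mono mult_left_mono hilbert_form_dilate b) auto
    also have "\<dots> = (2 + 4 * (2 ^ j)\<^sup>2) * hilbert_form N b d" by (simp add: algebra_simps)
    also have "\<dots> \<le> (2 + 4 * (2 ^ j)\<^sup>2) * (C * hilbert_form N b c)"
      using le[OF b, of c] unfolding d_def by (intro mult_left_mono) auto
    finally show "hilbert_form N b (\<lambda>i. c i * (\<Prod>j\<in>insert j J. 1 - 2 ^ j / 2 ^ i))
      \<le> (2 + 4 * (2 ^ j)\<^sup>2) * C * hilbert_form N b c" by simp
  qed
qed

text \<open>Eliminating every monomial except the i-th leaves only \<kappa>^2 b_ii / (2i+1), and
  \<kappa> \<noteq> 0 because the powers of 2 are distinct. The elimination is bounded with respect
  to the form by a constant that does not see \<open>b\<close>, so \<open>C\<close> depends on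
  \<open>N\<close> alone.\<close>

lemma hilbert_form_lower_bound:
  "\<exists>C>0. \<forall>b. psd_upto N b \<longrightarrow> (\<Sum>i\<le>N. b i i) \<le> C * hilbert_form N b (\<lambda>_. 1)"
proof -
  have "\<forall>i. \<exists>C>0. i \<le> N \<longrightarrow> (\<forall>b. psd_upto N b \<longrightarrow> b i i \<le> C * hilbert_form N b (\<lambda>_. 1))"
  proof
    fix i
    define \<kappa> :: real where "\<kappa> = (\<Prod>j\<in>{..N} - {i}. 1 - 2 ^ j / 2 ^ i)"
    obtain C where C: "C > 0" and le: "\<And>b c. psd_upto N b \<Longrightarrow>
      hilbert_form N b (\<lambda>k. c k * (\<Prod>j\<in>{..N} - {i}. 1 - 2 ^ j / 2 ^ k)) \<le> C * hilbert_form N b c"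
      using hilbert_form_eliminate[of "{..N} - {i}" N] by blast
    have \<kappa>: "\<kappa> \<noteq> 0" by (auto simp: \<kappa>_def)
    show "\<exists>C>0. i \<le> N \<longrightarrow> (\<forall>b. psd_upto N b \<longrightarrow> b i i \<le> C * hilbert_form N b (\<lambda>_. 1))"
    proof (intro exI[of _ "C * real (i + i + 1) / \<kappa>\<^sup>2"] conjI impI allI)
      show "0 < C * real (i + i + 1) / \<kappa>\<^sup>2" using C \<kappa> by simp
      fix b assume i: "i \<le> N" and b: "psd_upto N b"
      define w where "w k = (\<Prod>j\<in>{..N} - {i}. 1 - 2 ^ j / 2 ^ k :: real)" for k :: nat
      have z: "w k = (if k = i then \<kappa> else 0)" if "k \<le> N" for k
      proof (cases "k = i")
        case False
        then have "k \<in> {..N} - {i}" "1 - 2 ^ k / 2 ^ k = (0::real)" using that by auto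
        then have "w k = 0" unfolding w_def by (intro prod_zero bexI[of _ k]) simp_all
        then show ?thesis using False by simp
      qed (simp add: \<kappa>_def w_def)
      have "w j * w k * b j k / real (j + k + 1) =
          (if k = i then if j = i then \<kappa>\<^sup>2 * b i i / real (i + i + 1) else 0 else 0)"
        if "j \<le> N" "k \<le> N" for j k
        using that by (simp add: z power2_eq_square)
      then have "hilbert_form N b w =
        (\<Sum>j\<le>N. \<Sum>k\<le>N. if k = i then if j = i then \<kappa>\<^sup>2 * b i i / real (i + i + 1) else 0 else 0)"
        unfolding hilbert_form_def by (intro sum.cong refl) auto
      also have "\<dots> = \<kappa>\<^sup>2 * b i i / real (i + i + 1)" using i by simp
      finally have "\<kappa>\<^sup>2 * b i i / real (i + i + 1) \<le> C * hilbert_form N b (\<lambda>_. 1)"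
        using le[OF b, of "\<lambda>_. 1"] unfolding mult_1 w_def[symmetric] by simp
      then have "real (i + i + 1) / \<kappa>\<^sup>2 * (\<kappa>\<^sup>2 * b i i / real (i + i + 1))
          \<le> real (i + i + 1) / \<kappa>\<^sup>2 * (C * hilbert_form N b (\<lambda>_. 1))"
        by (intro mult_left_mono) auto
      also have "real (i + i + 1) / \<kappa>\<^sup>2 * (\<kappa>\<^sup>2 * b i i / real (i + i + 1)) = b i i"
        using \<kappa> by (simp del: of_nat_Suc of_nat_add)
      finally show "b i i \<le> C * real (i + i + 1) / \<kappa>\<^sup>2 * hilbert_form N b (\<lambda>_. 1)"
        by (simp add: mult_ac)
    qed
  qed
  then obtain C where C: "\<And>i. C i > 0"
    and le: "\<And>i b. i \<le> N \<Longrightarrow> psd_upto N b \<Longrightarrow> b i i \<le> C i * hilbert_form N b (\<lambda>_. 1)" by metis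
  show ?thesis
  proof (intro exI[of _ "\<Sum>i\<le>N. C i"] conjI allI impI)
    show "0 < (\<Sum>i\<le>N. C i)" by (rule sum_pos) (auto simp: C)
    fix b assume "psd_upto N b"
    then show "(\<Sum>i\<le>N. b i i) \<le> (\<Sum>i\<le>N. C i) * hilbert_form N b (\<lambda>_. 1)"
      unfolding sum_distrib_right by (intro sum_mono le) auto
  qed
qed

section \<open>Double sums as polynomials in the step size\<close>

lemma double_sum_triangle_split:
  fixes f :: "nat \<Rightarrow> nat \<Rightarrow> 'a :: comm_monoid_add"
  assumes "p \<le> N"
  shows "(\<Sum>j\<le>N. \<Sum>k\<le>N. f j k) = (\<Sum>n\<le>p. \<Sum>j\<le>n. f j (n - j)) + (\<Sum>j\<le>N. \<Sum>k\<le>N. if p < j + k then f j k else 0)"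
proof -
  have "(\<Sum>n\<le>p. \<Sum>j\<le>n. f j (n - j)) = (\<Sum>(j, k)\<in>{(j, k). j + k \<le> p}. f j k)"
    by (rule sum.triangle_reindex_eq[symmetric])
  also have "\<dots> = (\<Sum>(j, k)\<in>{..N} \<times> {..N}. if j + k \<le> p then f j k else 0)"
    by (rule sum.mono_neutral_cong_left) (use assms in \<open>auto split: if_splits\<close>)
  also have "\<dots> = (\<Sum>j\<le>N. \<Sum>k\<le>N. if j + k \<le> p then f j k else 0)"
    by (simp add: sum.cartesian_product)
  finally have "(\<Sum>n\<le>p. \<Sum>j\<le>n. f j (n - j)) = (\<Sum>j\<le>N. \<Sum>k\<le>N. if j + k \<le> p then f j k else 0)" .
  then show ?thesis
    by (simp only: flip: sum.distrib) (intro sum.cong refl, simp)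
qed

lemma triangle_tail_bound:
  fixes f :: "nat \<Rightarrow> nat \<Rightarrow> real"
  assumes "0 \<le> \<tau>" "\<tau> \<le> 1" "\<And>j k. j \<le> N \<Longrightarrow> k \<le> N \<Longrightarrow> \<bar>f j k\<bar> \<le> g j k"
  shows "\<bar>\<Sum>j\<le>N. \<Sum>k\<le>N. if p < j + k then \<tau> ^ (j + k) * f j k else 0\<bar> \<le> \<tau> ^ Suc p * (\<Sum>j\<le>N. \<Sum>k\<le>N. g j k)"
proof -
  have "\<bar>if p < j + k then \<tau> ^ (j + k) * f j k else 0\<bar> \<le> \<tau> ^ Suc p * g j k" if "j \<le> N" "k \<le> N" for j k
  proof -
    have "\<tau> ^ (j + k) \<le> \<tau> ^ Suc p" if "p < j + k"
      using assms that by (intro power_decreasing) auto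
    moreover have "0 \<le> g j k" using assms(3)[OF that] by linarith
    ultimately show ?thesis using assms(1) assms(3)[OF that]
      by (auto simp: abs_mult simp del: power_Suc intro!: mult_mono)
  qed
  then have "(\<Sum>j\<le>N. \<Sum>k\<le>N. \<bar>if p < j + k then \<tau> ^ (j + k) * f j k else 0\<bar>) \<le> (\<Sum>j\<le>N. \<Sum>k\<le>N. \<tau> ^ Suc p * g j k)"
    by (intro sum_mono) auto
  then show ?thesis unfolding sum_distrib_left
    by (rule order_trans[rotated]) (intro order_trans[OF sum_abs] sum_mono order_refl)
qed

lemma double_sum_leading_coeff_pos:
  fixes f :: "nat \<Rightarrow> nat \<Rightarrow> real"
  assumes "n0 \<le> N" "\<And>n. n < n0 \<Longrightarrow> (\<Sum>j\<le>n. f j (n - j)) = 0" "0 < (\<Sum>j\<le>n0. f j (n0 - j))" "0 < \<tau>0"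
  shows "\<exists>\<tau>. 0 < \<tau> \<and> \<tau> \<le> \<tau>0 \<and> 0 < (\<Sum>j\<le>N. \<Sum>k\<le>N. \<tau> ^ (j + k) * f j k)"
proof -
  define A where "A = (\<Sum>j\<le>n0. f j (n0 - j))"
  define B where "B = (\<Sum>j\<le>N. \<Sum>k\<le>N. \<bar>f j k\<bar>)"
  \<comment> \<open>\<tau> \<le> A / (B + 1) gives \<tau> B < A strictly, so the leading term beats
    the tail, and the quotient makes sense even if B = 0. The bound 1 lets every higher power be
    estimated by \<tau>^(n0+1).\<close>
  define \<tau> where "\<tau> = Min {\<tau>0, 1, A / (B + 1)}"
  have B: "0 \<le> B" unfolding B_def by (intro sum_nonneg) auto
  have \<tau>: "0 < \<tau>" "\<tau> \<le> \<tau>0" "\<tau> \<le> 1" "\<tau> \<le> A / (B + 1)" using assms B by (auto simp: \<tau>_def A_def)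
  then have "\<tau> * (B + 1) \<le> A" using B by (simp add: field_simps)
  then have "\<tau> * B < A" using \<tau> by (simp add: algebra_simps)
  have "(\<Sum>n\<le>n0. \<Sum>j\<le>n. \<tau> ^ (j + (n - j)) * f j (n - j)) = (\<Sum>n\<le>n0. \<tau> ^ n * (\<Sum>j\<le>n. f j (n - j)))"
    by (simp add: sum_distrib_left)
  also have "\<dots> = \<tau> ^ n0 * A + (\<Sum>n<n0. \<tau> ^ n * (\<Sum>j\<le>n. f j (n - j)))"
    by (simp add: A_def flip: lessThan_Suc_atMost)
  also have "\<dots> = \<tau> ^ n0 * A" using assms(2) by simp
  finally have "(\<Sum>j\<le>N. \<Sum>k\<le>N. \<tau> ^ (j + k) * f j k) \<ge> \<tau> ^ n0 * A - \<tau> ^ Suc n0 * B"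
    unfolding double_sum_triangle_split[OF assms(1), of "\<lambda>j k. \<tau> ^ (j + k) * f j k"]
    using triangle_tail_bound[of \<tau> N f "\<lambda>j k. \<bar>f j k\<bar>" n0] \<tau> by (simp add: B_def)
  moreover have "0 < \<tau> ^ n0 * (A - \<tau> * B)" using \<tau> \<open>\<tau> * B < A\<close> by simp
  moreover have "\<tau> ^ n0 * (A - \<tau> * B) = \<tau> ^ n0 * A - \<tau> ^ Suc n0 * B" by (simp add: algebra_simps)
  ultimately show ?thesis using \<tau> by (intro exI[of _ \<tau>]) linarith
qed

section \<open>Energy and dissipation kernels\<close>

text \<open>Everything the scalar estimates need from an orbit; a bound proved for all such kernels
  is automatically uniform in the start vector.\<close>

locale energy_kernel =
  fixes G K :: "nat \<Rightarrow> nat \<Rightarrow> real"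
  assumes G_sym: "G j k = G k j"
    and G_step: "G (Suc j) k + G j (Suc k) = - 2 * K j k"
begin

lemma K_sym: "K j k = K k j"
  using G_step[of j k] G_step[of k j] G_sym[of "Suc j" k] G_sym[of j "Suc k"] by simp

text \<open>Coefficient of \<tau>^n in the energy balance of the exact flow: the derivative of the
  energy of exp(\<tau>L) u is -2 times the dissipation form there. Differentiation is the weight n +
  1, split as j + (n + 1 - j) so that each part cancels one factor of a factorial.\<close>

lemma exp_energy_coeff:
  "(\<Sum>j\<le>Suc n. G j (Suc n - j) / (fact j * fact (Suc n - j))) =
     - 2 / real (Suc n) * (\<Sum>j\<le>n. K j (n - j) / (fact j * fact (n - j)))"
proof -
  define g where "g j = G j (Suc n - j) / (fact j * fact (Suc n - j))" for j
  have "real (Suc n) * (\<Sum>j\<le>Suc n. g j) = (\<Sum>j\<le>Suc n. real j * g j + real (Suc n - j) * g j)"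
    unfolding sum_distrib_left
    by (intro sum.cong refl) (auto simp: of_nat_diff algebra_simps)
  also have "\<dots> = (\<Sum>j\<le>Suc n. real j * g j) + (\<Sum>j\<le>Suc n. real (Suc n - j) * g j)"
    by (rule sum.distrib)
  also have "(\<Sum>j\<le>Suc n. real j * g j) = (\<Sum>j\<le>n. G (Suc j) (n - j) / (fact j * fact (n - j)))"
  proof -
    have "real (Suc j) * g (Suc j) = G (Suc j) (n - j) / (fact j * fact (n - j))" for j
      by (simp add: g_def del: of_nat_Suc)
    then show ?thesis by (simp only: sum.atMost_Suc_shift)
  qed
  also have "(\<Sum>j\<le>Suc n. real (Suc n - j) * g j) = (\<Sum>j\<le>n. G j (Suc (n - j)) / (fact j * fact (n - j)))"
  proof -
    have "real (Suc n - j) * g j = G j (Suc (n - j)) / (fact j * fact (n - j))" if "j \<le> n" for j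
      using that by (simp add: g_def Suc_diff_le del: of_nat_Suc)
    then show ?thesis by simp
  qed
  finally have "real (Suc n) * (\<Sum>j\<le>Suc n. g j) = (\<Sum>j\<le>n. (G (Suc j) (n - j) + G j (Suc (n - j))) / (fact j * fact (n - j)))"
    by (simp only: sum.distrib[symmetric] add_divide_distrib[symmetric])
  also have "\<dots> = - 2 * (\<Sum>j\<le>n. K j (n - j) / (fact j * fact (n - j)))"
    by (simp only: G_step sum_distrib_left times_divide_eq_right)
  finally have "(\<Sum>j\<le>Suc n. g j) = - 2 * (\<Sum>j\<le>n. K j (n - j) / (fact j * fact (n - j))) / real (Suc n)"
    by (metis nonzero_mult_div_cancel_left of_nat_eq_0_iff nat.distinct(1))
  then show ?thesis unfolding g_def by simp
qed

end

section \<open>Energy growth when the first q iterates are undamped\<close>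

locale dissipation_free_kernel = energy_kernel +
  fixes q :: nat
  assumes K_eq_0: "j < q \<Longrightarrow> K j k = 0"
begin

lemma K_eq_0': "k < q \<Longrightarrow> K j k = 0"
  using K_eq_0 K_sym by metis

lemma G_alternating: "j + k \<le> 2 * q \<Longrightarrow> G j k = (- 1) ^ j * G 0 (j + k)"
proof (induction j arbitrary: k)
  case (Suc j)
  \<comment> \<open>j + 1 + k \<le> 2q forces one of j, k below q, so moving one factor L across
    costs only a sign.\<close>
  have "K j k = 0" using Suc.prems K_eq_0[of j k] K_eq_0'[of k j] by (cases "j < q") auto
  then show ?case using G_step[of j k] Suc.IH[of "Suc k"] Suc.prems by simp
qed simp

lemma G_odd_eq_0:
  assumes "j + k \<le> 2 * q" "odd (j + k)"
  shows "G j k = 0"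
proof -
  have "G (j + k) 0 = - G 0 (j + k)" using G_alternating[of "j + k" 0] assms by simp
  then have "G 0 (j + k) = 0" using G_sym[of "j + k" 0] by simp
  then show ?thesis using G_alternating[of j k] assms by simp
qed

text \<open>One antidiagonal beyond \<open>G_alternating\<close>: the sign rule survives from the
  edge to the middle, where \<open>G_step\<close> at (q, q) together with symmetry brings in the
  first dissipation that need not vanish.\<close>

lemma G_0_top: "G 0 (2 * q + 1) = - ((- 1) ^ q * K q q)"
proof -
  have "j \<le> q \<Longrightarrow> G j (2 * q + 1 - j) = (- 1) ^ j * G 0 (2 * q + 1)" for j
  proof (induction j)
    case (Suc j)
    have "Suc (2 * q + 1 - Suc j) = 2 * q + 1 - j" using Suc.prems by simp
    then show ?case using G_step[of j "2 * q + 1 - Suc j"] K_eq_0[of j] Suc by simp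
  qed simp
  from this[of q] have "G q (Suc q) = (- 1) ^ q * G 0 (2 * q + 1)" by (simp add: mult_2)
  moreover have "2 * G q (Suc q) = - 2 * K q q" using G_step[of q q] G_sym[of q "Suc q"] by simp
  ultimately have "(- 1) ^ q * ((- 1) ^ q * G 0 (2 * q + 1)) = - ((- 1) ^ q * K q q)" by simp
  then show ?thesis by (simp flip: mult.assoc power_add mult_2)
qed

lemma energy_growth_odd_order:
  assumes q: "1 \<le> q" and N: "2 * q \<le> N" and G: "0 < G q q"
    and r: "\<And>j. j < 2 * q \<Longrightarrow> r j = 1 / fact j"
    and C: "0 < (- 1) ^ q * (fact (2 * q) * r (2 * q) - 1)" and \<tau>0: "0 < \<tau>0"
  shows "\<exists>\<tau>. 0 < \<tau> \<and> \<tau> \<le> \<tau>0 \<and> G 0 0 < (\<Sum>j\<le>N. \<Sum>k\<le>N. \<tau> ^ (j + k) * (r j * r k * G j k))"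
proof -
  \<comment> \<open>Subtracting the initial energy in the entry (0, 0) makes the constant
    coefficient vanish like the following ones.\<close>
  define f where "f j k = (r j * r k - (if j = 0 \<and> k = 0 then 1 else 0)) * G j k" for j k
  have G2q: "G 0 (2 * q) = (- 1) ^ q * G q q"
    using G_alternating[of q q] by (simp flip: mult_2 mult.assoc power_add)
  \<comment> \<open>To this order the exact flow is undamped and conserves energy; with alternating
    \<open>G\<close> this becomes (1 - 1)^n = 0.\<close>
  have exp_part: "(\<Sum>j\<le>n. 1 / (fact j * fact (n - j)) * G j (n - j)) = 0" if n: "1 \<le> n" "n \<le> 2 * q" for n
  proof -
    have "(\<Sum>j\<le>n. 1 / (fact j * fact (n - j)) * G j (n - j))
      = (\<Sum>j\<le>n. (- 1) ^ j * real (n choose j) * (G 0 n / fact n))"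
    proof (intro sum.cong refl)
      fix j assume "j \<in> {..n}"
      then have "j \<le> n" "G j (n - j) = (- 1) ^ j * G 0 n" using n G_alternating[of j "n - j"] by auto
      then show "1 / (fact j * fact (n - j)) * G j (n - j) = (- 1) ^ j * real (n choose j) * (G 0 n / fact n)"
        by (simp add: binomial_fact)
    qed
    also have "\<dots> = (\<Sum>j\<le>n. (- 1) ^ j * real (n choose j)) * (G 0 n / fact n)"
      by (rule sum_distrib_right[symmetric])
    also have "\<dots> = 0" using choose_alternating_sum[of n, where 'a = real] n by simp
    finally show ?thesis .
  qed
  have low: "(\<Sum>j\<le>n. f j (n - j)) = 0" if n: "n < 2 * q" for n
  proof (cases "n = 0")
    case True
    then show ?thesis using r[of 0] q by (simp add: f_def)
  next
    case False
    have "f j (n - j) = 1 / (fact j * fact (n - j)) * G j (n - j)" if "j \<le> n" for j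
      using n False that by (auto simp: f_def r)
    then show ?thesis using exp_part[of n] n False by simp
  qed
  have lead: "(\<Sum>j\<le>2 * q. f j (2 * q - j)) = 2 / fact (2 * q) * ((- 1) ^ q * (fact (2 * q) * r (2 * q) - 1)) * G q q"
  proof -
    \<comment> \<open>The first deviation from exp enters the antidiagonal only at its two ends,
      where the other factor is r 0 = 1.\<close>
    define e where "e = r (2 * q) - 1 / fact (2 * q)"
    have "f j (2 * q - j) = 1 / (fact j * fact (2 * q - j)) * G j (2 * q - j)
        + ((if j = 0 then e * G 0 (2 * q) else 0) + (if j = 2 * q then e * G 0 (2 * q) else 0))"
      if j: "j \<le> 2 * q" for j
    proof -
      consider "j = 0" | "j = 2 * q" "j \<noteq> 0" | "0 < j" "j < 2 * q" using j by linarith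
      then show ?thesis
      proof cases
        case 1
        then show ?thesis using q r[of 0] by (simp add: f_def e_def algebra_simps)
      next
        case 2
        then show ?thesis using q r[of 0] G_sym[of "2 * q" 0] by (simp add: f_def e_def algebra_simps)
      next
        case 3
        then show ?thesis using q by (simp add: f_def r)
      qed
    qed
    then have "(\<Sum>j\<le>2 * q. f j (2 * q - j)) = 2 * e * G 0 (2 * q)"
      using exp_part[of "2 * q"] q by (simp add: sum.distrib)
    then show ?thesis unfolding G2q by (simp add: e_def field_simps)
  qed
  have "0 < (\<Sum>j\<le>2 * q. f j (2 * q - j))"
    unfolding lead by (rule mult_pos_pos[OF mult_pos_pos[OF _ C] G]) simp
  from double_sum_leading_coeff_pos[of "2 * q" N f, OF N low this \<tau>0]
  obtain \<tau> where \<tau>: "0 < \<tau>" "\<tau> \<le> \<tau>0" and pos: "0 < (\<Sum>j\<le>N. \<Sum>k\<le>N. \<tau> ^ (j + k) * f j k)" by blast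
  have "(\<Sum>j\<le>N. \<Sum>k\<le>N. \<tau> ^ (j + k) * (r j * r k * G j k)) - (\<Sum>j\<le>N. \<Sum>k\<le>N. \<tau> ^ (j + k) * f j k)
     = (\<Sum>j\<le>N. \<Sum>k\<le>N. if k = 0 then if j = 0 then G 0 0 else 0 else 0)"
    unfolding sum_subtractf[symmetric]
    by (intro sum.cong refl) (auto simp: f_def algebra_simps)
  also have "\<dots> = G 0 0" by simp
  finally show ?thesis using pos \<tau> by (intro exI[of _ \<tau>]) simp
qed

text \<open>\<open>d\<close> and \<open>w\<close> stand for the coefficients of Q and of R Q. On
  antidiagonals of degree at most 2q the difference w_j w_k - d_j d_k vanishes in even degree, and G
  vanishes in odd degree. In degree 2q + 1 every interior product is zero since one of the two
  indices exceeds q, so only w (2q+1), paired with w 0 = 1 at both ends, remains.\<close>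

lemma energy_growth_even_order:
  assumes q: "1 \<le> q" and N: "2 * q + 1 \<le> N" and K: "0 < K q q"
    and d0: "d 0 = 1" and d: "\<And>j. q < j \<Longrightarrow> d j = 0"
    and w: "\<And>j. j \<le> 2 * q \<Longrightarrow> w j = (- 1) ^ j * d j"
    and C: "(- 1) ^ q * w (2 * q + 1) < 0" and \<tau>0: "0 < \<tau>0"
  shows "\<exists>\<tau>. 0 < \<tau> \<and> \<tau> \<le> \<tau>0 \<and>
    (\<Sum>j\<le>N. \<Sum>k\<le>N. \<tau> ^ (j + k) * (d j * d k * G j k)) < (\<Sum>j\<le>N. \<Sum>k\<le>N. \<tau> ^ (j + k) * (w j * w k * G j k))"
proof -
  define f where "f j k = (w j * w k - d j * d k) * G j k" for j k
  have low: "(\<Sum>j\<le>n. f j (n - j)) = 0" if n: "n < 2 * q + 1" for n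
  proof (rule sum.neutral, rule ballI)
    fix j assume "j \<in> {..n}"
    then have j: "j \<le> n" by simp
    have "w j * w (n - j) = (- 1) ^ n * (d j * d (n - j))"
      using n j by (simp add: w flip: power_add mult.assoc)
    then show "f j (n - j) = 0"
      using G_odd_eq_0[of j "n - j"] n j by (cases "even n") (auto simp: f_def)
  qed
  have "f j (2 * q + 1 - j) = (if j = 0 then w (2 * q + 1) * G 0 (2 * q + 1) else 0)
      + (if j = 2 * q + 1 then w (2 * q + 1) * G 0 (2 * q + 1) else 0)" if j: "j \<le> 2 * q + 1" for j
  proof -
    consider "j = 0" | "j = 2 * q + 1" | "0 < j" "j \<le> 2 * q" using j by linarith
    then show ?thesis
    proof cases
      case 1
      then show ?thesis using q d0 d[of "2 * q + 1"] w[of 0] by (simp add: f_def)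
    next
      case 2
      then show ?thesis using q d0 d[of "2 * q + 1"] w[of 0] G_sym[of "2 * q + 1" 0] by (simp add: f_def)
    next
      case 3
      have "d j * d (2 * q + 1 - j) = 0" using d[of j] d[of "2 * q + 1 - j"] 3 by (cases "q < j") auto
      then show ?thesis using 3 w[of j] w[of "2 * q + 1 - j"] by (auto simp: f_def)
    qed
  qed
  then have "(\<Sum>j\<le>2 * q + 1. f j (2 * q + 1 - j)) = 2 * w (2 * q + 1) * G 0 (2 * q + 1)"
    by (simp add: sum.distrib)
  also have "\<dots> = 2 * K q q * - ((- 1) ^ q * w (2 * q + 1))" unfolding G_0_top by simp
  also have "\<dots> > 0" by (rule mult_pos_pos) (use C K in linarith)+
  finally have lead: "0 < (\<Sum>j\<le>2 * q + 1. f j (2 * q + 1 - j))" .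
  from double_sum_leading_coeff_pos[of "2 * q + 1" N f, OF N low lead \<tau>0]
  obtain \<tau> where \<tau>: "0 < \<tau>" "\<tau> \<le> \<tau>0" and pos: "0 < (\<Sum>j\<le>N. \<Sum>k\<le>N. \<tau> ^ (j + k) * f j k)" by blast
  have "(\<Sum>j\<le>N. \<Sum>k\<le>N. \<tau> ^ (j + k) * f j k) =
    (\<Sum>j\<le>N. \<Sum>k\<le>N. \<tau> ^ (j + k) * (w j * w k * G j k)) - (\<Sum>j\<le>N. \<Sum>k\<le>N. \<tau> ^ (j + k) * (d j * d k * G j k))"
    unfolding sum_subtractf[symmetric] by (simp only: f_def left_diff_distrib right_diff_distrib)
  then show ?thesis using pos \<tau> by (intro exI[of _ \<tau>]) simp
qed

end

section \<open>Energy decay from coercive dissipation\<close>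

lemma psd_upto_diag:
  assumes "psd_upto N b" "i \<le> N"
  shows "0 \<le> b i i"
proof -
  have "(if j = i then 1 else 0) * (if k = i then 1 else 0) * b j k = (if k = i then if j = i then b i i else 0 else 0)"
    for j k :: nat by auto
  then show ?thesis
    using assms(1)[unfolded psd_upto_def, rule_format, of "\<lambda>j. if j = i then 1 else 0"] assms(2) by simp
qed

lemma psd_upto_scale:
  assumes "psd_upto N b" "0 \<le> t"
  shows "psd_upto N (\<lambda>j k. t * (e j * e k * b j k))"
  unfolding psd_upto_def
proof
  fix c
  have "(\<Sum>j\<le>N. \<Sum>k\<le>N. c j * c k * (t * (e j * e k * b j k))) = t * (\<Sum>j\<le>N. \<Sum>k\<le>N. (c j * e j) * (c k * e k) * b j k)"
    by (simp add: sum_distrib_left mult_ac)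
  also have "\<dots> \<ge> 0"
    using assms(1)[unfolded psd_upto_def, rule_format, of "\<lambda>j. c j * e j"] assms(2) by (intro mult_nonneg_nonneg)
  finally show "0 \<le> (\<Sum>j\<le>N. \<Sum>k\<le>N. c j * c k * (t * (e j * e k * b j k)))" .
qed

text \<open>The bound \<tau>0 is chosen before \<open>G\<close> and \<open>K\<close>, hence
  uniformly in the start vector. The dissipation is integrated only up to degree P = p - 1, because
  integration raises the degree by one and R agrees with exp only up to degree p.\<close>

lemma energy_decay:
  fixes r :: "nat \<Rightarrow> real"
  assumes p: "p = Suc P" "p \<le> s" "2 * m \<le> P" and r: "\<And>j. j \<le> p \<Longrightarrow> r j = 1 / fact j"
    and M: "0 \<le> M" and \<kappa>: "0 < \<kappa>"
  shows "\<exists>\<tau>0>0. \<forall>G K. energy_kernel G K \<and> psd_upto P K \<and>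
      (\<forall>j\<le>s. \<forall>k\<le>s. \<bar>G j k\<bar> \<le> M * G 0 0) \<and> \<kappa> * G 0 0 \<le> (\<Sum>i\<le>m. K i i) \<longrightarrow>
      (\<forall>\<tau>. 0 < \<tau> \<and> \<tau> \<le> \<tau>0 \<longrightarrow> (\<Sum>j\<le>s. \<Sum>k\<le>s. \<tau> ^ (j + k) * (r j * r k * G j k)) \<le> G 0 0)"
proof -
  obtain C where C: "C > 0" and hilb: "\<And>b. psd_upto P b \<Longrightarrow> (\<Sum>i\<le>P. b i i) \<le> C * hilbert_form P b (\<lambda>_. 1)"
    using hilbert_form_lower_bound[of P] by blast
  \<comment> \<open>\<open>D1\<close> bounds the energy terms beyond degree p and \<open>D2\<close>
    the dissipation terms beyond degree P; the summand 1 makes \<open>D\<close> positive.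
    \<open>E\<close> is the coercivity constant after the Hilbert bound, with (m!)^2 from the
    weights \<tau>^i / i!.\<close>
  define D1 where "D1 = (\<Sum>j\<le>s. \<Sum>k\<le>s. \<bar>r j * r k\<bar> * M)"
  define D2 where "D2 = (\<Sum>j\<le>P. \<Sum>k\<le>P. M)"
  define D where "D = D1 + 2 * D2 + 1"
  define E where "E = \<kappa> / (C * (fact m)\<^sup>2)"
  have D: "0 < D" using M by (auto simp: D_def D1_def D2_def intro!: add_nonneg_pos add_nonneg_nonneg sum_nonneg)
  have E: "0 < E" using \<kappa> C by (simp add: E_def)
  show ?thesis
  proof (intro exI[of _ "min 1 (2 * E / D)"] conjI allI impI; (elim conjE)?)
    show "0 < min 1 (2 * E / D)" using D E by simp
    fix G K :: "nat \<Rightarrow> nat \<Rightarrow> real" and \<tau> :: real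
    assume GK: "energy_kernel G K" and psd: "psd_upto P K"
      and GM: "\<forall>j\<le>s. \<forall>k\<le>s. \<bar>G j k\<bar> \<le> M * G 0 0" and coercive: "\<kappa> * G 0 0 \<le> (\<Sum>i\<le>m. K i i)"
      and \<tau>: "0 < \<tau>" "\<tau> \<le> min 1 (2 * E / D)"
    interpret energy_kernel G K by (rule GK)
    have \<tau>1: "\<tau> \<le> 1" and "\<tau> \<le> 2 * E / D" using \<tau> by auto
    then have \<tau>D: "\<tau> * D \<le> 2 * E" using D by (simp add: field_simps)
    define N where "N = G 0 0"
    have "\<bar>G 0 0\<bar> \<le> M * N" using GM by (auto simp: N_def)
    have N: "0 \<le> N"
    proof (rule ccontr)
      assume "\<not> 0 \<le> N"
      then have "M * N \<le> 0" using M by (simp add: mult_nonneg_nonpos)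
      then show False using \<open>\<bar>G 0 0\<bar> \<le> M * N\<close> \<open>\<not> 0 \<le> N\<close> by (simp add: N_def)
    qed
    have KM: "\<bar>K j k\<bar> \<le> M * N" if "j \<le> P" "k \<le> P" for j k
    proof -
      have "\<bar>G (Suc j) k\<bar> \<le> M * N" "\<bar>G j (Suc k)\<bar> \<le> M * N" using that p GM by (auto simp: N_def)
      then show ?thesis using G_step[of j k] by linarith
    qed
    define b where "b j k = \<tau> * ((\<tau> ^ j / fact j) * (\<tau> ^ k / fact k) * K j k)" for j k
    have b: "psd_upto P b" unfolding b_def using psd_upto_scale[OF psd, of \<tau> "\<lambda>j. \<tau> ^ j / fact j"] \<tau> by simp
    define f where "f j k = r j * r k * G j k" for j k
    define h where "h j k = \<tau> * K j k / (fact j * fact k * real (j + k + 1))" for j k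
    define F where "F = (\<Sum>j\<le>s. \<Sum>k\<le>s. \<tau> ^ (j + k) * f j k)"
    define H where "H = hilbert_form P b (\<lambda>_. 1)"
    define R1 where "R1 = (\<Sum>j\<le>s. \<Sum>k\<le>s. if p < j + k then \<tau> ^ (j + k) * f j k else 0)"
    define R2 where "R2 = (\<Sum>j\<le>P. \<Sum>k\<le>P. if P < j + k then \<tau> ^ (j + k) * h j k else 0)"

    have "\<bar>R1\<bar> \<le> \<tau> ^ Suc p * (\<Sum>j\<le>s. \<Sum>k\<le>s. \<bar>r j * r k\<bar> * (M * N))"
      unfolding R1_def f_def
      by (rule triangle_tail_bound) (use \<tau> GM in \<open>auto simp: abs_mult N_def intro!: mult_left_mono\<close>)
    also have "\<dots> = \<tau> ^ Suc p * (D1 * N)" by (simp add: D1_def sum_distrib_right mult.assoc)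
    finally have R1: "\<bar>R1\<bar> \<le> \<tau> ^ Suc p * (D1 * N)" .
    have "\<bar>h j k\<bar> \<le> \<tau> * (M * N)" if "j \<le> P" "k \<le> P" for j k
    proof -
      have "(1::real) \<le> fact j * fact k" using mult_mono[of 1 "fact j::real" 1 "fact k"] by simp
      then have d: "(1::real) \<le> fact j * fact k * real (j + k + 1)" (is "1 \<le> ?d")
        using mult_mono[of 1 "fact j * fact k::real" 1 "real (j + k + 1)"] by simp
      have "\<bar>\<tau> * K j k\<bar> * 1 \<le> \<bar>\<tau> * K j k\<bar> * ?d" by (rule mult_left_mono[OF d]) simp
      moreover have "\<bar>h j k\<bar> = \<bar>\<tau> * K j k\<bar> / ?d" unfolding h_def abs_divide using d by linarith
      moreover have "0 < ?d" using d by linarith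
      ultimately have "\<bar>h j k\<bar> \<le> \<bar>\<tau> * K j k\<bar>" by (simp only: pos_divide_le_eq mult_1_right)
      also have "\<dots> \<le> \<tau> * (M * N)" using KM[OF that] \<tau> by (simp add: abs_mult mult_left_mono)
      finally show ?thesis .
    qed
    then have "\<bar>R2\<bar> \<le> \<tau> ^ Suc P * (\<Sum>j\<le>P. \<Sum>k\<le>P. \<tau> * (M * N))"
      unfolding R2_def using \<tau> by (intro triangle_tail_bound) auto
    also have "\<dots> = \<tau> ^ Suc p * (D2 * N)" by (simp add: D2_def p)
    finally have R2: "\<bar>R2\<bar> \<le> \<tau> ^ Suc p * (D2 * N)" .

    have F: "F = (\<Sum>n\<le>p. \<Sum>j\<le>n. \<tau> ^ (j + (n - j)) * f j (n - j)) + R1"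
      unfolding F_def R1_def by (rule double_sum_triangle_split[OF p(2)])
    have H: "H = (\<Sum>n\<le>P. \<Sum>j\<le>n. \<tau> ^ (j + (n - j)) * h j (n - j)) + R2"
    proof -
      have "H = (\<Sum>j\<le>P. \<Sum>k\<le>P. \<tau> ^ (j + k) * h j k)"
        unfolding H_def hilbert_form_def by (simp add: b_def h_def power_add mult_ac)
      also have "\<dots> = (\<Sum>n\<le>P. \<Sum>j\<le>n. \<tau> ^ (j + (n - j)) * h j (n - j)) + R2"
        unfolding R2_def by (rule double_sum_triangle_split) simp
      finally show ?thesis .
    qed
    have step: "(\<Sum>j\<le>Suc n. \<tau> ^ (j + (Suc n - j)) * f j (Suc n - j)) = - 2 * (\<Sum>j\<le>n. \<tau> ^ (j + (n - j)) * h j (n - j))"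
      if "n \<le> P" for n
    proof -
      have "(\<Sum>j\<le>Suc n. \<tau> ^ (j + (Suc n - j)) * f j (Suc n - j))
        = \<tau> ^ Suc n * (\<Sum>j\<le>Suc n. G j (Suc n - j) / (fact j * fact (Suc n - j)))"
        unfolding sum_distrib_left
        by (intro sum.cong refl) (use that p in \<open>simp add: f_def r\<close>)
      also have "\<dots> = - 2 * (\<tau> ^ Suc n * ((\<Sum>j\<le>n. K j (n - j) / (fact j * fact (n - j))) / real (Suc n)))"
        unfolding exp_energy_coeff by simp
      also have "\<tau> ^ Suc n * ((\<Sum>j\<le>n. K j (n - j) / (fact j * fact (n - j))) / real (Suc n))
        = (\<Sum>j\<le>n. \<tau> ^ (j + (n - j)) * h j (n - j))"
        unfolding sum_distrib_left sum_divide_distrib by (intro sum.cong refl) (simp add: h_def)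
      finally show ?thesis .
    qed
    have "(\<Sum>n\<le>p. \<Sum>j\<le>n. \<tau> ^ (j + (n - j)) * f j (n - j))
       = N + (\<Sum>n\<le>P. \<Sum>j\<le>Suc n. \<tau> ^ (j + (Suc n - j)) * f j (Suc n - j))"
      unfolding p(1) by (subst sum.atMost_Suc_shift) (simp add: f_def r N_def)
    also have "\<dots> = N - 2 * (\<Sum>n\<le>P. \<Sum>j\<le>n. \<tau> ^ (j + (n - j)) * h j (n - j))"
    proof -
      have "(\<Sum>n\<le>P. \<Sum>j\<le>Suc n. \<tau> ^ (j + (Suc n - j)) * f j (Suc n - j))
        = (\<Sum>n\<le>P. - 2 * (\<Sum>j\<le>n. \<tau> ^ (j + (n - j)) * h j (n - j)))"
        by (rule sum.cong[OF refl], rule step) simp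
      then show ?thesis unfolding sum_distrib_left[symmetric] by linarith
    qed
    \<comment> \<open>The full Hilbert form \<open>H\<close> contains a tail \<open>R2\<close> that
      has no counterpart in the matched part of the energy, so it is added back.\<close>
    finally have FH: "F = N - 2 * H + 2 * R2 + R1" using F H by simp

    have "\<tau> ^ (2 * m + 1) / (fact m)\<^sup>2 * (\<kappa> * N) \<le> \<tau> ^ (2 * m + 1) / (fact m)\<^sup>2 * (\<Sum>i\<le>m. K i i)"
      using coercive \<tau> by (intro mult_left_mono) (auto simp: N_def)
    also have "\<dots> \<le> (\<Sum>i\<le>m. b i i)"
      unfolding sum_distrib_left
    proof (rule sum_mono)
      fix i assume "i \<in> {..m}"
      then have i: "i \<le> m" by simp
      \<comment> \<open>Since \<tau> \<le> 1, the smallest weight is the last one; this is where the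
        power \<tau>^(2m+1) arises.\<close>
      have "\<tau> ^ m / fact m \<le> \<tau> ^ i / fact i"
        using \<tau> \<tau>1 i by (intro frac_le power_decreasing fact_mono) auto
      then have "(\<tau> ^ m / fact m)\<^sup>2 \<le> (\<tau> ^ i / fact i)\<^sup>2" using \<tau> by (intro power_mono) auto
      moreover have "0 \<le> K i i" using psd_upto_diag[OF psd, of i] i p by simp
      ultimately have "(\<tau> ^ m / fact m)\<^sup>2 * (\<tau> * K i i) \<le> (\<tau> ^ i / fact i)\<^sup>2 * (\<tau> * K i i)"
        using \<tau> by (intro mult_right_mono) auto
      moreover have odd_power: "\<tau> ^ (2 * m + 1) = \<tau> * (\<tau> ^ m * \<tau> ^ m)"
        by (simp add: power_even_eq power2_eq_square)
      ultimately show "\<tau> ^ (2 * m + 1) / (fact m)\<^sup>2 * K i i \<le> b i i"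
        unfolding odd_power by (simp add: b_def power2_eq_square mult_ac)
    qed
    also have "\<dots> \<le> (\<Sum>i\<le>P. b i i)"
      using psd_upto_diag[OF b] p by (intro sum_mono2) auto
    also have "\<dots> \<le> C * H" unfolding H_def by (rule hilb[OF b])
    finally have "\<tau> ^ (2 * m + 1) * (E * N) \<le> H" using C by (simp add: E_def field_simps)
    moreover have "\<tau> ^ Suc p * (D * N) \<le> \<tau> ^ (2 * m + 2) * (D * N)"
      using \<tau> \<tau>1 p N D by (intro mult_right_mono power_decreasing) auto
    moreover have "\<tau> ^ (2 * m + 1) * (\<tau> * D) * N \<le> \<tau> ^ (2 * m + 1) * (2 * E) * N"
      using \<tau> \<tau>D N by (intro mult_right_mono mult_left_mono) auto
    moreover have "R1 + 2 * R2 \<le> \<tau> ^ Suc p * (D * N)"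
    proof -
      have "R1 + 2 * R2 \<le> \<tau> ^ Suc p * (D1 * N) + 2 * (\<tau> ^ Suc p * (D2 * N))" using R1 R2 by linarith
      also have "\<dots> = \<tau> ^ Suc p * (D * N) - \<tau> ^ Suc p * N" by (simp add: D_def algebra_simps)
      finally show ?thesis using N \<tau> by (smt (verit) mult_nonneg_nonneg zero_le_power)
    qed
    ultimately have "F \<le> N" unfolding FH by (simp add: algebra_simps)
    then show "(\<Sum>j\<le>s. \<Sum>k\<le>s. \<tau> ^ (j + k) * (r j * r k * G j k)) \<le> G 0 0"
      by (simp add: F_def f_def N_def)
  qed
qed

section \<open>Real inner products of complex vectors\<close>

text \<open>The real part is symmetric and bilinear over the reals, gives the same norm, and
  suffices because all scheme coefficients are real.\<close>

definition re_inner :: "complex vec \<Rightarrow> complex vec \<Rightarrow> real" where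
  "re_inner x y = Re (x \<bullet>c y)"

definition lincomb :: "nat \<Rightarrow> nat \<Rightarrow> (nat \<Rightarrow> complex) \<Rightarrow> (nat \<Rightarrow> complex vec) \<Rightarrow> complex vec" where
  "lincomb n N \<alpha> X = vec n (\<lambda>r. \<Sum>j\<le>N. \<alpha> j * X j $ r)"

lemma lincomb_carrier [simp]: "lincomb n N \<alpha> X \<in> carrier_vec n"
  by (simp add: lincomb_def)

lemma lincomb_index: "r < n \<Longrightarrow> lincomb n N \<alpha> X $ r = (\<Sum>j\<le>N. \<alpha> j * X j $ r)"
  by (simp add: lincomb_def)

lemma re_inner_sum:
  assumes "x \<in> carrier_vec n" "y \<in> carrier_vec n"
  shows "re_inner x y = (\<Sum>i<n. Re (x $ i * cnj (y $ i)))"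
proof -
  have "x \<bullet>c y = (\<Sum>i<n. x $ i * cnj (y $ i))"
    using assms by (simp add: scalar_prod_def atLeast0LessThan)
  then show ?thesis by (simp add: re_inner_def)
qed

lemma re_inner_commute:
  "x \<in> carrier_vec n \<Longrightarrow> y \<in> carrier_vec n \<Longrightarrow> re_inner x y = re_inner y x"
  by (simp add: re_inner_sum mult.commute)

lemma re_inner_add_left:
  assumes "x \<in> carrier_vec n" "y \<in> carrier_vec n" "z \<in> carrier_vec n"
  shows "re_inner (x + y) z = re_inner x z + re_inner y z"
  using assms by (simp add: re_inner_sum[of _ n] distrib_right sum.distrib)

lemma re_inner_smult_left:
  assumes "x \<in> carrier_vec n" "z \<in> carrier_vec n"
  shows "re_inner (complex_of_real t \<cdot>\<^sub>v x) z = t * re_inner x z"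
  using assms by (simp add: re_inner_sum[of _ n] sum_distrib_left algebra_simps)

lemma re_inner_lincomb_left:
  assumes "\<And>j. X j \<in> carrier_vec n" "y \<in> carrier_vec n"
  shows "re_inner (lincomb n N (\<lambda>j. complex_of_real (\<alpha> j)) X) y = (\<Sum>j\<le>N. \<alpha> j * re_inner (X j) y)"
proof -
  have "re_inner (lincomb n N (\<lambda>j. complex_of_real (\<alpha> j)) X) y
      = (\<Sum>i<n. \<Sum>j\<le>N. \<alpha> j * Re (X j $ i * cnj (y $ i)))"
    using assms by (simp add: re_inner_sum[of _ n] lincomb_index sum_distrib_right sum_distrib_left
        algebra_simps sum_subtractf sum.distrib sum_negf)
  also have "\<dots> = (\<Sum>j\<le>N. \<alpha> j * re_inner (X j) y)"
    by (subst sum.swap) (simp only: re_inner_sum[OF assms] sum_distrib_left)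
  finally show ?thesis .
qed

lemma re_inner_lincomb:
  assumes X: "\<And>j. X j \<in> carrier_vec n" and Y: "\<And>j. Y j \<in> carrier_vec n"
  shows "re_inner (lincomb n N (\<lambda>j. complex_of_real (\<alpha> j)) X) (lincomb n N (\<lambda>j. complex_of_real (\<beta> j)) Y)
    = (\<Sum>j\<le>N. \<Sum>k\<le>N. \<alpha> j * \<beta> k * re_inner (X j) (Y k))"
proof -
  have "re_inner (X j) (lincomb n N (\<lambda>k. complex_of_real (\<beta> k)) Y) = (\<Sum>k\<le>N. \<beta> k * re_inner (X j) (Y k))" for j
    using re_inner_lincomb_left[of Y n "X j" N \<beta>] re_inner_commute[OF X Y]
      re_inner_commute[OF X lincomb_carrier] X Y by simp
  then show ?thesis
    by (subst re_inner_lincomb_left[OF X lincomb_carrier]) (simp add: sum_distrib_left mult.assoc)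
qed

lemma mult_mat_lincomb:
  assumes A: "A \<in> carrier_mat n n" and X: "\<And>j. X j \<in> carrier_vec n"
  shows "A *\<^sub>v lincomb n N \<alpha> X = lincomb n N \<alpha> (\<lambda>j. A *\<^sub>v X j)"
proof (rule eq_vecI)
  show "dim_vec (A *\<^sub>v lincomb n N \<alpha> X) = dim_vec (lincomb n N \<alpha> (\<lambda>j. A *\<^sub>v X j))"
    using A by (simp add: lincomb_def)
  fix r assume "r < dim_vec (lincomb n N \<alpha> (\<lambda>j. A *\<^sub>v X j))"
  then have r: "r < n" by (simp add: lincomb_def)
  have "(A *\<^sub>v lincomb n N \<alpha> X) $ r = (\<Sum>k<n. \<Sum>j\<le>N. \<alpha> j * (A $$ (r, k) * X j $ k))"
    unfolding mult_vec_index[OF A lincomb_carrier r]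
    by (intro sum.cong refl) (simp add: lincomb_index sum_distrib_left mult.left_commute)
  also have "\<dots> = (\<Sum>j\<le>N. \<alpha> j * (A *\<^sub>v X j) $ r)"
    by (subst sum.swap) (simp only: mult_vec_index[OF A X r] sum_distrib_left)
  finally show "(A *\<^sub>v lincomb n N \<alpha> X) $ r = lincomb n N \<alpha> (\<lambda>j. A *\<^sub>v X j) $ r"
    using r by (simp add: lincomb_index)
qed

lemma re_inner_self: "x \<in> carrier_vec n \<Longrightarrow> re_inner x x = (\<Sum>i<n. (cmod (x $ i))\<^sup>2)"
  by (simp add: re_inner_sum[of _ n] cmod_power2 power2_eq_square[symmetric])

lemma re_inner_self_nonneg: "x \<in> carrier_vec n \<Longrightarrow> 0 \<le> re_inner x x"
  by (simp add: re_inner_self sum_nonneg)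

lemma re_inner_self_eq_0: "x \<in> carrier_vec n \<Longrightarrow> re_inner x x = 0 \<longleftrightarrow> x = 0\<^sub>v n"
  by (auto simp: re_inner_self sum_nonneg_eq_0_iff)

lemma re_inner_self_pos: "x \<in> carrier_vec n \<Longrightarrow> x \<noteq> 0\<^sub>v n \<Longrightarrow> 0 < re_inner x x"
  using re_inner_self_nonneg[of x n] re_inner_self_eq_0[of x n] by linarith

lemma vec_norm2_eq: "vec_norm2 x = sqrt (re_inner x x)"
  by (simp add: vec_norm2_def re_inner_self[of x "dim_vec x"])

section \<open>Adjoints, Hermitian matrices and norm bounds\<close>

lemma mat_adjoint_carrier [simp]: "A \<in> carrier_mat n n \<Longrightarrow> mat_adjoint A \<in> carrier_mat n n"
  unfolding mat_adjoint_def carrier_mat_def mem_Collect_eq by simp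
lemma mat_adjoint_index:
  assumes "A \<in> carrier_mat n n" "i < n" "j < n"
  shows "mat_adjoint A $$ (i, j) = cnj (A $$ (j, i))"
proof -
  have "length (cols A) = n" "dim_row A = n" "dim_col A = n" using assms by simp_all
  then show ?thesis using assms(2,3) by (simp add: mat_adjoint_def mat_of_rows_def)
qed

lemma re_inner_adjoint:
  assumes A: "A \<in> carrier_mat n n" and x: "x \<in> carrier_vec n" and y: "y \<in> carrier_vec n"
  shows "re_inner (A *\<^sub>v x) y = re_inner x (mat_adjoint A *\<^sub>v y)"
proof -
  have c: "A *\<^sub>v x \<in> carrier_vec n" "mat_adjoint A *\<^sub>v y \<in> carrier_vec n"
    by (rule mult_mat_vec_carrier[OF A x], rule mult_mat_vec_carrier[OF mat_adjoint_carrier[OF A] y])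
  have "re_inner (A *\<^sub>v x) y = (\<Sum>i<n. \<Sum>k<n. Re (A $$ (i, k) * x $ k * cnj (y $ i)))"
    unfolding re_inner_sum[OF c(1) y]
    by (intro sum.cong refl) (simp add: mult_vec_index[OF A x] sum_distrib_right del: index_mult_mat_vec times_complex.sel)
  also have "\<dots> = (\<Sum>k<n. \<Sum>i<n. Re (x $ k * cnj (mat_adjoint A $$ (k, i) * y $ i)))"
    by (subst sum.swap, intro sum.cong refl)
      (simp add: mat_adjoint_index[OF A] mult_ac del: index_mult_mat_vec times_complex.sel)
  also have "\<dots> = re_inner x (mat_adjoint A *\<^sub>v y)"
    unfolding re_inner_sum[OF x c(2)]
    by (intro sum.cong refl)
      (simp add: mult_vec_index[OF mat_adjoint_carrier[OF A] y] sum_distrib_left del: index_mult_mat_vec times_complex.sel)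
  finally show ?thesis .
qed

lemma mat_adjoint_adjoint:
  assumes "(A :: complex mat) \<in> carrier_mat n n"
  shows "mat_adjoint (mat_adjoint A) = A"
proof (rule eq_matI)
  have A': "mat_adjoint A \<in> carrier_mat n n" and A'': "mat_adjoint (mat_adjoint A) \<in> carrier_mat n n"
    using assms by simp_all
  then show "dim_row (mat_adjoint (mat_adjoint A)) = dim_row A" "dim_col (mat_adjoint (mat_adjoint A)) = dim_col A"
    using assms by (metis carrier_matD)+
  fix i j assume "i < dim_row A" "j < dim_col A"
  then show "mat_adjoint (mat_adjoint A) $$ (i, j) = A $$ (i, j)"
    using assms by (simp add: mat_adjoint_index[OF A'] mat_adjoint_index[OF assms])
qed

text \<open>The real part alone already determines the adjoint: the difference of
  \<open>A *\<^sub>v y\<close> and the adjoint applied to \<open>y\<close> is orthogonal to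
  itself.\<close>

lemma hermitian_iff_re_inner:
  assumes A: "A \<in> carrier_mat n n"
  shows "hermitian A \<longleftrightarrow> (\<forall>x\<in>carrier_vec n. \<forall>y\<in>carrier_vec n. re_inner (A *\<^sub>v x) y = re_inner x (A *\<^sub>v y))"
proof
  assume "hermitian A"
  then show "\<forall>x\<in>carrier_vec n. \<forall>y\<in>carrier_vec n. re_inner (A *\<^sub>v x) y = re_inner x (A *\<^sub>v y)"
    using re_inner_adjoint[OF A] by (simp add: hermitian_def)
next
  assume sym: "\<forall>x\<in>carrier_vec n. \<forall>y\<in>carrier_vec n. re_inner (A *\<^sub>v x) y = re_inner x (A *\<^sub>v y)"
  have A': "mat_adjoint A \<in> carrier_mat n n" using A by simp
  have eq: "mat_adjoint A *\<^sub>v y = A *\<^sub>v y" if y: "y \<in> carrier_vec n" for y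
  proof -
    let ?z = "A *\<^sub>v y + complex_of_real (- 1) \<cdot>\<^sub>v (mat_adjoint A *\<^sub>v y)"
    have c: "A *\<^sub>v y \<in> carrier_vec n" "mat_adjoint A *\<^sub>v y \<in> carrier_vec n"
      by (rule mult_mat_vec_carrier[OF A y], rule mult_mat_vec_carrier[OF A' y])
    then have z: "?z \<in> carrier_vec n" by simp
    have "re_inner ?z ?z = re_inner (A *\<^sub>v y) ?z - re_inner (mat_adjoint A *\<^sub>v y) ?z"
      using c z by (subst re_inner_add_left[of _ n]) (auto simp: re_inner_smult_left[of _ n] simp del: of_real_minus of_real_1)
    also have "\<dots> = re_inner ?z (A *\<^sub>v y) - re_inner ?z (mat_adjoint A *\<^sub>v y)"
      using c z re_inner_commute by metis
    also have "\<dots> = 0" using sym re_inner_adjoint[OF A z y] z y by simp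
    finally have "?z = 0\<^sub>v n" using re_inner_self_eq_0[OF z] by simp
    show ?thesis
    proof (rule eq_vecI)
      fix i assume "i < dim_vec (A *\<^sub>v y)"
      then have i: "i < n" using A by simp
      have "?z $ i = 0" using \<open>?z = 0\<^sub>v n\<close> i by (metis index_zero_vec(1))
      then show "(mat_adjoint A *\<^sub>v y) $ i = (A *\<^sub>v y) $ i" using i A carrier_matD(1)[OF A'] by (simp del: index_mult_mat_vec)
    qed (use A carrier_matD(1)[OF A'] in simp)
  qed
  have col: "(M *\<^sub>v unit_vec n j) $ i = M $$ (i, j)" if "M \<in> carrier_mat n n" "i < n" "j < n" for M :: "complex mat" and i j
  proof -
    have "(M *\<^sub>v unit_vec n j) $ i = (\<Sum>k<n. if k = j then M $$ (i, k) else 0)"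
      unfolding mult_vec_index[OF that(1) unit_vec_carrier that(2)]
      by (intro sum.cong refl) (use that(3) in auto)
    then show ?thesis using that(3) by simp
  qed
  show "hermitian A" unfolding hermitian_def
  proof (rule eq_matI)
    fix i j assume "i < dim_row A" "j < dim_col A"
    then have ij: "i < n" "j < n" using A by auto
    show "mat_adjoint A $$ (i, j) = A $$ (i, j)"
      using eq[of "unit_vec n j"] col[OF A' ij] col[OF A ij] by simp
  qed (use A carrier_matD[OF A'] in auto)
qed

lemma re_inner_mult_mat_le:
  assumes A: "A \<in> carrier_mat n n"
  shows "\<exists>C>0. \<forall>x\<in>carrier_vec n. re_inner (A *\<^sub>v x) (A *\<^sub>v x) \<le> C * re_inner x x"
proof -
  define C where "C = (\<Sum>i<n. (\<Sum>k<n. cmod (A $$ (i, k)))\<^sup>2) + 1"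
  have "re_inner (A *\<^sub>v x) (A *\<^sub>v x) \<le> C * re_inner x x" if x: "x \<in> carrier_vec n" for x
  proof -
    have c: "A *\<^sub>v x \<in> carrier_vec n" using A x by simp
    define N where "N = sqrt (re_inner x x)"
    have N2: "N\<^sup>2 = re_inner x x" and N0: "0 \<le> N" using re_inner_self_nonneg[OF x] by (auto simp: N_def)
    have xk: "cmod (x $ k) \<le> N" if "k < n" for k
    proof -
      have "(cmod (x $ k))\<^sup>2 \<le> (\<Sum>i<n. (cmod (x $ i))\<^sup>2)"
        using that by (intro member_le_sum) auto
      then show ?thesis unfolding N_def re_inner_self[OF x] by (rule real_le_rsqrt)
    qed
    have "(cmod ((A *\<^sub>v x) $ i))\<^sup>2 \<le> (\<Sum>k<n. cmod (A $$ (i, k)))\<^sup>2 * N\<^sup>2" if i: "i < n" for i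
    proof -
      have "cmod ((A *\<^sub>v x) $ i) \<le> (\<Sum>k<n. cmod (A $$ (i, k) * x $ k))"
        unfolding mult_vec_index[OF A x i] by (rule norm_sum)
      also have "\<dots> \<le> (\<Sum>k<n. cmod (A $$ (i, k)) * N)"
        using xk by (intro sum_mono) (auto simp: norm_mult intro!: mult_left_mono)
      finally have "cmod ((A *\<^sub>v x) $ i) \<le> (\<Sum>k<n. cmod (A $$ (i, k))) * N" by (simp add: sum_distrib_right)
      then show ?thesis unfolding power_mult_distrib[symmetric] by (intro power_mono) auto
    qed
    then have "re_inner (A *\<^sub>v x) (A *\<^sub>v x) \<le> (\<Sum>i<n. (\<Sum>k<n. cmod (A $$ (i, k)))\<^sup>2 * N\<^sup>2)"
      unfolding re_inner_self[OF c] by (intro sum_mono) auto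
    also have "\<dots> \<le> C * re_inner x x"
      using re_inner_self_nonneg[OF x] by (simp add: C_def N2 sum_distrib_right distrib_right)
    finally show ?thesis .
  qed
  moreover have "0 < C" unfolding C_def by (intro add_nonneg_pos sum_nonneg) auto
  ultimately show ?thesis by blast
qed

lemma re_inner_le:
  assumes x: "x \<in> carrier_vec n" and y: "y \<in> carrier_vec n"
  shows "2 * \<bar>re_inner x y\<bar> \<le> re_inner x x + re_inner y y"
proof -
  have "2 * \<bar>Re (x $ i * cnj (y $ i))\<bar> \<le> (cmod (x $ i))\<^sup>2 + (cmod (y $ i))\<^sup>2" for i
  proof -
    have "2 * \<bar>Re (x $ i * cnj (y $ i))\<bar> \<le> 2 * cmod (x $ i) * cmod (y $ i)"
      using abs_Re_le_cmod[of "x $ i * cnj (y $ i)"] unfolding norm_mult complex_mod_cnj by linarith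
    also have "\<dots> \<le> (cmod (x $ i))\<^sup>2 + (cmod (y $ i))\<^sup>2" by (rule sum_squares_bound)
    finally show ?thesis .
  qed
  then have "(\<Sum>i<n. 2 * \<bar>Re (x $ i * cnj (y $ i))\<bar>) \<le> re_inner x x + re_inner y y"
    unfolding re_inner_self[OF x] re_inner_self[OF y] sum.distrib[symmetric] by (intro sum_mono) auto
  moreover have "\<bar>re_inner x y\<bar> \<le> (\<Sum>i<n. \<bar>Re (x $ i * cnj (y $ i))\<bar>)"
    unfolding re_inner_sum[OF x y] by (rule sum_abs)
  ultimately show ?thesis unfolding sum_distrib_left[symmetric] by linarith
qed

section \<open>Negative semidefinite forms\<close>

lemma neg_quadratic_form_discriminant:
  fixes a b c :: real
  assumes "\<And>s t. s\<^sup>2 * a + 2 * s * t * b + t\<^sup>2 * c \<le> 0"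
  shows "b\<^sup>2 \<le> a * c"
proof -
  have a: "a \<le> 0" and c: "c \<le> 0" using assms[of 1 0] assms[of 0 1] by simp_all
  have "c * (a * c - b\<^sup>2) \<le> 0" using assms[of c "- b"] by (simp add: power2_eq_square algebra_simps)
  moreover have "a * (a * c - b\<^sup>2) \<le> 0" using assms[of "- b" a] by (simp add: power2_eq_square algebra_simps)
  moreover have "b\<^sup>2 \<le> 0" if "a = 0" "c = 0" using assms[of 1 b] that by (simp add: power2_eq_square)
  ultimately show ?thesis
    using a c by (cases "a = 0"; cases "c = 0") (auto simp: mult_le_0_iff zero_le_mult_iff)
qed

locale neg_semidef_form =
  fixes n :: nat and A :: "complex mat"
  assumes A: "A \<in> carrier_mat n n"
    and sym: "\<And>x y. x \<in> carrier_vec n \<Longrightarrow> y \<in> carrier_vec n \<Longrightarrow> re_inner (A *\<^sub>v x) y = re_inner x (A *\<^sub>v y)"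
    and nonpos: "\<And>x. x \<in> carrier_vec n \<Longrightarrow> re_inner (A *\<^sub>v x) x \<le> 0"
begin

lemma Ax_carrier [simp]: "x \<in> carrier_vec n \<Longrightarrow> A *\<^sub>v x \<in> carrier_vec n"
  by (rule mult_mat_vec_carrier[OF A])

lemma sym': "x \<in> carrier_vec n \<Longrightarrow> y \<in> carrier_vec n \<Longrightarrow> re_inner (A *\<^sub>v x) y = re_inner (A *\<^sub>v y) x"
  using sym re_inner_commute[OF _ Ax_carrier] by metis

lemma cauchy_schwarz:
  assumes x: "x \<in> carrier_vec n" and y: "y \<in> carrier_vec n"
  shows "(re_inner (A *\<^sub>v x) y)\<^sup>2 \<le> re_inner (A *\<^sub>v x) x * re_inner (A *\<^sub>v y) y"
proof (rule neg_quadratic_form_discriminant)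
  fix s t :: real
  let ?s = "complex_of_real s" and ?t = "complex_of_real t"
  let ?z = "?s \<cdot>\<^sub>v x + ?t \<cdot>\<^sub>v y"
  have z: "?z \<in> carrier_vec n" using x y by simp
  have expand: "re_inner (A *\<^sub>v ?z) w = s * re_inner (A *\<^sub>v x) w + t * re_inner (A *\<^sub>v y) w"
    if w: "w \<in> carrier_vec n" for w
  proof -
    have "A *\<^sub>v ?z = ?s \<cdot>\<^sub>v (A *\<^sub>v x) + ?t \<cdot>\<^sub>v (A *\<^sub>v y)"
      using mult_add_distrib_mat_vec[OF A, of "?s \<cdot>\<^sub>v x" "?t \<cdot>\<^sub>v y"] mult_mat_vec[OF A x] mult_mat_vec[OF A y] x y
      by (metis smult_carrier_vec)
    then show ?thesis
      using re_inner_add_left[of "?s \<cdot>\<^sub>v (A *\<^sub>v x)" n "?t \<cdot>\<^sub>v (A *\<^sub>v y)" w]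
        re_inner_smult_left[OF Ax_carrier[OF x] w] re_inner_smult_left[OF Ax_carrier[OF y] w] x y w
      by (metis Ax_carrier smult_carrier_vec)
  qed
  have "re_inner (A *\<^sub>v ?z) ?z = s * re_inner (A *\<^sub>v ?z) x + t * re_inner (A *\<^sub>v ?z) y"
    unfolding expand[OF z] sym'[OF x z] sym'[OF y z] ..
  also have "\<dots> = s\<^sup>2 * re_inner (A *\<^sub>v x) x + 2 * s * t * re_inner (A *\<^sub>v x) y + t\<^sup>2 * re_inner (A *\<^sub>v y) y"
    unfolding expand[OF x] expand[OF y] sym'[OF y x] by (simp add: power2_eq_square algebra_simps)
  finally show "s\<^sup>2 * re_inner (A *\<^sub>v x) x + 2 * s * t * re_inner (A *\<^sub>v x) y + t\<^sup>2 * re_inner (A *\<^sub>v y) y \<le> 0"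
    using nonpos[OF z] by linarith
qed

lemma kernel_if_form_eq_0:
  assumes "x \<in> carrier_vec n" "re_inner (A *\<^sub>v x) x = 0"
  shows "A *\<^sub>v x = 0\<^sub>v n"
proof -
  have "(re_inner (A *\<^sub>v x) (A *\<^sub>v x))\<^sup>2 \<le> 0"
    using cauchy_schwarz[OF assms(1) Ax_carrier[OF assms(1)]] assms(2) by simp
  then show ?thesis using re_inner_self_eq_0[OF Ax_carrier[OF assms(1)]] by simp
qed

text \<open>The inverse \<open>B\<close> of \<open>A\<close> replaces compactness of the sphere:
  Cauchy-Schwarz for the form at \<open>B *\<^sub>v x\<close> and \<open>x\<close> bounds |x|^4 by
  |re_inner x (Bx)| times the form at x, and the first factor is at most (1 + C) |x|^2.\<close>

lemma coercive_if_definite: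
  assumes definite: "\<And>x. x \<in> carrier_vec n \<Longrightarrow> x \<noteq> 0\<^sub>v n \<Longrightarrow> A *\<^sub>v x \<noteq> 0\<^sub>v n"
  shows "\<exists>c>0. \<forall>x\<in>carrier_vec n. c * re_inner x x \<le> - re_inner (A *\<^sub>v x) x"
proof -
  have "det A \<noteq> 0" using det_0_iff_vec_prod_zero_field[OF A] definite by blast
  define B where "B = (1 / det A) \<cdot>\<^sub>m adj_mat A"
  have adj: "adj_mat A \<in> carrier_mat n n" by (rule adj_mat(1)[OF A])
  have B: "B \<in> carrier_mat n n" unfolding B_def using adj by simp
  have "A * B = 1\<^sub>m n"
    unfolding B_def mult_smult_distrib[OF A adj] adj_mat(2)[OF A] using \<open>det A \<noteq> 0\<close>
    by (intro eq_matI) auto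
  then have AB: "A *\<^sub>v (B *\<^sub>v x) = x" if "x \<in> carrier_vec n" for x
    using assoc_mult_mat_vec[OF A B that] that by simp
  obtain C where C: "C > 0" and le: "\<And>x. x \<in> carrier_vec n \<Longrightarrow> re_inner (B *\<^sub>v x) (B *\<^sub>v x) \<le> C * re_inner x x"
    using re_inner_mult_mat_le[OF B] by blast
  show ?thesis
  proof (intro exI[of _ "1 / (1 + C)"] conjI ballI)
    show "0 < 1 / (1 + C)" using C by simp
    fix x :: "complex vec" assume x: "x \<in> carrier_vec n"
    have y: "B *\<^sub>v x \<in> carrier_vec n" by (rule mult_mat_vec_carrier[OF B x])
    define N where "N = re_inner x x"
    define E where "E = - re_inner (A *\<^sub>v x) x"
    have N: "0 \<le> N" unfolding N_def by (rule re_inner_self_nonneg[OF x])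
    have E: "0 \<le> E" unfolding E_def using nonpos[OF x] by simp
    have "2 * \<bar>re_inner x (B *\<^sub>v x)\<bar> \<le> (1 + C) * N"
      using re_inner_le[OF x y] le[OF x] by (simp add: N_def distrib_right)
    then have b: "\<bar>re_inner x (B *\<^sub>v x)\<bar> \<le> (1 + C) * N" by linarith
    have "N\<^sup>2 \<le> re_inner x (B *\<^sub>v x) * - E"
      using cauchy_schwarz[OF y x] unfolding AB[OF x] N_def E_def by simp
    also have "\<dots> \<le> \<bar>re_inner x (B *\<^sub>v x)\<bar> * E"
      using E by (metis abs_ge_minus_self minus_mult_commute mult_right_mono)
    also have "\<dots> \<le> ((1 + C) * N) * E" using b E by (rule mult_right_mono)
    finally have "N * N \<le> N * ((1 + C) * E)" by (simp add: power2_eq_square mult_ac)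
    then have "N \<le> (1 + C) * E"
      using N E C by (cases "N = 0") (auto simp: mult_le_cancel_left)
    then show "1 / (1 + C) * re_inner x x \<le> - re_inner (A *\<^sub>v x) x"
      using C by (simp add: N_def E_def field_simps)
  qed
qed

end

section \<open>Matrix powers on vectors and sums of congruent forms\<close>

lemma pow_mat_mult_vec_carrier [simp]:
  assumes "A \<in> carrier_mat n n" "x \<in> carrier_vec n"
  shows "A ^\<^sub>m j *\<^sub>v x \<in> carrier_vec n"
  by (rule mult_mat_vec_carrier[OF pow_carrier_mat[OF assms(1)] assms(2)])

lemma pow_mat_mult_vec_0:
  assumes "(A :: complex mat) \<in> carrier_mat n n" "x \<in> carrier_vec n"
  shows "A ^\<^sub>m 0 *\<^sub>v x = x"
  using assms by simp

lemma pow_mat_mult_vec_Suc':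
  assumes "(A :: complex mat) \<in> carrier_mat n n" "x \<in> carrier_vec n"
  shows "A ^\<^sub>m Suc j *\<^sub>v x = A ^\<^sub>m j *\<^sub>v (A *\<^sub>v x)"
  by (simp only: pow_mat.simps assoc_mult_mat_vec[OF pow_carrier_mat[OF assms(1)] assms])

lemma pow_mat_mult_vec_add:
  assumes A: "(A :: complex mat) \<in> carrier_mat n n" and x: "x \<in> carrier_vec n"
  shows "A ^\<^sub>m (i + j) *\<^sub>v x = A ^\<^sub>m i *\<^sub>v (A ^\<^sub>m j *\<^sub>v x)"
  using x
proof (induction j arbitrary: x)
  case 0
  then show ?case using A by (simp only: pow_mat_mult_vec_0[OF A] add_0_right)
next
  case (Suc j)
  have "A *\<^sub>v x \<in> carrier_vec n" by (rule mult_mat_vec_carrier[OF A Suc.prems])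
  then show ?case
    using Suc.IH by (simp only: add_Suc_right pow_mat_mult_vec_Suc'[OF A Suc.prems])
qed

lemma pow_mat_mult_vec_Suc:
  assumes A: "(A :: complex mat) \<in> carrier_mat n n" and x: "x \<in> carrier_vec n"
  shows "A ^\<^sub>m Suc j *\<^sub>v x = A *\<^sub>v (A ^\<^sub>m j *\<^sub>v x)"
proof -
  have "A ^\<^sub>m Suc 0 *\<^sub>v z = A *\<^sub>v z" if "z \<in> carrier_vec n" for z
    using pow_mat_mult_vec_Suc'[OF A that, of 0] pow_mat_mult_vec_0[OF A] mult_mat_vec_carrier[OF A that] by simp
  then show ?thesis
    using pow_mat_mult_vec_add[OF A x, of "Suc 0" j] pow_mat_mult_vec_carrier[OF A x] by simp
qed

lemma re_inner_pow_adjoint: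
  assumes A: "A \<in> carrier_mat n n" and x: "x \<in> carrier_vec n" and y: "y \<in> carrier_vec n"
  shows "re_inner (A ^\<^sub>m j *\<^sub>v x) y = re_inner x (mat_adjoint A ^\<^sub>m j *\<^sub>v y)"
  using x
proof (induction j arbitrary: x)
  case 0
  then show ?case by (simp only: pow_mat_mult_vec_0[OF A] pow_mat_mult_vec_0[OF mat_adjoint_carrier[OF A] y])
next
  case (Suc j)
  note A' = mat_adjoint_carrier[OF A]
  have "re_inner (A ^\<^sub>m Suc j *\<^sub>v x) y = re_inner (A *\<^sub>v x) (mat_adjoint A ^\<^sub>m j *\<^sub>v y)"
    unfolding pow_mat_mult_vec_Suc'[OF A Suc.prems] by (rule Suc.IH[OF mult_mat_vec_carrier[OF A Suc.prems]])
  then show ?case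
    unfolding re_inner_adjoint[OF A Suc.prems pow_mat_mult_vec_carrier[OF A' y]] pow_mat_mult_vec_Suc[OF A' y] .
qed

text \<open>Used with two choices of B: the skew part of L gives the sum that defines the index, the
  adjoint of L gives the dissipation summed along the orbit of L.\<close>

definition sandwich_sum :: "complex mat \<Rightarrow> complex mat \<Rightarrow> nat \<Rightarrow> complex mat" where
  "sandwich_sum B A m = mat (dim_row A) (dim_row A) (\<lambda>rc. \<Sum>j\<le>m. (B ^\<^sub>m j * A * mat_adjoint B ^\<^sub>m j) $$ rc)"

context neg_semidef_form
begin

lemma re_inner_sandwich_sum:
  assumes B: "B \<in> carrier_mat n n" and x: "x \<in> carrier_vec n" and y: "y \<in> carrier_vec n"
  shows "re_inner (sandwich_sum B A m *\<^sub>v x) y =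
    (\<Sum>j\<le>m. re_inner (A *\<^sub>v (mat_adjoint B ^\<^sub>m j *\<^sub>v x)) (mat_adjoint B ^\<^sub>m j *\<^sub>v y))"
proof -
  let ?M = "\<lambda>j. B ^\<^sub>m j * A * mat_adjoint B ^\<^sub>m j"
  let ?S = "sandwich_sum B A m"
  note B' = mat_adjoint_carrier[OF B]
  have BA: "B ^\<^sub>m j * A \<in> carrier_mat n n" for j by (rule mult_carrier_mat[OF pow_carrier_mat[OF B] A])
  have M: "?M j \<in> carrier_mat n n" for j using mult_carrier_mat[OF BA pow_carrier_mat[OF B']] .
  have S: "?S \<in> carrier_mat n n" using A by (simp add: sandwich_sum_def)
  have Mx: "?M j *\<^sub>v x = B ^\<^sub>m j *\<^sub>v (A *\<^sub>v (mat_adjoint B ^\<^sub>m j *\<^sub>v x))" for j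
    using assoc_mult_mat_vec[OF BA pow_carrier_mat[OF B'] x]
      assoc_mult_mat_vec[OF pow_carrier_mat[OF B] A pow_mat_mult_vec_carrier[OF B' x]] by metis
  have "?S *\<^sub>v x = lincomb n m (\<lambda>j. complex_of_real 1) (\<lambda>j. ?M j *\<^sub>v x)"
  proof (rule eq_vecI)
    show "dim_vec (?S *\<^sub>v x) = dim_vec (lincomb n m (\<lambda>j. complex_of_real 1) (\<lambda>j. ?M j *\<^sub>v x))"
      using S by (simp add: lincomb_def)
    fix r assume "r < dim_vec (lincomb n m (\<lambda>j. complex_of_real 1) (\<lambda>j. ?M j *\<^sub>v x))"
    then have r: "r < n" by (simp add: lincomb_def)
    have "(?S *\<^sub>v x) $ r = (\<Sum>k<n. \<Sum>j\<le>m. ?M j $$ (r, k) * x $ k)"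
      unfolding mult_vec_index[OF S x r]
      by (intro sum.cong refl) (use A r in \<open>simp add: sandwich_sum_def sum_distrib_right del: index_mult_mat\<close>)
    also have "\<dots> = (\<Sum>j\<le>m. (?M j *\<^sub>v x) $ r)"
      by (subst sum.swap) (simp only: mult_vec_index[OF M x r])
    finally show "(?S *\<^sub>v x) $ r = lincomb n m (\<lambda>j. complex_of_real 1) (\<lambda>j. ?M j *\<^sub>v x) $ r"
      unfolding lincomb_index[OF r] by simp
  qed
  then have "re_inner (?S *\<^sub>v x) y = (\<Sum>j\<le>m. 1 * re_inner (?M j *\<^sub>v x) y)"
    using re_inner_lincomb_left[OF mult_mat_vec_carrier[OF M x] y, of m "\<lambda>_. 1"] by simp
  then show ?thesis
    by (simp only: Mx mult_1 re_inner_pow_adjoint[OF B Ax_carrier[OF pow_mat_mult_vec_carrier[OF B' x]] y])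
qed

lemma sandwich_sum_neg_semidef_form:
  assumes B: "B \<in> carrier_mat n n"
  shows "neg_semidef_form n (sandwich_sum B A m)"
proof
  note B' = mat_adjoint_carrier[OF B]
  show S: "sandwich_sum B A m \<in> carrier_mat n n" using A by (simp add: sandwich_sum_def)
  fix x :: "complex vec" assume x: "x \<in> carrier_vec n"
  show "re_inner (sandwich_sum B A m *\<^sub>v x) x \<le> 0"
    unfolding re_inner_sandwich_sum[OF B x x]
    by (intro sum_nonpos nonpos pow_mat_mult_vec_carrier[OF B' x])
  fix y :: "complex vec" assume y: "y \<in> carrier_vec n"
  have "re_inner (sandwich_sum B A m *\<^sub>v x) y = re_inner (sandwich_sum B A m *\<^sub>v y) x"
    unfolding re_inner_sandwich_sum[OF B x y] re_inner_sandwich_sum[OF B y x]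
    by (intro sum.cong refl sym' pow_mat_mult_vec_carrier[OF B'] x y)
  then show "re_inner (sandwich_sum B A m *\<^sub>v x) y = re_inner x (sandwich_sum B A m *\<^sub>v y)"
    using re_inner_commute[OF mult_mat_vec_carrier[OF S y] x] by simp
qed

lemma sandwich_sum_kernel_iff:
  assumes B: "B \<in> carrier_mat n n" and x: "x \<in> carrier_vec n"
  shows "re_inner (sandwich_sum B A m *\<^sub>v x) x = 0 \<longleftrightarrow> (\<forall>j\<le>m. A *\<^sub>v (mat_adjoint B ^\<^sub>m j *\<^sub>v x) = 0\<^sub>v n)"
proof -
  let ?f = "\<lambda>j. re_inner (A *\<^sub>v (mat_adjoint B ^\<^sub>m j *\<^sub>v x)) (mat_adjoint B ^\<^sub>m j *\<^sub>v x)"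
  have c: "mat_adjoint B ^\<^sub>m j *\<^sub>v x \<in> carrier_vec n" for j
    by (rule pow_mat_mult_vec_carrier[OF mat_adjoint_carrier[OF B] x])
  have "re_inner (sandwich_sum B A m *\<^sub>v x) x = 0 \<longleftrightarrow> (\<Sum>j\<le>m. - ?f j) = 0"
    by (simp add: re_inner_sandwich_sum[OF B x x] sum_negf)
  also have "\<dots> \<longleftrightarrow> (\<forall>j\<le>m. ?f j = 0)"
    using nonpos[OF c] by (subst sum_nonneg_eq_0_iff) auto
  also have "\<dots> \<longleftrightarrow> (\<forall>j\<le>m. A *\<^sub>v (mat_adjoint B ^\<^sub>m j *\<^sub>v x) = 0\<^sub>v n)"
  proof -
    have "?f j = 0 \<longleftrightarrow> A *\<^sub>v (mat_adjoint B ^\<^sub>m j *\<^sub>v x) = 0\<^sub>v n" for j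
      using kernel_if_form_eq_0[OF c] re_inner_sum[OF zero_carrier_vec c] by (auto simp del: index_mult_mat_vec)
    then show ?thesis by simp
  qed
  finally show ?thesis .
qed

end

section \<open>Semi-dissipative matrices\<close>

lemma herm_part_carrier [simp]: "L \<in> carrier_mat n n \<Longrightarrow> herm_part L \<in> carrier_mat n n"
  using mat_adjoint_carrier[of L n] by (simp add: herm_part_def)

lemma skew_part_carrier [simp]: "L \<in> carrier_mat n n \<Longrightarrow> skew_part L \<in> carrier_mat n n"
  using mat_adjoint_carrier[of L n] minus_carrier_mat[of "mat_adjoint L" n n L] by (simp add: skew_part_def)

lemma herm_part_index:
  assumes L: "L \<in> carrier_mat n n" and ij: "i < n" "j < n"
  shows "herm_part L $$ (i, j) = (L $$ (i, j) + cnj (L $$ (j, i))) / 2"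
  using mat_adjoint_index[OF L ij] carrier_matD[OF L] carrier_matD[OF mat_adjoint_carrier[OF L]] ij
  by (simp add: herm_part_def)

text \<open>A form of \<open>L_S^* = - L_S\<close> in which L and \<open>L_S^*\<close> add up to
  L_H, as \<open>iterates_of_opposite\<close> requires.\<close>

lemma adjoint_skew_part:
  assumes L: "L \<in> carrier_mat n n"
  shows "mat_adjoint (skew_part L) = herm_part L - L"
proof (rule eq_matI)
  note S = skew_part_carrier[OF L] and H = herm_part_carrier[OF L]
  show "dim_row (mat_adjoint (skew_part L)) = dim_row (herm_part L - L)"
    "dim_col (mat_adjoint (skew_part L)) = dim_col (herm_part L - L)"
    using carrier_matD[OF mat_adjoint_carrier[OF S]] carrier_matD[OF L] by simp_all
  fix i j assume "i < dim_row (herm_part L - L)" "j < dim_col (herm_part L - L)"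
  then have ij: "i < n" "j < n" using L by simp_all
  have skew: "skew_part L $$ (j, i) = (L $$ (j, i) - cnj (L $$ (i, j))) / 2"
    using mat_adjoint_index[OF L ij(2,1)] carrier_matD[OF L] carrier_matD[OF mat_adjoint_carrier[OF L]] ij
    by (simp add: skew_part_def)
  have "mat_adjoint (skew_part L) $$ (i, j) = (cnj (L $$ (j, i)) - L $$ (i, j)) / 2"
    unfolding mat_adjoint_index[OF S ij] skew by simp
  also have "\<dots> = (herm_part L - L) $$ (i, j)"
    using ij carrier_matD[OF L] by (simp add: herm_part_index[OF L ij] field_simps)
  finally show "mat_adjoint (skew_part L) $$ (i, j) = (herm_part L - L) $$ (i, j)" .
qed

lemma hc_sum_eq_sandwich_sum:
  assumes "L \<in> carrier_mat n n"
  shows "hc_sum L m = sandwich_sum (skew_part L) (herm_part L) m"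
  using carrier_matD[OF assms] carrier_matD[OF herm_part_carrier[OF assms]]
  by (simp add: hc_sum_def sandwich_sum_def)

lemma re_inner_herm_part:
  assumes L: "L \<in> carrier_mat n n" and x: "x \<in> carrier_vec n" and y: "y \<in> carrier_vec n"
  shows "re_inner (L *\<^sub>v x) y + re_inner x (L *\<^sub>v y) = 2 * re_inner (herm_part L *\<^sub>v x) y"
proof -
  note L' = mat_adjoint_carrier[OF L]
  have c: "L *\<^sub>v x \<in> carrier_vec n" "mat_adjoint L *\<^sub>v x \<in> carrier_vec n" "L *\<^sub>v y \<in> carrier_vec n"
    by (rule mult_mat_vec_carrier[OF L x], rule mult_mat_vec_carrier[OF L' x], rule mult_mat_vec_carrier[OF L y])
  have "herm_part L *\<^sub>v x = complex_of_real (1 / 2) \<cdot>\<^sub>v (L *\<^sub>v x + mat_adjoint L *\<^sub>v x)"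
  proof (rule eq_vecI)
    fix r assume "r < dim_vec (complex_of_real (1 / 2) \<cdot>\<^sub>v (L *\<^sub>v x + mat_adjoint L *\<^sub>v x))"
    then have r: "r < n" using L' by simp
    have "(herm_part L *\<^sub>v x) $ r = (\<Sum>k<n. 1 / 2 * (L $$ (r, k) * x $ k + mat_adjoint L $$ (r, k) * x $ k))"
      unfolding mult_vec_index[OF herm_part_carrier[OF L] x r]
      by (intro sum.cong refl) (use r in \<open>simp add: herm_part_index[OF L] mat_adjoint_index[OF L] field_simps\<close>)
    also have "\<dots> = 1 / 2 * ((L *\<^sub>v x) $ r + (mat_adjoint L *\<^sub>v x) $ r)"
      unfolding mult_vec_index[OF L x r] mult_vec_index[OF L' x r] by (simp only: sum_distrib_left[symmetric] sum.distrib)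
    finally show "(herm_part L *\<^sub>v x) $ r = (complex_of_real (1 / 2) \<cdot>\<^sub>v (L *\<^sub>v x + mat_adjoint L *\<^sub>v x)) $ r"
      using r carrier_matD[OF L] carrier_matD[OF L'] by (simp del: index_mult_mat_vec)
  qed (use carrier_matD[OF L] carrier_matD[OF L'] carrier_matD[OF herm_part_carrier[OF L]] in simp)
  then have "re_inner (herm_part L *\<^sub>v x) y = 1 / 2 * (re_inner (L *\<^sub>v x) y + re_inner (mat_adjoint L *\<^sub>v x) y)"
    using re_inner_smult_left[OF add_carrier_vec[OF c(1,2)] y] re_inner_add_left[OF c(1,2) y] by metis
  moreover have "re_inner (mat_adjoint L *\<^sub>v x) y = re_inner x (L *\<^sub>v y)"
    using re_inner_adjoint[OF L' x y] unfolding mat_adjoint_adjoint[OF L] .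
  ultimately show ?thesis by simp
qed

text \<open>If \<open>H\<close> annihilates the first \<open>q\<close> iterates, then \<open>A + B = H\<close> lets \<open>B\<close> be exchanged for \<open>- A\<close> along them.\<close>

lemma iterates_of_opposite:
  fixes A B H :: "complex mat"
  assumes A: "A \<in> carrier_mat n n" and B: "B \<in> carrier_mat n n" and x: "x \<in> carrier_vec n"
    and sum: "A + B = H" and ker: "\<And>j. j < q \<Longrightarrow> H *\<^sub>v (A ^\<^sub>m j *\<^sub>v x) = 0\<^sub>v n"
  shows "j \<le> q \<Longrightarrow> B ^\<^sub>m j *\<^sub>v x = (- 1) ^ j \<cdot>\<^sub>v (A ^\<^sub>m j *\<^sub>v x)"
proof (induction j)
  case 0
  then show ?case by (simp only: pow_mat_mult_vec_0[OF A x] pow_mat_mult_vec_0[OF B x] power_0 one_smult_vec)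
next
  case (Suc j)
  let ?y = "A ^\<^sub>m j *\<^sub>v x"
  have y: "?y \<in> carrier_vec n" by (rule pow_mat_mult_vec_carrier[OF A x])
  have c: "A *\<^sub>v ?y \<in> carrier_vec n" "B *\<^sub>v ?y \<in> carrier_vec n"
    by (rule mult_mat_vec_carrier[OF A y], rule mult_mat_vec_carrier[OF B y])
  have "A *\<^sub>v ?y + B *\<^sub>v ?y = 0\<^sub>v n"
    using ker[of j] Suc.prems unfolding sum[symmetric] add_mult_distrib_mat_vec[OF A B y] by simp
  have "B *\<^sub>v ?y = - 1 \<cdot>\<^sub>v (A *\<^sub>v ?y)"
  proof (rule eq_vecI)
    fix r assume "r < dim_vec (- 1 \<cdot>\<^sub>v (A *\<^sub>v ?y))"
    then have r: "r < n" using c by (metis carrier_vecD index_smult_vec(2))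
    have "(A *\<^sub>v ?y + B *\<^sub>v ?y) $ r = 0" using \<open>A *\<^sub>v ?y + B *\<^sub>v ?y = 0\<^sub>v n\<close> r by simp
    then have "(B *\<^sub>v ?y) $ r = - (A *\<^sub>v ?y) $ r"
      using r carrier_vecD[OF c(2)] by (subst (asm) index_add_vec) (simp_all add: add_eq_0_iff)
    then show "(B *\<^sub>v ?y) $ r = (- 1 \<cdot>\<^sub>v (A *\<^sub>v ?y)) $ r"
      using r carrier_vecD[OF c(1)] by (subst index_smult_vec) simp_all
  qed (use carrier_vecD[OF c(1)] carrier_vecD[OF c(2)] in \<open>metis index_smult_vec(2)\<close>)
  then have "B ^\<^sub>m Suc j *\<^sub>v x = (- 1) ^ j \<cdot>\<^sub>v (- 1 \<cdot>\<^sub>v (A *\<^sub>v ?y))"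
    unfolding pow_mat_mult_vec_Suc[OF B x] using Suc mult_mat_vec[OF B y, of "(- 1) ^ j"] by simp
  then show ?case unfolding pow_mat_mult_vec_Suc[OF A x] by (simp only: smult_smult_assoc power_Suc2)
qed

lemma kernel_of_iterates_swap:
  fixes A B H :: "complex mat"
  assumes A: "A \<in> carrier_mat n n" and B: "B \<in> carrier_mat n n" and H: "H \<in> carrier_mat n n" and x: "x \<in> carrier_vec n"
    and sum: "A + B = H" and ker: "\<forall>j\<le>m. H *\<^sub>v (A ^\<^sub>m j *\<^sub>v x) = 0\<^sub>v n"
  shows "\<forall>j\<le>m. H *\<^sub>v (B ^\<^sub>m j *\<^sub>v x) = 0\<^sub>v n"
proof (intro allI impI)
  fix j assume j: "j \<le> m"
  have "B ^\<^sub>m j *\<^sub>v x = (- 1) ^ j \<cdot>\<^sub>v (A ^\<^sub>m j *\<^sub>v x)"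
    by (rule iterates_of_opposite[OF A B x sum, of m]) (use ker j in auto)
  then have "H *\<^sub>v (B ^\<^sub>m j *\<^sub>v x) = (- 1) ^ j \<cdot>\<^sub>v (H *\<^sub>v (A ^\<^sub>m j *\<^sub>v x))"
    using mult_mat_vec[OF H pow_mat_mult_vec_carrier[OF A x]] by simp
  then show "H *\<^sub>v (B ^\<^sub>m j *\<^sub>v x) = 0\<^sub>v n" using ker j by (auto intro!: eq_vecI)
qed

section \<open>Energy and dissipation along the orbits of a matrix\<close>

locale semi_dissipative_mat =
  fixes n :: nat and L :: "complex mat"
  assumes L: "L \<in> carrier_mat n n" and semi_dissipative: "semi_dissipative L"
begin

abbreviation "H \<equiv> herm_part L"
abbreviation "T \<equiv> mat_adjoint (skew_part L)"

lemma H: "H \<in> carrier_mat n n" and T: "T \<in> carrier_mat n n"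
  using L by simp_all

sublocale neg_semidef_form n H
proof
  show "H \<in> carrier_mat n n" by (rule H)
  have "hermitian H" using semi_dissipative by (simp add: semi_dissipative_def neg_semidefinite_def)
  then show "re_inner (H *\<^sub>v x) y = re_inner x (H *\<^sub>v y)" if "x \<in> carrier_vec n" "y \<in> carrier_vec n" for x y
    using hermitian_iff_re_inner[OF H] that by blast
  show "re_inner (H *\<^sub>v x) x \<le> 0" if "x \<in> carrier_vec n" for x
    using semi_dissipative that H by (simp add: semi_dissipative_def neg_semidefinite_def re_inner_def)
qed

lemma L_plus_T: "L + T = H" and T_plus_L: "T + L = H"
  unfolding adjoint_skew_part[OF L] using carrier_matD[OF L] carrier_matD[OF H] by (auto intro!: eq_matI)

lemma krylov_carrier: "u \<in> carrier_vec n \<Longrightarrow> L ^\<^sub>m j *\<^sub>v u \<in> carrier_vec n"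
  by (rule pow_mat_mult_vec_carrier[OF L])

definition energy :: "complex vec \<Rightarrow> nat \<Rightarrow> nat \<Rightarrow> real" where
  "energy u j k = re_inner (L ^\<^sub>m j *\<^sub>v u) (L ^\<^sub>m k *\<^sub>v u)"

definition dissipation :: "complex vec \<Rightarrow> nat \<Rightarrow> nat \<Rightarrow> real" where
  "dissipation u j k = - re_inner (H *\<^sub>v (L ^\<^sub>m j *\<^sub>v u)) (L ^\<^sub>m k *\<^sub>v u)"

lemma energy_0_0: "u \<in> carrier_vec n \<Longrightarrow> energy u 0 0 = re_inner u u"
  by (simp only: energy_def pow_mat_mult_vec_0[OF L])

lemma energy_kernel:
  assumes u: "u \<in> carrier_vec n"
  shows "energy_kernel (energy u) (dissipation u)"
proof
  fix j k
  show "energy u j k = energy u k j"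
    unfolding energy_def by (rule re_inner_commute[OF krylov_carrier[OF u] krylov_carrier[OF u]])
  show "energy u (Suc j) k + energy u j (Suc k) = - 2 * dissipation u j k"
    using re_inner_herm_part[OF L krylov_carrier[OF u] krylov_carrier[OF u], of j k]
    by (simp only: energy_def dissipation_def pow_mat_mult_vec_Suc[OF L u])
qed

lemma dissipation_psd:
  assumes u: "u \<in> carrier_vec n"
  shows "psd_upto N (dissipation u)"
  unfolding psd_upto_def
proof
  fix c
  let ?y = "lincomb n N (\<lambda>j. complex_of_real (c j)) (\<lambda>j. L ^\<^sub>m j *\<^sub>v u)"
  have "re_inner (H *\<^sub>v ?y) ?y = (\<Sum>j\<le>N. \<Sum>k\<le>N. c j * c k * re_inner (H *\<^sub>v (L ^\<^sub>m j *\<^sub>v u)) (L ^\<^sub>m k *\<^sub>v u))"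
    unfolding mult_mat_lincomb[OF H krylov_carrier[OF u]]
    by (rule re_inner_lincomb) (simp_all only: Ax_carrier krylov_carrier[OF u])
  then show "0 \<le> (\<Sum>j\<le>N. \<Sum>k\<le>N. c j * c k * dissipation u j k)"
    using nonpos[of ?y] by (simp add: dissipation_def sum_negf)
qed

lemma dissipation_eq_0_if_kernel:
  assumes u: "u \<in> carrier_vec n" and "H *\<^sub>v (L ^\<^sub>m j *\<^sub>v u) = 0\<^sub>v n"
  shows "dissipation u j k = 0"
  unfolding dissipation_def assms(2) re_inner_sum[OF zero_carrier_vec krylov_carrier[OF u]] by simp

lemma dissipation_diag_pos:
  assumes u: "u \<in> carrier_vec n" and "H *\<^sub>v (L ^\<^sub>m j *\<^sub>v u) \<noteq> 0\<^sub>v n"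
  shows "0 < dissipation u j j"
  using nonpos[OF krylov_carrier[OF u, of j]] kernel_if_form_eq_0[OF krylov_carrier[OF u, of j]] assms(2)
  unfolding dissipation_def by fastforce

lemma energy_bounded:
  "\<exists>M\<ge>0. \<forall>u\<in>carrier_vec n. \<forall>j\<le>s. \<forall>k\<le>s. \<bar>energy u j k\<bar> \<le> M * energy u 0 0"
proof -
  have "\<exists>C>0. \<forall>u\<in>carrier_vec n. energy u j j \<le> C * energy u 0 0" for j
    using re_inner_mult_mat_le[OF pow_carrier_mat[OF L], of j]
    by (simp add: energy_0_0) (simp only: energy_def)
  then obtain C where C: "\<And>j. C j > 0" and le: "\<And>j u. u \<in> carrier_vec n \<Longrightarrow> energy u j j \<le> C j * energy u 0 0"
    by metis
  show ?thesis
  proof (intro exI[of _ "\<Sum>j\<le>s. C j"] conjI ballI allI impI)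
    show "0 \<le> (\<Sum>j\<le>s. C j)" using C by (intro sum_nonneg) (simp add: less_imp_le)
    fix u :: "complex vec" and j k assume u: "u \<in> carrier_vec n" and jk: "j \<le> s" "k \<le> s"
    have N: "0 \<le> energy u 0 0" using re_inner_self_nonneg[OF u] by (simp add: energy_0_0[OF u])
    have bound: "energy u i i \<le> (\<Sum>j\<le>s. C j) * energy u 0 0" if "i \<le> s" for i
    proof -
      have "C i \<le> (\<Sum>j\<le>s. C j)" using that C by (intro member_le_sum) (auto simp: less_imp_le)
      then show ?thesis using le[OF u, of i] N by (meson mult_right_mono order_trans)
    qed
    have "2 * \<bar>energy u j k\<bar> \<le> energy u j j + energy u k k"
      unfolding energy_def by (rule re_inner_le[OF krylov_carrier[OF u] krylov_carrier[OF u]])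
    then show "\<bar>energy u j k\<bar> \<le> (\<Sum>j\<le>s. C j) * energy u 0 0" using bound[of j] bound[of k] jk by linarith
  qed
qed

lemma hc_sum_form: "neg_semidef_form n (hc_sum L m)"
  unfolding hc_sum_eq_sandwich_sum[OF L] by (rule sandwich_sum_neg_semidef_form[OF skew_part_carrier[OF L]])

text \<open>The form of \<open>hc_sum\<close> vanishes exactly where H annihilates the first
  iterates of \<open>T\<close>; since L + T = H, these are annihilated together with the first
  iterates of L. The index thus becomes a property of the orbits of L.\<close>

lemma neg_definite_hc_sum_iff:
  "neg_definite (hc_sum L m) \<longleftrightarrow> (\<forall>v\<in>carrier_vec n. v \<noteq> 0\<^sub>v n \<longrightarrow> (\<exists>j\<le>m. H *\<^sub>v (L ^\<^sub>m j *\<^sub>v v) \<noteq> 0\<^sub>v n))"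
proof -
  interpret hc: neg_semidef_form n "hc_sum L m" by (rule hc_sum_form)
  have herm: "hermitian (hc_sum L m)" using hermitian_iff_re_inner[OF hc.A] hc.sym by blast
  have "re_inner (hc_sum L m *\<^sub>v v) v < 0 \<longleftrightarrow> (\<exists>j\<le>m. H *\<^sub>v (L ^\<^sub>m j *\<^sub>v v) \<noteq> 0\<^sub>v n)"
    if v: "v \<in> carrier_vec n" for v
  proof -
    have "re_inner (hc_sum L m *\<^sub>v v) v < 0 \<longleftrightarrow> re_inner (hc_sum L m *\<^sub>v v) v \<noteq> 0"
      using hc.nonpos[OF v] by linarith
    also have "\<dots> \<longleftrightarrow> \<not> (\<forall>j\<le>m. H *\<^sub>v (T ^\<^sub>m j *\<^sub>v v) = 0\<^sub>v n)"
      unfolding hc_sum_eq_sandwich_sum[OF L] sandwich_sum_kernel_iff[OF skew_part_carrier[OF L] v] ..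
    also have "\<dots> \<longleftrightarrow> \<not> (\<forall>j\<le>m. H *\<^sub>v (L ^\<^sub>m j *\<^sub>v v) = 0\<^sub>v n)"
      using kernel_of_iterates_swap[OF T L H v T_plus_L] kernel_of_iterates_swap[OF L T H v L_plus_T] by blast
    finally show ?thesis by blast
  qed
  then show ?thesis
    unfolding neg_definite_def re_inner_def[symmetric] using herm carrier_matD(1)[OF hc.A] by auto
qed

text \<open>The dissipation along L-orbits is the form of another matrix than \<open>hc_sum\<close>,
  but both vanish on the same vectors, and a semidefinite form with trivial kernel is
  coercive.\<close>

lemma dissipation_coercive:
  assumes "neg_definite (hc_sum L m)"
  shows "\<exists>c>0. \<forall>u\<in>carrier_vec n. c * energy u 0 0 \<le> (\<Sum>j\<le>m. dissipation u j j)"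
proof -
  let ?S = "sandwich_sum (mat_adjoint L) H m"
  note L' = mat_adjoint_carrier[OF L]
  interpret S: neg_semidef_form n ?S by (rule sandwich_sum_neg_semidef_form[OF L'])
  have form: "- re_inner (?S *\<^sub>v u) u = (\<Sum>j\<le>m. dissipation u j j)" if u: "u \<in> carrier_vec n" for u
    unfolding re_inner_sandwich_sum[OF L' u u] mat_adjoint_adjoint[OF L] dissipation_def by (simp add: sum_negf)
  have "?S *\<^sub>v u \<noteq> 0\<^sub>v n" if u: "u \<in> carrier_vec n" "u \<noteq> 0\<^sub>v n" for u
  proof
    assume "?S *\<^sub>v u = 0\<^sub>v n"
    then have "re_inner (?S *\<^sub>v u) u = 0" using re_inner_sum[OF zero_carrier_vec u(1)] by simp
    then have "\<forall>j\<le>m. H *\<^sub>v (L ^\<^sub>m j *\<^sub>v u) = 0\<^sub>v n"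
      unfolding sandwich_sum_kernel_iff[OF L' u(1)] mat_adjoint_adjoint[OF L] .
    then show False using assms u unfolding neg_definite_hc_sum_iff by blast
  qed
  then obtain c where "c > 0" "\<And>u. u \<in> carrier_vec n \<Longrightarrow> c * re_inner u u \<le> - re_inner (?S *\<^sub>v u) u"
    using S.coercive_if_definite by blast
  then show ?thesis using form by (intro exI[of _ c]) (simp add: energy_0_0)
qed

end

section \<open>Krylov spaces and asymptotic stability\<close>

lemma re_inner_smult_self:
  assumes w: "w \<in> carrier_vec n"
  shows "re_inner (z \<cdot>\<^sub>v w) w = Re z * re_inner w w"
proof -
  have "Re (z * x * cnj x) = Re z * (cmod x)\<^sup>2" for x
    by (simp only: cmod_power2) (simp add: power2_eq_square algebra_simps)
  then show ?thesis
    unfolding re_inner_self[OF w] re_inner_sum[OF smult_carrier_vec[THEN iffD2, OF w] w] sum_distrib_left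
    using carrier_vecD[OF w] by (intro sum.cong refl) (simp del: times_complex.sel)
qed

lemma annihilating_poly_exists:
  fixes L :: "complex mat"
  assumes L: "L \<in> carrier_mat n n" and v: "v \<in> carrier_vec n"
  shows "\<exists>f. f \<noteq> 0 \<and> poly_mat f L *\<^sub>v v = 0\<^sub>v n"
proof -
  \<comment> \<open>The rows are n + 1 iterates in dimension n, padded by a zero column to a square
    matrix. Its determinant is therefore 0, and a kernel vector of the transpose is a linear
    dependence of the rows.\<close>
  define B where "B = mat (Suc n) (Suc n) (\<lambda>(j, i). if i < n then (L ^\<^sub>m j *\<^sub>v v) $ i else 0)"
  have B: "B \<in> carrier_mat (Suc n) (Suc n)" by (simp add: B_def)
  have BT: "transpose_mat B \<in> carrier_mat (Suc n) (Suc n)" using B by simp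
  have "B *\<^sub>v unit_vec (Suc n) n = 0\<^sub>v (Suc n)"
  proof (rule eq_vecI)
    fix j assume "j < dim_vec (0\<^sub>v (Suc n) :: complex vec)"
    then have j: "j < Suc n" by simp
    have "(B *\<^sub>v unit_vec (Suc n) n) $ j = 0"
      unfolding mult_vec_index[OF B unit_vec_carrier j] by (rule sum.neutral) (use j in \<open>auto simp: B_def\<close>)
    then show "(B *\<^sub>v unit_vec (Suc n) n) $ j = 0\<^sub>v (Suc n) $ j" using j by simp
  qed (use B in simp)
  then have "det B = 0"
    using det_0_iff_vec_prod_zero_field[OF B] unit_vec_nonzero[of n "Suc n"] unit_vec_carrier by (metis lessI)
  then have "det (transpose_mat B) = 0" using det_transpose[OF B] by simp
  then obtain c where c: "c \<in> carrier_vec (Suc n)" "c \<noteq> 0\<^sub>v (Suc n)" and Bc: "transpose_mat B *\<^sub>v c = 0\<^sub>v (Suc n)"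
    using det_0_iff_vec_prod_zero_field[OF BT] by blast
  define f where "f = (\<Sum>j\<le>n. monom (c $ j) j)"
  have coeff: "coeff f j = (if j \<le> n then c $ j else 0)" for j
    unfolding f_def coeff_sum coeff_monom by simp
  have "poly_mat f L *\<^sub>v v = 0\<^sub>v n"
  proof (rule eq_vecI)
    show "dim_vec (poly_mat f L *\<^sub>v v) = dim_vec (0\<^sub>v n :: complex vec)"
      using poly_mat_vec_carrier(2)[OF L] by simp
    fix r assume "r < dim_vec (0\<^sub>v n :: complex vec)"
    then have r: "r < n" by simp
    have "(poly_mat f L *\<^sub>v v) $ r = (\<Sum>j\<le>n. coeff f j * (L ^\<^sub>m j *\<^sub>v v) $ r)"
      by (rule poly_mat_vec_index[OF L v r]) (simp add: degree_le coeff)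
    also have "\<dots> = (\<Sum>j<Suc n. transpose_mat B $$ (r, j) * c $ j)"
      by (intro sum.cong) (use r in \<open>auto simp: coeff B_def simp del: index_mult_mat_vec\<close>)
    also have "\<dots> = (transpose_mat B *\<^sub>v c) $ r" using mult_vec_index[OF BT c(1), of r] r by simp
    finally show "(poly_mat f L *\<^sub>v v) $ r = 0\<^sub>v n $ r" using Bc r by simp
  qed
  moreover have "f \<noteq> 0"
  proof
    assume "f = 0"
    then have "c $ j = 0" if "j < Suc n" for j using coeff[of j] that by simp
    then have "c = 0\<^sub>v (Suc n)" using c(1) by (intro eq_vecI) auto
    then show False using c(2) by simp
  qed
  ultimately show ?thesis by blast
qed

text \<open>Take an annihilating polynomial f of least degree and a root z of it, and let g = f / (X
  - z). Then g(L) v is nonzero by minimality, and L - z annihilates it. An eigenvector inside the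
  Krylov space is wanted because only there does L_H inherit its vanishing on the orbit.\<close>

lemma eigenvector_in_krylov_space:
  fixes L :: "complex mat"
  assumes L: "L \<in> carrier_mat n n" and v: "v \<in> carrier_vec n" "v \<noteq> 0\<^sub>v n"
  shows "\<exists>g z. eigenvector L (poly_mat g L *\<^sub>v v) z"
proof -
  let ?P = "\<lambda>f. f \<noteq> 0 \<and> poly_mat f L *\<^sub>v v = 0\<^sub>v n"
  obtain f where f: "f \<noteq> 0" "poly_mat f L *\<^sub>v v = 0\<^sub>v n" and minimal: "\<And>g. ?P g \<Longrightarrow> degree f \<le> degree g"
    using annihilating_poly_exists[OF L v(1)] ex_has_least_nat[of ?P _ degree] by blast
  have "degree f \<noteq> 0"
  proof
    assume deg: "degree f = 0"
    have "v $ r = 0" if r: "r < n" for r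
    proof -
      have "(poly_mat f L *\<^sub>v v) $ r = (\<Sum>j\<le>0. coeff f j * (L ^\<^sub>m j *\<^sub>v v) $ r)"
        by (rule poly_mat_vec_index[OF L v(1) r]) (simp add: deg)
      also have "\<dots> = coeff f 0 * v $ r" by (simp only: atMost_0 sum.insert_if finite.emptyI empty_iff if_False sum.empty add_0_right
            pow_mat_mult_vec_0[OF L v(1)])
      finally have "coeff f 0 * v $ r = 0" unfolding f(2) using r by simp
      moreover have "coeff f 0 \<noteq> 0" using f(1) deg by (metis leading_coeff_0_iff)
      ultimately show ?thesis by simp
    qed
    then have "v = 0\<^sub>v n" using v(1) by (intro eq_vecI) auto
    then show False using v(2) by simp
  qed
  then obtain z where "poly f z = 0" using fundamental_theorem_of_algebra constant_degree by metis
  then obtain g where g: "f = [:- z, 1:] * g" by (metis poly_eq_0_iff_dvd dvdE)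
  then have "g \<noteq> 0" using f(1) by auto
  then have "degree f = Suc (degree g)" unfolding g by (subst degree_mult_eq) auto
  let ?w = "poly_mat g L *\<^sub>v v"
  have w: "?w \<in> carrier_vec n" by (rule poly_mat_vec_carrier(1)[OF L])
  have "?w \<noteq> 0\<^sub>v n" using minimal[of g] \<open>g \<noteq> 0\<close> \<open>degree f = Suc (degree g)\<close> by auto
  moreover have "L *\<^sub>v ?w = z \<cdot>\<^sub>v ?w"
  proof (rule eq_vecI)
    show "dim_vec (L *\<^sub>v ?w) = dim_vec (z \<cdot>\<^sub>v ?w)"
      using carrier_matD(1)[OF L] carrier_vecD[OF w] by (metis dim_mult_mat_vec index_smult_vec(2))
    fix r assume "r < dim_vec (z \<cdot>\<^sub>v ?w)"
    then have r: "r < n" using carrier_vecD[OF w] by (metis index_smult_vec(2))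
    have "f = smult (- z) g + pCons 0 g" unfolding g by simp
    then have "(poly_mat f L *\<^sub>v v) $ r = - z * ?w $ r + (L *\<^sub>v ?w) $ r"
      by (simp only: poly_mat_vec_add[OF L v(1) r] poly_mat_vec_smult[OF L v(1) r] poly_mat_vec_shift[OF L v(1) r])
    then have "(L *\<^sub>v ?w) $ r = z * ?w $ r" unfolding f(2) using r by (simp only: index_zero_vec) (simp del: index_mult_mat_vec)
    then show "(L *\<^sub>v ?w) $ r = (z \<cdot>\<^sub>v ?w) $ r"
      using r carrier_vecD[OF w] by (simp only: index_smult_vec)
  qed
  ultimately show ?thesis using w L unfolding eigenvector_def by auto
qed

lemma lincomb_0:
  assumes "\<And>j. X j = 0\<^sub>v n"
  shows "lincomb n N \<alpha> X = 0\<^sub>v n"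
  by (rule eq_vecI) (simp_all add: lincomb_def assms)

context semi_dissipative_mat
begin

lemma eigenvalue_Re:
  assumes "w \<in> carrier_vec n" "L *\<^sub>v w = z \<cdot>\<^sub>v w"
  shows "Re z * re_inner w w = re_inner (H *\<^sub>v w) w"
  using re_inner_herm_part[OF L assms(1) assms(1)] re_inner_smult_self[OF assms(1), of z] assms(2)
    re_inner_commute[OF assms(1), of "z \<cdot>\<^sub>v w"] assms(1) by simp

text \<open>If H annihilated the whole orbit, it would annihilate an eigenvector in its span, and
  the corresponding eigenvalue would be purely imaginary.\<close>

lemma krylov_escapes_kernel:
  assumes stable: "asymptotically_stable L" and v: "v \<in> carrier_vec n" "v \<noteq> 0\<^sub>v n"
  shows "\<exists>j. H *\<^sub>v (L ^\<^sub>m j *\<^sub>v v) \<noteq> 0\<^sub>v n"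
proof (rule ccontr)
  assume "\<not> ?thesis"
  then have ker: "H *\<^sub>v (L ^\<^sub>m j *\<^sub>v v) = 0\<^sub>v n" for j by blast
  obtain g z where ev: "eigenvector L (poly_mat g L *\<^sub>v v) z"
    using eigenvector_in_krylov_space[OF L v] by blast
  define w where "w = poly_mat g L *\<^sub>v v"
  have w: "w \<in> carrier_vec n" "w \<noteq> 0\<^sub>v n" and Lw: "L *\<^sub>v w = z \<cdot>\<^sub>v w"
    using ev L unfolding eigenvector_def w_def by auto
  have "w = lincomb n (degree g) (coeff g) (\<lambda>j. L ^\<^sub>m j *\<^sub>v v)"
  proof (rule eq_vecI)
    fix r assume "r < dim_vec (lincomb n (degree g) (coeff g) (\<lambda>j. L ^\<^sub>m j *\<^sub>v v))"
    then have r: "r < n" by (simp add: lincomb_def)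
    show "w $ r = lincomb n (degree g) (coeff g) (\<lambda>j. L ^\<^sub>m j *\<^sub>v v) $ r"
      unfolding w_def lincomb_index[OF r] by (rule poly_mat_vec_index[OF L v(1) r order_refl])
  qed (use w in \<open>simp add: lincomb_def\<close>)
  then have "H *\<^sub>v w = 0\<^sub>v n"
    using mult_mat_lincomb[OF H krylov_carrier[OF v(1)]] lincomb_0[OF ker] by simp
  then have "Re z * re_inner w w = 0"
    using eigenvalue_Re[OF w(1) Lw] re_inner_sum[OF zero_carrier_vec w(1)] by simp
  then have "Re z = 0" using re_inner_self_pos[OF w] by simp
  moreover have "Re z < 0" using stable ev unfolding asymptotically_stable_def eigenvalue_def by blast
  ultimately show False by simp
qed

text \<open>Asymptotic stability excludes the eigenvalue 0, so L is injective.\<close>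

lemma krylov_nonzero:
  assumes stable: "asymptotically_stable L" and v: "v \<in> carrier_vec n" "v \<noteq> 0\<^sub>v n"
  shows "L ^\<^sub>m j *\<^sub>v v \<noteq> 0\<^sub>v n"
proof (induction j)
  case 0
  show ?case unfolding pow_mat_mult_vec_0[OF L v(1)] by (rule v(2))
next
  case (Suc j)
  show ?case
  proof
    assume "L ^\<^sub>m Suc j *\<^sub>v v = 0\<^sub>v n"
    then have "L *\<^sub>v (L ^\<^sub>m j *\<^sub>v v) = 0 \<cdot>\<^sub>v (L ^\<^sub>m j *\<^sub>v v)"
      unfolding pow_mat_mult_vec_Suc[OF L v(1)] using krylov_carrier[OF v(1), of j] L by (auto intro!: eq_vecI)
    then have "eigenvalue L 0"
      unfolding eigenvalue_def eigenvector_def using Suc krylov_carrier[OF v(1), of j] L by auto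
    then show False using stable unfolding asymptotically_stable_def by force
  qed
qed

lemma dissipation_free_kernel:
  assumes u: "u \<in> carrier_vec n" and ker: "\<And>j. j < q \<Longrightarrow> H *\<^sub>v (L ^\<^sub>m j *\<^sub>v u) = 0\<^sub>v n"
  shows "dissipation_free_kernel (energy u) (dissipation u) q"
  unfolding dissipation_free_kernel_def dissipation_free_kernel_axioms_def
  using energy_kernel[OF u] dissipation_eq_0_if_kernel[OF u ker] by blast

text \<open>The orbit of v leaves the kernel of H at a first index i \<ge> q; restarting the orbit i
  - q steps later places this exit exactly at q.\<close>

lemma dissipation_starts_at:
  assumes stable: "asymptotically_stable L" and v: "v \<in> carrier_vec n" "v \<noteq> 0\<^sub>v n"
    and ker: "\<And>j. j < q \<Longrightarrow> H *\<^sub>v (L ^\<^sub>m j *\<^sub>v v) = 0\<^sub>v n"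
  shows "\<exists>u\<in>carrier_vec n. dissipation_free_kernel (energy u) (dissipation u) q \<and> 0 < dissipation u q q"
proof -
  define i where "i = (LEAST j. H *\<^sub>v (L ^\<^sub>m j *\<^sub>v v) \<noteq> 0\<^sub>v n)"
  have i: "H *\<^sub>v (L ^\<^sub>m i *\<^sub>v v) \<noteq> 0\<^sub>v n"
    unfolding i_def by (rule LeastI_ex[OF krylov_escapes_kernel[OF stable v]])
  have least: "H *\<^sub>v (L ^\<^sub>m j *\<^sub>v v) = 0\<^sub>v n" if "j < i" for j
    using not_less_Least[of j] that unfolding i_def by blast
  have "q \<le> i" using i ker by (meson not_le)
  define u where "u = L ^\<^sub>m (i - q) *\<^sub>v v"
  have u: "u \<in> carrier_vec n" unfolding u_def by (rule krylov_carrier[OF v(1)])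
  have Lu: "L ^\<^sub>m j *\<^sub>v u = L ^\<^sub>m (j + (i - q)) *\<^sub>v v" for j
    unfolding u_def pow_mat_mult_vec_add[OF L v(1)] ..
  have "H *\<^sub>v (L ^\<^sub>m j *\<^sub>v u) = 0\<^sub>v n" if "j < q" for j
    unfolding Lu by (rule least) (use that \<open>q \<le> i\<close> in linarith)
  then have "dissipation_free_kernel (energy u) (dissipation u) q" by (rule dissipation_free_kernel[OF u])
  moreover have "0 < dissipation u q q"
    by (rule dissipation_diag_pos[OF u]) (use i \<open>q \<le> i\<close> in \<open>simp add: Lu del: pow_mat.simps\<close>)
  ultimately show ?thesis using u by blast
qed

end

section \<open>Runge-Kutta steps along a Krylov orbit\<close>

lemma smult_mat_pow_mult_vec:
  fixes A :: "complex mat"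
  assumes A: "A \<in> carrier_mat n n" and x: "x \<in> carrier_vec n"
  shows "(c \<cdot>\<^sub>m A) ^\<^sub>m j *\<^sub>v x = c ^ j \<cdot>\<^sub>v (A ^\<^sub>m j *\<^sub>v x)"
proof (induction j)
  case 0
  have "c \<cdot>\<^sub>m A \<in> carrier_mat n n" using A by simp
  then show ?case by (simp only: pow_mat_mult_vec_0[OF _ x] A power_0 one_smult_vec)
next
  case (Suc j)
  have cA: "c \<cdot>\<^sub>m A \<in> carrier_mat n n" using A by simp
  let ?y = "A ^\<^sub>m j *\<^sub>v x"
  have y: "?y \<in> carrier_vec n" by (rule pow_mat_mult_vec_carrier[OF A x])
  have Ay: "A *\<^sub>v ?y \<in> carrier_vec n" by (rule mult_mat_vec_carrier[OF A y])
  have "(c \<cdot>\<^sub>m A) *\<^sub>v ?y = c \<cdot>\<^sub>v (A *\<^sub>v ?y)"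
  proof (rule eq_vecI)
    fix r assume "r < dim_vec (c \<cdot>\<^sub>v (A *\<^sub>v ?y))"
    then have r: "r < n" using carrier_vecD[OF Ay] by (metis index_smult_vec(2))
    have "((c \<cdot>\<^sub>m A) *\<^sub>v ?y) $ r = c * (A *\<^sub>v ?y) $ r"
      unfolding mult_vec_index[OF cA y r] mult_vec_index[OF A y r] sum_distrib_left
      using A r by (intro sum.cong refl) (simp del: index_mult_mat_vec)
    then show "((c \<cdot>\<^sub>m A) *\<^sub>v ?y) $ r = (c \<cdot>\<^sub>v (A *\<^sub>v ?y)) $ r"
      using r carrier_vecD[OF Ay] by (simp only: index_smult_vec)
  qed simp
  then show ?case
    unfolding pow_mat_mult_vec_Suc[OF cA x] pow_mat_mult_vec_Suc[OF A x] Suc.IH mult_mat_vec[OF cA y]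
    by (simp only: smult_smult_assoc power_Suc2)
qed

locale rk_scheme =
  fixes s :: nat and a :: "nat \<Rightarrow> nat \<Rightarrow> real" and b :: "nat \<Rightarrow> real" and R :: "complex poly"
    and p :: nat and r :: "nat \<Rightarrow> real"
  assumes R: "stability_function s a b R" and coeff_R: "\<And>j. coeff R j = complex_of_real (r j)"
    and p: "1 \<le> p" "p \<le> s" and r: "\<And>j. j \<le> p \<Longrightarrow> r j = 1 / fact j" and r_eq_0: "\<And>j. s < j \<Longrightarrow> r j = 0"

locale rk_scheme_mat = rk_scheme + semi_dissipative_mat +
  assumes n: "1 \<le> n"
begin

lemma rk_step_eq_lincomb:
  assumes u: "u \<in> carrier_vec n" and "0 < \<tau>" and N: "s \<le> N"
  shows "rk_step s a b L \<tau> u = lincomb n N (\<lambda>j. complex_of_real (\<tau> ^ j * r j)) (\<lambda>j. L ^\<^sub>m j *\<^sub>v u)"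
proof -
  let ?A = "complex_of_real \<tau> \<cdot>\<^sub>m L"
  have A: "?A \<in> carrier_mat n n" using L by simp
  have "rk_step s a b L \<tau> u = poly_mat R ?A *\<^sub>v u"
    using R n L u \<open>0 < \<tau>\<close> unfolding stability_function_def by blast
  also have "\<dots> = lincomb n N (\<lambda>j. complex_of_real (\<tau> ^ j * r j)) (\<lambda>j. L ^\<^sub>m j *\<^sub>v u)"
  proof (rule eq_vecI)
    show "dim_vec (poly_mat R ?A *\<^sub>v u) = dim_vec (lincomb n N (\<lambda>j. complex_of_real (\<tau> ^ j * r j)) (\<lambda>j. L ^\<^sub>m j *\<^sub>v u))"
      unfolding poly_mat_vec_carrier(2)[OF A] by (simp add: lincomb_def)
    fix i assume "i < dim_vec (lincomb n N (\<lambda>j. complex_of_real (\<tau> ^ j * r j)) (\<lambda>j. L ^\<^sub>m j *\<^sub>v u))"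
    then have i: "i < n" by (simp add: lincomb_def)
    have "degree R \<le> N" using N by (intro degree_le) (simp add: coeff_R r_eq_0)
    then show "(poly_mat R ?A *\<^sub>v u) $ i = lincomb n N (\<lambda>j. complex_of_real (\<tau> ^ j * r j)) (\<lambda>j. L ^\<^sub>m j *\<^sub>v u) $ i"
      unfolding poly_mat_vec_index[OF A u i \<open>degree R \<le> N\<close>] lincomb_index[OF i]
      using i carrier_vecD[OF krylov_carrier[OF u]]
      by (intro sum.cong refl) (simp add: smult_mat_pow_mult_vec[OF L u] coeff_R del: index_mult_mat_vec dim_mult_mat_vec)
  qed
  finally show ?thesis .
qed

lemma re_inner_krylov_lincomb:
  assumes u: "u \<in> carrier_vec n"
  shows "re_inner (lincomb n N (\<lambda>j. complex_of_real (\<tau> ^ j * w j)) (\<lambda>j. L ^\<^sub>m j *\<^sub>v u))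
      (lincomb n N (\<lambda>j. complex_of_real (\<tau> ^ j * w j)) (\<lambda>j. L ^\<^sub>m j *\<^sub>v u))
    = (\<Sum>j\<le>N. \<Sum>k\<le>N. \<tau> ^ (j + k) * (w j * w k * energy u j k))"
  unfolding re_inner_lincomb[OF krylov_carrier[OF u] krylov_carrier[OF u]] energy_def
  by (simp add: power_add mult_ac)

lemma strongly_stable_if_neg_definite:
  assumes nd: "neg_definite (hc_sum L m)" and m: "2 * m + 1 \<le> p"
  shows "\<exists>\<tau>0>0. \<forall>\<tau>. 0 < \<tau> \<and> \<tau> \<le> \<tau>0 \<longrightarrow> (\<forall>u\<in>carrier_vec (dim_row L). vec_norm2 (rk_step s a b L \<tau> u) \<le> vec_norm2 u)"
proof -
  obtain c where c: "c > 0" "\<And>u. u \<in> carrier_vec n \<Longrightarrow> c * energy u 0 0 \<le> (\<Sum>j\<le>m. dissipation u j j)"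
    using dissipation_coercive[OF nd] by blast
  obtain M where M: "M \<ge> 0" "\<And>u. u \<in> carrier_vec n \<Longrightarrow> \<forall>j\<le>s. \<forall>k\<le>s. \<bar>energy u j k\<bar> \<le> M * energy u 0 0"
    using energy_bounded[of s] by blast
  have "p = Suc (p - 1)" "2 * m \<le> p - 1" using p m by auto
  from energy_decay[OF this(1) p(2) this(2) r M(1) c(1)]
  obtain \<tau>0 where \<tau>0: "\<tau>0 > 0" and decay: "\<And>G K \<tau>. energy_kernel G K \<Longrightarrow> psd_upto (p - 1) K \<Longrightarrow>
      \<forall>j\<le>s. \<forall>k\<le>s. \<bar>G j k\<bar> \<le> M * G 0 0 \<Longrightarrow> c * G 0 0 \<le> (\<Sum>i\<le>m. K i i) \<Longrightarrow>
      0 < \<tau> \<Longrightarrow> \<tau> \<le> \<tau>0 \<Longrightarrow> (\<Sum>j\<le>s. \<Sum>k\<le>s. \<tau> ^ (j + k) * (r j * r k * G j k)) \<le> G 0 0" by blast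
  have "vec_norm2 (rk_step s a b L \<tau> u) \<le> vec_norm2 u" if u: "u \<in> carrier_vec n" and \<tau>: "0 < \<tau>" "\<tau> \<le> \<tau>0" for \<tau> u
    using decay[OF energy_kernel[OF u] dissipation_psd[OF u] M(2)[OF u] c(2)[OF u] \<tau>]
    unfolding rk_step_eq_lincomb[OF u \<tau>(1) order_refl] vec_norm2_eq re_inner_krylov_lincomb[OF u] energy_0_0[OF u]
    by (rule real_sqrt_le_mono)
  then show ?thesis using \<tau>0 L by auto
qed

lemma rk_step_krylov_lincomb:
  assumes u: "u \<in> carrier_vec n" and \<tau>: "0 < \<tau>" and d: "\<And>k. q < k \<Longrightarrow> d k = 0" and N: "s + q \<le> N"
  shows "rk_step s a b L \<tau> (lincomb n N (\<lambda>k. complex_of_real (\<tau> ^ k * d k)) (\<lambda>k. L ^\<^sub>m k *\<^sub>v u)) =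
    lincomb n N (\<lambda>i. complex_of_real (\<tau> ^ i * (\<Sum>k\<le>i. d k * r (i - k)))) (\<lambda>i. L ^\<^sub>m i *\<^sub>v u)"
    (is "rk_step s a b L \<tau> ?v = ?w")
proof -
  have "rk_step s a b L \<tau> ?v = lincomb n N (\<lambda>j. complex_of_real (\<tau> ^ j * r j)) (\<lambda>j. L ^\<^sub>m j *\<^sub>v ?v)"
    by (rule rk_step_eq_lincomb[OF lincomb_carrier \<tau>]) (use N in simp)
  also have "\<dots> = ?w"
  proof (rule eq_vecI)
    fix i assume "i < dim_vec ?w"
    then have i: "i < n" by (simp add: lincomb_def)
    define X where "X j = (L ^\<^sub>m j *\<^sub>v u) $ i" for j
    define f where "f k j = complex_of_real (\<tau> ^ (k + j) * (d k * r j)) * X (k + j)" for k j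
    have Lv: "(L ^\<^sub>m j *\<^sub>v ?v) $ i = (\<Sum>k\<le>N. complex_of_real (\<tau> ^ k * d k) * X (k + j))" for j
      unfolding mult_mat_lincomb[OF pow_carrier_mat[OF L] krylov_carrier[OF u]] lincomb_index[OF i] X_def
        pow_mat_mult_vec_add[OF L u, symmetric] by (simp only: add.commute)
    have "lincomb n N (\<lambda>j. complex_of_real (\<tau> ^ j * r j)) (\<lambda>j. L ^\<^sub>m j *\<^sub>v ?v) $ i
        = (\<Sum>j\<le>N. \<Sum>k\<le>N. f k j)"
      unfolding lincomb_index[OF i] Lv sum_distrib_left
      by (intro sum.cong refl) (simp add: f_def power_add)
    also have "\<dots> = (\<Sum>k\<le>N. \<Sum>j\<le>N. f k j)" by (rule sum.swap)
    also have "\<dots> = (\<Sum>l\<le>N. \<Sum>k\<le>l. f k (l - k)) + (\<Sum>k\<le>N. \<Sum>j\<le>N. if N < k + j then f k j else 0)"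
      by (rule double_sum_triangle_split) simp
    \<comment> \<open>The product of R and the polynomial with coefficients \<open>d\<close> has
      degree at most s + q \<le> N, so truncating at N loses nothing.\<close>
    also have "(\<Sum>k\<le>N. \<Sum>j\<le>N. if N < k + j then f k j else 0) = 0"
    proof (intro sum.neutral ballI)
      fix k j
      have "q < k \<or> s < j" if "N < k + j" using that N by linarith
      then show "(if N < k + j then f k j else 0) = 0" using d[of k] r_eq_0[of j] by (auto simp: f_def)
    qed
    also have "(\<Sum>l\<le>N. \<Sum>k\<le>l. f k (l - k)) + 0 = ?w $ i"
      unfolding lincomb_index[OF i] add_0_right of_real_mult of_real_sum sum_distrib_left sum_distrib_right
      by (intro sum.cong refl) (simp add: f_def X_def del: index_mult_mat_vec)
    finally show "lincomb n N (\<lambda>j. complex_of_real (\<tau> ^ j * r j)) (\<lambda>j. L ^\<^sub>m j *\<^sub>v ?v) $ i = ?w $ i" .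
  qed (simp add: lincomb_def)
  finally show ?thesis .
qed

lemma not_strongly_stable_if_growth:
  assumes "\<And>\<tau>0. 0 < \<tau>0 \<Longrightarrow> \<exists>\<tau> v. 0 < \<tau> \<and> \<tau> \<le> \<tau>0 \<and> v \<in> carrier_vec n \<and>
    re_inner v v < re_inner (rk_step s a b L \<tau> v) (rk_step s a b L \<tau> v)"
  shows "\<not> strongly_stable s a b {L}"
proof
  assume "strongly_stable s a b {L}"
  then obtain \<tau>0 where "\<tau>0 > 0" and le: "\<And>\<tau> u. 0 < \<tau> \<Longrightarrow> \<tau> \<le> \<tau>0 \<Longrightarrow> u \<in> carrier_vec n \<Longrightarrow>
      vec_norm2 (rk_step s a b L \<tau> u) \<le> vec_norm2 u"
    using carrier_matD(1)[OF L] unfolding strongly_stable_def by auto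
  from assms[OF \<open>\<tau>0 > 0\<close>] le show False
    unfolding vec_norm2_eq real_sqrt_le_iff by (meson not_le)
qed

lemma not_neg_definite_hc_sumE:
  assumes "\<not> neg_definite (hc_sum L m)"
  obtains v where "v \<in> carrier_vec n" "v \<noteq> 0\<^sub>v n" "\<And>j. j \<le> m \<Longrightarrow> H *\<^sub>v (L ^\<^sub>m j *\<^sub>v v) = 0\<^sub>v n"
  using assms unfolding neg_definite_hc_sum_iff by blast

lemma not_strongly_stable_odd_order:
  assumes stable: "asymptotically_stable L" and nd: "\<not> neg_definite (hc_sum L (q - 1))"
    and q: "1 \<le> q" "p = 2 * q - 1" and C: "0 < (- 1) ^ q * (fact (2 * q) * r (2 * q) - 1)"
  shows "\<not> strongly_stable s a b {L}"
proof (rule not_strongly_stable_if_growth)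
  fix \<tau>0 :: real assume \<tau>0: "0 < \<tau>0"
  obtain v where v: "v \<in> carrier_vec n" "v \<noteq> 0\<^sub>v n" and ker: "\<And>j. j < q \<Longrightarrow> H *\<^sub>v (L ^\<^sub>m j *\<^sub>v v) = 0\<^sub>v n"
  proof (rule not_neg_definite_hc_sumE[OF nd])
    fix v assume "v \<in> carrier_vec n" "v \<noteq> 0\<^sub>v n" "\<And>j. j \<le> q - 1 \<Longrightarrow> H *\<^sub>v (L ^\<^sub>m j *\<^sub>v v) = 0\<^sub>v n"
    then show thesis using q(1) by (intro that[of v]) auto
  qed
  interpret K: dissipation_free_kernel "energy v" "dissipation v" q
    by (rule dissipation_free_kernel[OF v(1) ker])
  have pos: "0 < energy v q q"
    unfolding energy_def by (rule re_inner_self_pos[OF krylov_carrier[OF v(1)] krylov_nonzero[OF stable v]])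
  have "r j = 1 / fact j" if "j < 2 * q" for j using that q by (intro r) simp
  \<comment> \<open>If s = p, the decisive index 2q lies beyond the degree of R; padding the sum
    keeps it in range, with r (2q) = 0.\<close>
  from K.energy_growth_odd_order[OF q(1), of "s + 2 * q" r, OF _ pos this C \<tau>0]
  obtain \<tau> where \<tau>: "0 < \<tau>" "\<tau> \<le> \<tau>0"
    and grow: "energy v 0 0 < (\<Sum>j\<le>s + 2 * q. \<Sum>k\<le>s + 2 * q. \<tau> ^ (j + k) * (r j * r k * energy v j k))" by auto
  have "re_inner v v < re_inner (rk_step s a b L \<tau> v) (rk_step s a b L \<tau> v)"
    using grow unfolding rk_step_eq_lincomb[OF v(1) \<tau>(1) le_add1[of s "2 * q"]] re_inner_krylov_lincomb[OF v(1)] energy_0_0[OF v(1)] .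
  then show "\<exists>\<tau> v. 0 < \<tau> \<and> \<tau> \<le> \<tau>0 \<and> v \<in> carrier_vec n \<and> re_inner v v < re_inner (rk_step s a b L \<tau> v) (rk_step s a b L \<tau> v)"
    using \<tau> v(1) by blast
qed

lemma not_strongly_stable_even_order:
  assumes stable: "asymptotically_stable L" and nd: "\<not> neg_definite (hc_sum L (q - 1))"
    and q: "1 \<le> q" "p = 2 * q"
    and C: "1 + (- 1) ^ q * (fact (2 * q + 1) * r (2 * q + 1) - 1) * real ((2 * q) choose q) < 0"
  shows "\<not> strongly_stable s a b {L}"
proof (rule not_strongly_stable_if_growth)
  fix \<tau>0 :: real assume \<tau>0: "0 < \<tau>0"
  obtain v where v: "v \<in> carrier_vec n" "v \<noteq> 0\<^sub>v n" and ker: "\<And>j. j < q \<Longrightarrow> H *\<^sub>v (L ^\<^sub>m j *\<^sub>v v) = 0\<^sub>v n"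
  proof (rule not_neg_definite_hc_sumE[OF nd])
    fix v assume "v \<in> carrier_vec n" "v \<noteq> 0\<^sub>v n" "\<And>j. j \<le> q - 1 \<Longrightarrow> H *\<^sub>v (L ^\<^sub>m j *\<^sub>v v) = 0\<^sub>v n"
    then show thesis using q(1) by (intro that[of v]) auto
  qed
  obtain u where u: "u \<in> carrier_vec n" and kernel: "dissipation_free_kernel (energy u) (dissipation u) q"
    and pos: "0 < dissipation u q q"
    using dissipation_starts_at[OF stable v ker] by blast
  interpret K: dissipation_free_kernel "energy u" "dissipation u" q by (rule kernel)
  let ?d = "pade_coeff q"
  define w where "w i = (\<Sum>k\<le>i. ?d k * r (i - k))" for i
  \<comment> \<open>Large enough for the product of R and Q, and for index 2q + 1 even when s = p =
    2q.\<close>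
  define N where "N = s + (2 * q + 1)"
  have w_low: "w i = (- 1) ^ i * ?d i" if "i \<le> 2 * q" for i
    using pade_numerator[OF that q(1)] that q by (simp add: w_def r)
  have "(- 1) ^ q * w (2 * q + 1) < 0"
  proof -
    define B where "B = real ((2 * q) choose q)"
    have B: "0 < B" by (simp add: B_def)
    define e where "e = fact (2 * q + 1) * r (2 * q + 1) - 1"
    \<comment> \<open>In degree 2q + 1 the coefficient of R R Q would see no other defect than e =
      c_(p+1) - 1, and in R Q it enters only through k = 0, where \<open>pade_coeff\<close> is 1;
      the rest is the Pade error.\<close>
    have "?d k * r (2 * q + 1 - k) = ?d k * (1 / fact (2 * q + 1 - k)) + (if k = 0 then e / fact (2 * q + 1) else 0)" for k
      using q by (cases "k = 0") (auto simp: r e_def field_simps simp del: fact_Suc)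
    then have "w (2 * q + 1) = (- 1) ^ q / (fact (2 * q + 1) * B) + e / fact (2 * q + 1)"
      unfolding w_def B_def pade_error[OF q(1), symmetric] by (simp only: sum.distrib) simp
    then have "(- 1) ^ q * w (2 * q + 1) * (fact (2 * q + 1) * B) = 1 + (- 1) ^ q * e * B"
      using B by (simp add: field_simps del: fact_Suc flip: power_add mult_2)
    also have "\<dots> < 0" using C by (simp only: e_def B_def)
    finally show ?thesis using B by (simp add: mult_less_0_iff del: fact_Suc)
  qed
  from K.energy_growth_even_order[OF q(1), of N ?d w, OF _ pos pade_coeff_0 pade_coeff_eq_0[OF _ q(1)] w_low this \<tau>0]
  obtain \<tau> where \<tau>: "0 < \<tau>" "\<tau> \<le> \<tau>0" and grow: "(\<Sum>j\<le>N. \<Sum>k\<le>N. \<tau> ^ (j + k) * (?d j * ?d k * energy u j k))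
      < (\<Sum>j\<le>N. \<Sum>k\<le>N. \<tau> ^ (j + k) * (w j * w k * energy u j k))" by (auto simp: N_def)
  let ?v = "lincomb n N (\<lambda>k. complex_of_real (\<tau> ^ k * ?d k)) (\<lambda>k. L ^\<^sub>m k *\<^sub>v u)"
  have step: "rk_step s a b L \<tau> ?v = lincomb n N (\<lambda>i. complex_of_real (\<tau> ^ i * w i)) (\<lambda>i. L ^\<^sub>m i *\<^sub>v u)"
    unfolding w_def by (rule rk_step_krylov_lincomb[OF u \<tau>(1), of q]) (use pade_coeff_eq_0[OF _ q(1)] in \<open>auto simp: N_def\<close>)
  have "re_inner ?v ?v < re_inner (rk_step s a b L \<tau> ?v) (rk_step s a b L \<tau> ?v)"
    unfolding step re_inner_krylov_lincomb[OF u] by (rule grow)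
  then show "\<exists>\<tau> v. 0 < \<tau> \<and> \<tau> \<le> \<tau>0 \<and> v \<in> carrier_vec n \<and> re_inner v v < re_inner (rk_step s a b L \<tau> v) (rk_step s a b L \<tau> v)"
    using \<tau> lincomb_carrier by blast
qed

end

section \<open>The hypocoercivity index and matrices of large index\<close>

text \<open>In orbit form, definiteness of \<open>hc_sum L m\<close> visibly persists for larger m.
  The set under the infimum is upward closed, so an infimum of at most m puts m itself into the
  set.\<close>

lemma hc_index_le_iff:
  assumes "semi_dissipative_mat n L"
  shows "hc_index L \<le> enat m \<longleftrightarrow> neg_definite (hc_sum L m)"
proof
  interpret semi_dissipative_mat n L by (rule assms)
  assume le: "hc_index L \<le> enat m"
  show "neg_definite (hc_sum L m)"
  proof (rule ccontr)
    assume "\<not> neg_definite (hc_sum L m)"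
    then have "enat (Suc m) \<le> enat k" if "neg_definite (hc_sum L k)" for k
      using that unfolding neg_definite_hc_sum_iff by (metis enat_ord_simps(1) not_less_eq_eq order_trans)
    then have "enat (Suc m) \<le> hc_index L" unfolding hc_index_def by (intro INF_greatest) auto
    then show False using le by (metis Suc_n_not_le_n enat_ord_simps(1) order_trans)
  qed
next
  assume "neg_definite (hc_sum L m)"
  then show "hc_index L \<le> enat m" unfolding hc_index_def by (intro INF_lower) auto
qed

text \<open>Only coordinate \<open>0\<close> is damped, and the last unit vector reaches it after \<open>N - 1\<close> applications of the matrix.\<close>

definition chain_mat :: "nat \<Rightarrow> complex mat" where
  "chain_mat N = mat N N (\<lambda>(i, j). if i = Suc j then 1 else if j = Suc i then - 1 else if i = 0 \<and> j = 0 then - 1 else 0)"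

lemma chain_mat_carrier [simp]: "chain_mat N \<in> carrier_mat N N"
  by (simp add: chain_mat_def)

lemma chain_mat_mult_vec:
  assumes v: "v \<in> carrier_vec N" and i: "i < N"
  shows "(chain_mat N *\<^sub>v v) $ i = (if i = 0 then - v $ 0 else v $ (i - 1)) - (if Suc i < N then v $ Suc i else 0)"
proof -
  have "chain_mat N $$ (i, j) * v $ j = (if j = (if i = 0 then 0 else i - 1) then (if i = 0 then - 1 else 1) * v $ j else 0)
      + (if j = Suc i then - v $ j else 0)" if "j < N" for j
    using i that by (auto simp: chain_mat_def)
  then have "(chain_mat N *\<^sub>v v) $ i = (\<Sum>j<N. (if j = (if i = 0 then 0 else i - 1) then (if i = 0 then - 1 else 1) * v $ j else 0)
      + (if j = Suc i then - v $ j else 0))"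
    unfolding mult_vec_index[OF chain_mat_carrier v i] by (intro sum.cong) auto
  then show ?thesis using i unfolding sum.distrib by (auto simp: sum.delta)
qed

lemma herm_part_chain_mat_mult_vec:
  assumes v: "v \<in> carrier_vec N" and i: "i < N"
  shows "(herm_part (chain_mat N) *\<^sub>v v) $ i = (if i = 0 then - v $ 0 else 0)"
proof -
  have "herm_part (chain_mat N) $$ (i, j) = (if i = 0 \<and> j = 0 then - 1 else 0)" if "j < N" for j
    unfolding herm_part_index[OF chain_mat_carrier i that] using i that by (simp add: chain_mat_def)
  then have "(herm_part (chain_mat N) *\<^sub>v v) $ i = (\<Sum>j<N. if j = 0 then if i = 0 then - v $ 0 else 0 else 0)"
    unfolding mult_vec_index[OF herm_part_carrier[OF chain_mat_carrier] v i]
    by (intro sum.cong refl) simp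
  then show ?thesis using i by (auto simp: sum.delta)
qed

lemma re_inner_herm_part_chain_mat:
  assumes v: "v \<in> carrier_vec N" and w: "w \<in> carrier_vec N" and N: "1 \<le> N"
  shows "re_inner (herm_part (chain_mat N) *\<^sub>v v) w = - Re (v $ 0 * cnj (w $ 0))"
proof -
  have "re_inner (herm_part (chain_mat N) *\<^sub>v v) w = (\<Sum>i<N. if i = 0 then - Re (v $ 0 * cnj (w $ 0)) else 0)"
    unfolding re_inner_sum[OF mult_mat_vec_carrier[OF herm_part_carrier[OF chain_mat_carrier] v] w]
    by (intro sum.cong refl) (simp add: herm_part_chain_mat_mult_vec[OF v] del: index_mult_mat_vec)
  then show ?thesis using N by simp
qed

lemma semi_dissipative_chain_mat:
  assumes N: "1 \<le> N"
  shows "semi_dissipative_mat N (chain_mat N)"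
proof
  let ?H = "herm_part (chain_mat N)"
  have H: "?H \<in> carrier_mat N N" by simp
  have sym: "re_inner (?H *\<^sub>v x) y = re_inner x (?H *\<^sub>v y)" if x: "x \<in> carrier_vec N" and y: "y \<in> carrier_vec N" for x y
    unfolding re_inner_commute[OF x mult_mat_vec_carrier[OF H y]]
      re_inner_herm_part_chain_mat[OF x y N] re_inner_herm_part_chain_mat[OF y x N]
    by (simp add: mult.commute)
  then have "hermitian ?H" unfolding hermitian_iff_re_inner[OF H] by blast
  moreover have "Re ((?H *\<^sub>v v) \<bullet>c v) \<le> 0" if v: "v \<in> carrier_vec N" for v
    using re_inner_herm_part_chain_mat[OF v v N] unfolding re_inner_def by simp
  ultimately show "semi_dissipative (chain_mat N)"
    using carrier_matD(1)[OF H] unfolding semi_dissipative_def neg_semidefinite_def by simp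
qed simp

text \<open>An eigenvector with zero coordinate 0 would vanish entirely, since each row of the
  eigenvalue equation determines the next coordinate from the previous two. Hence coordinate 0 is
  nonzero, and the damping there makes Re z negative.\<close>

lemma asymptotically_stable_chain_mat:
  assumes N: "1 \<le> N"
  shows "asymptotically_stable (chain_mat N)"
  unfolding asymptotically_stable_def
proof (intro allI impI)
  fix z assume "eigenvalue (chain_mat N) z"
  then obtain w where w: "w \<in> carrier_vec N" "w \<noteq> 0\<^sub>v N" and Lw: "chain_mat N *\<^sub>v w = z \<cdot>\<^sub>v w"
    unfolding eigenvalue_def eigenvector_def using carrier_matD(1)[OF chain_mat_carrier[of N]] by auto
  interpret semi_dissipative_mat N "chain_mat N" by (rule semi_dissipative_chain_mat[OF N])
  have row: "(if i = 0 then - w $ 0 else w $ (i - 1)) - (if Suc i < N then w $ Suc i else 0) = z * w $ i" if "i < N" for i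
    using chain_mat_mult_vec[OF w(1) that] that carrier_vecD[OF w(1)] unfolding Lw by (simp only: index_smult_vec)
  have "w $ 0 \<noteq> 0"
  proof
    assume w0: "w $ 0 = 0"
    have "i < N \<Longrightarrow> w $ i = 0" for i
    proof (induction i rule: less_induct)
      case (less i)
      show ?case
      proof (cases i)
        case (Suc j)
        have "w $ j = 0" "j \<noteq> 0 \<Longrightarrow> w $ (j - 1) = 0" using less Suc by auto
        then show ?thesis using row[of j] less.prems Suc w0 by (cases "j = 0") auto
      qed (simp add: w0)
    qed
    then have "w = 0\<^sub>v N" using w(1) by (intro eq_vecI) auto
    then show False using w(2) by simp
  qed
  then have "Re z * re_inner w w < 0"
    unfolding eigenvalue_Re[OF w(1) Lw] re_inner_herm_part_chain_mat[OF w(1) w(1) N]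
    by (simp add: complex_neq_0 power2_eq_square)
  then show "Re z < 0" using re_inner_self_pos[OF w] by (simp add: mult_less_0_iff)
qed

lemma chain_mat_in_L_AS: "1 \<le> N \<Longrightarrow> chain_mat N \<in> L_AS"
  using semi_dissipative_chain_mat asymptotically_stable_chain_mat
  unfolding L_AS_def semi_dissipative_mat_def by blast

lemma hc_index_chain_mat: "enat m < hc_index (chain_mat (m + 2))"
proof -
  let ?N = "m + 2"
  define v :: "complex vec" where "v = unit_vec ?N (Suc m)"
  have v: "v \<in> carrier_vec ?N" "v \<noteq> 0\<^sub>v ?N" by (simp_all add: v_def)
  interpret semi_dissipative_mat ?N "chain_mat ?N" by (rule semi_dissipative_chain_mat) simp
  \<comment> \<open>Propagation of one site per application: starting at site m + 1, the orbit
    cannot reach a site i with i + j \<le> m after j steps.\<close>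
  have supp: "(chain_mat ?N ^\<^sub>m j *\<^sub>v v) $ i = 0" if "i + j \<le> m" for i j
    using that
  proof (induction j arbitrary: i)
    case 0
    then show ?case unfolding pow_mat_mult_vec_0[OF L v(1)] by (simp add: v_def)
  next
    case (Suc j)
    have i: "i < ?N" using Suc.prems by simp
    show ?case
      unfolding pow_mat_mult_vec_Suc[OF L v(1)] chain_mat_mult_vec[OF krylov_carrier[OF v(1)] i]
      using Suc.IH[of 0] Suc.IH[of "i - 1"] Suc.IH[of "Suc i"] Suc.prems by simp
  qed
  have "herm_part (chain_mat ?N) *\<^sub>v (chain_mat ?N ^\<^sub>m j *\<^sub>v v) = 0\<^sub>v ?N" if j: "j \<le> m" for j
  proof (rule eq_vecI)
    fix i assume "i < dim_vec (0\<^sub>v ?N :: complex vec)"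
    then have i: "i < ?N" by simp
    show "(herm_part (chain_mat ?N) *\<^sub>v (chain_mat ?N ^\<^sub>m j *\<^sub>v v)) $ i = 0\<^sub>v ?N $ i"
      unfolding herm_part_chain_mat_mult_vec[OF krylov_carrier[OF v(1)] i]
      using supp[of 0 j] j i by (simp del: index_mult_mat_vec)
  qed (use carrier_matD(1)[OF H] in simp)
  then have "\<not> neg_definite (hc_sum (chain_mat ?N) m)" unfolding neg_definite_hc_sum_iff using v by blast
  then show ?thesis using hc_index_le_iff[OF semi_dissipative_mat_axioms] by (meson not_le)
qed

theorem theorem2:
  fixes s p :: nat
    and a :: "nat \<Rightarrow> nat \<Rightarrow> real" and b :: "nat \<Rightarrow> real"
    and c :: "nat \<Rightarrow> real"
    and R :: "complex poly"
  assumes "1 \<le> p" and "p \<le> s"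
    and "stability_function s a b R"
    and "\<And>z :: complex. poly R z =
           (\<Sum>j=0..p. z ^ j / fact j) + (\<Sum>j=p+1..s. complex_of_real (c j) * (z ^ j / fact j))"
    and "\<And>j. j \<ge> s + 1 \<Longrightarrow> c j = 0"
    and "c (p + 1) \<noteq> 1"
  shows "(\<forall>m::nat. 2 * m + 1 \<le> p \<longrightarrow> strongly_stable s a b (L_AS_hc m)) \<and>
         (condition_C p (c (p + 1)) \<longrightarrow> \<not> strongly_stable s a b L_AS) \<and>
         (condition_C p (c (p + 1)) \<longrightarrow>
            (\<forall>L \<in> L_AS. 2 * hc_index L + 1 > enat p \<longrightarrow> \<not> strongly_stable s a b {L}) \<and>
            (\<forall>m::nat. m \<ge> 1 \<and> 2 * m + 1 \<le> p \<longrightarrow>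
               strongly_stable s a b (L_AS_hc m) \<and>
               \<not> strongly_stable s a b (L_AS - L_AS_hc m)))"
proof -
  define r where "r j = (if j \<le> p then 1 else c j) / fact j" for j
  have scheme: "rk_scheme s a b R p r"
  proof
    have "R = (\<Sum>j\<le>s. monom (complex_of_real (r j)) j)"
    proof (rule poly_eq_poly_eq_iff[THEN iffD1], rule ext)
      fix z
      have "poly R z = (\<Sum>j=0..p. complex_of_real (r j) * z ^ j) + (\<Sum>j=p+1..s. complex_of_real (r j) * z ^ j)"
        unfolding assms(4) by (intro arg_cong2[of _ _ _ _ "(+)"] sum.cong refl) (auto simp: r_def)
      also have "\<dots> = (\<Sum>j\<le>s. complex_of_real (r j) * z ^ j)"
        using assms(2) sum.ub_add_nat[of 0 p "\<lambda>j. complex_of_real (r j) * z ^ j" "s - p"] by (simp add: atLeast0AtMost)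
      finally show "poly R z = poly (\<Sum>j\<le>s. monom (complex_of_real (r j)) j) z" by (simp add: poly_sum poly_monom)
    qed
    then show "coeff R j = complex_of_real (r j)" for j
      using assms(2,5) by (auto simp: coeff_sum r_def)
    show "r j = 1 / fact j" if "j \<le> p" for j using that by (simp add: r_def)
    show "r j = 0" if "s < j" for j using that assms(2,5) by (simp add: r_def)
  qed (use assms in auto)
  have scheme_mat: "rk_scheme_mat s a b R p r n L" if "1 \<le> n" "semi_dissipative_mat n L" for n L
    using scheme that by (simp add: rk_scheme_mat_def rk_scheme_mat_axioms_def)
  have L_ASD: "\<exists>n\<ge>1. semi_dissipative_mat n L \<and> asymptotically_stable L" if "L \<in> L_AS" for L
    using that unfolding L_AS_def semi_dissipative_mat_def by blast
  have stable: "strongly_stable s a b (L_AS_hc m)" if m: "2 * m + 1 \<le> p" for m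
    unfolding strongly_stable_def
  proof
    fix L assume "L \<in> L_AS_hc m"
    then obtain n where n: "1 \<le> n" "semi_dissipative_mat n L" and "hc_index L \<le> enat m"
      using L_ASD unfolding L_AS_hc_def by blast
    then have nd: "neg_definite (hc_sum L m)" using hc_index_le_iff by blast
    interpret rk_scheme_mat s a b R p r n L by (rule scheme_mat[OF n])
    show "\<exists>\<tau>0>0. \<forall>\<tau>. 0 < \<tau> \<and> \<tau> \<le> \<tau>0 \<longrightarrow>
        (\<forall>u\<in>carrier_vec (dim_row L). vec_norm2 (rk_step s a b L \<tau> u) \<le> vec_norm2 u)"
      by (rule strongly_stable_if_neg_definite[OF nd m])
  qed
  have unstable: "\<not> strongly_stable s a b {L}"
    if C: "condition_C p (c (p + 1))" and "L \<in> L_AS" and index: "2 * hc_index L + 1 > enat p" for L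
  proof -
    obtain n where nL: "1 \<le> n" "semi_dissipative_mat n L" and stable: "asymptotically_stable L"
      using L_ASD[OF \<open>L \<in> L_AS\<close>] by blast
    interpret rk_scheme_mat s a b R p r n L by (rule scheme_mat[OF nL])
    define q where "q = (p + 1) div 2"
    have q: "1 \<le> q" using assms(1) by (simp add: q_def)
    \<comment> \<open>q is p/2 rounded up, and 2k + 1 > p holds for a natural number k exactly if k
      \<ge> q.\<close>
    have "\<not> hc_index L \<le> enat (q - 1)"
    proof
      assume "hc_index L \<le> enat (q - 1)"
      then obtain k where k: "hc_index L = enat k" "k \<le> q - 1" by (cases "hc_index L") auto
      have "p < 2 * k + 1" using index unfolding k(1) by (simp add: numeral_eq_enat one_enat_def)
      then show False using k(2) q unfolding q_def by linarith
    qed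
    then have nd: "\<not> neg_definite (hc_sum L (q - 1))" using hc_index_le_iff[OF nL(2)] by blast
    have r_next: "fact (p + 1) * r (p + 1) = c (p + 1)" unfolding r_def by simp
    show ?thesis
    proof (cases "odd p")
      case True
      then have p: "p = 2 * q - 1" "p + 1 = 2 * q" unfolding q_def by presburger+
      have "(- 1) ^ q * (1 - c (p + 1)) < 0" using C True unfolding condition_C_def q_def by simp
      then have "0 < (- 1) ^ q * (fact (2 * q) * r (2 * q) - 1)"
        unfolding r_next[unfolded p(2)] p(2) by (simp add: algebra_simps)
      then show ?thesis by (rule not_strongly_stable_odd_order[OF stable nd q p(1)])
    next
      case False
      then have p: "p = 2 * q" unfolding q_def by presburger
      have "1 + (- 1) ^ q * (c (p + 1) - 1) * real (p choose q) < 0" using C False p unfolding condition_C_def by simp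
      then have "1 + (- 1) ^ q * (fact (2 * q + 1) * r (2 * q + 1) - 1) * real ((2 * q) choose q) < 0"
        unfolding r_next[unfolded p] unfolding p .
      then show ?thesis by (rule not_strongly_stable_even_order[OF stable nd q p])
    qed
  qed
  \<comment> \<open>One unstable member refutes strong stability of a set. The index of this chain
    exceeds p + m: exceeding p triggers instability, exceeding m keeps the matrix out of
    \<open>L_AS_hc m\<close>, so the same witness serves \<open>L_AS\<close> and every difference
    set.\<close>
  have unstable_set: "\<not> strongly_stable s a b S"
    if C: "condition_C p (c (p + 1))" and S: "chain_mat (p + m + 2) \<in> S" for S m
  proof -
    let ?L = "chain_mat (p + m + 2)"
    have "enat p < 2 * hc_index ?L + 1"
    proof (cases "hc_index ?L")
      case (enat k)
      then show ?thesis using hc_index_chain_mat[of "p + m"] by (simp add: numeral_eq_enat one_enat_def)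
    next
      case infinity
      have "2 * (\<infinity> :: enat) = \<infinity>" by (simp add: imult_is_infinity)
      then show ?thesis unfolding infinity by simp
    qed
    then have "\<not> strongly_stable s a b {?L}"
      by (intro unstable[OF C]) (simp_all add: chain_mat_in_L_AS)
    then show ?thesis using S unfolding strongly_stable_def by blast
  qed
  have "chain_mat (p + m + 2) \<in> L_AS - L_AS_hc m" for m
  proof -
    have "enat m \<le> enat (p + m)" by simp
    then have "enat m < hc_index (chain_mat (p + m + 2))" using hc_index_chain_mat[of "p + m"] by (rule le_less_trans)
    then show ?thesis unfolding L_AS_hc_def using chain_mat_in_L_AS[of "p + m + 2"] by (simp add: not_le)
  qed
  then show ?thesis using stable unstable unstable_set by blast
qed

end
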